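(* For every integer $g>0$ there exists a constant $C_g>0$, depending only on $g$, such that for every integer $n>2g$ the spectral gap $\gamma_{n,g}$ of the fixed genus chord swap chain on $\mathcal{X}_{n,g}$ satisfies $$\gamma_{n,g}\ \ge\ C_g\, n^{-1488g+616}.$$
   Context: Chord diagrams. Let $P$ be a regular polygon with $2n$ vertices, labelled clockwise $1,\dots,2n$ (indices modulo $2n$), and hence $2n$ sides $\{x,x+1\}$. A chord is an unordered pair of distinct sides. A chord diagram $X$ is a set of $n$ chords forming a perfect matching of the $2n$ sides of $P$. Genus. The genus of a chord diagram is the genus of the closed orientable surface obtained by gluing the sides of $P$ in pairs according to the chords, compatibly with orientation (a chord $\{\{x,x+1\},\{y,y+1\}\}$ identifies vertex $x$ with $y+1$ and vertex $y$ with $x+1$). Equivalently, if $V$ is the number of classes of vertices of $P$ after these identifications, the genus is $g=(n+1-V)/2$. $\mathcal{X}_{n,g}$ is the set of all chord diagrams with $n$ chords and genus $g$. Chord swap. $Y$ is a chord swap of $X$ if there are two distinct chords $\{A,B\},\{C,D\}\in X$ such that $Y=(X\setminus\{\{A,B\},\{C,D\}\})\cup\{\{A,C\},\{B,D\}\}$ or $Y=(X\setminus\{\{A,B\},\{C,D\}\})\cup\{\{A,D\},\{B,C\}\}$. The chain. The fixed genus chord swap chain on $\mathcal{X}_{n,g}$ is the Markov chain with transition kernel $P(X,Y)=\frac{1}{4\binom n2}$ if $Y$ is a chord swap of $X$ (with $X,Y\in\mathcal{X}_{n,g}$), $P(X,Y)=0$ for other $Y\ne X$, and $P(X,X)=1-\sum_{Z\in\mathcal{X}_{n,g}\setminus\{X\}}P(X,Z)$.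 It is symmetric, hence reversible with respect to the uniform distribution. Its spectral gap is $\gamma_{n,g}=1-\lambda_2$, where $\lambda_2$ is the second largest eigenvalue of $P$ (with multiplicity). *)

theory Defs
  imports Complex_Main "Jordan_Normal_Form.Char_Poly"
begin

text \<open>
  The vertices of the \<open>2n\<close>-gon are \<open>1, \<dots>, 2n\<close> in clockwise order. The side
  \<open>{x, x+1}\<close> (indices modulo \<open>2n\<close>) is represented by its first vertex \<open>x\<close>, so the set
  \<open>{1..2*n}\<close> serves both as the set of vertices and as the set of sides.
\<close>

definition polygon_vertices :: "nat \<Rightarrow> nat set" where
  "polygon_vertices n = {1..2 * n}"

definition polygon_sides :: "nat \<Rightarrow> nat set" where
  "polygon_sides n = {1..2 * n}"

definition next_vertex :: "nat \<Rightarrow> nat \<Rightarrow> nat" where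
  "next_vertex n x = (if x = 2 * n then 1 else x + 1)"

definition chords :: "nat \<Rightarrow> nat set set" where
  "chords n = {{a, b} | a b. a \<in> polygon_sides n \<and> b \<in> polygon_sides n \<and> a \<noteq> b}"

definition chord_diagram :: "nat \<Rightarrow> nat set set \<Rightarrow> bool" where
  "chord_diagram n X \<longleftrightarrow>
     X \<subseteq> chords n \<and> card X = n \<and> (\<forall>a\<in>polygon_sides n. \<exists>!c. c \<in> X \<and> a \<in> c)"

text \<open>
  A chord joining the sides \<open>{x, x+1}\<close> and \<open>{y, y+1}\<close> identifies \<open>x\<close> with \<open>y+1\<close> and
  \<open>y\<close> with \<open>x+1\<close>; both pairs occur below because \<open>{x, y} = {y, x}\<close>.
\<close>

definition glued_vertices :: "nat \<Rightarrow> nat set set \<Rightarrow> (nat \<times> nat) set" where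
  "glued_vertices n X = {(x, next_vertex n y) | x y. {x, y} \<in> X}"

definition vertex_equiv :: "nat \<Rightarrow> nat set set \<Rightarrow> (nat \<times> nat) set" where
  "vertex_equiv n X = (glued_vertices n X \<union> (glued_vertices n X)\<inverse>)\<^sup>*"

definition num_vertex_classes :: "nat \<Rightarrow> nat set set \<Rightarrow> nat" where
  "num_vertex_classes n X = card (polygon_vertices n // vertex_equiv n X)"

text \<open>
  The glued surface has a cell structure with \<open>V\<close> vertices, \<open>n\<close> edges and one face, so
  \<open>2 - 2g = V - n + 1\<close>. The value is a real number in order to avoid truncation.
\<close>

definition genus :: "nat \<Rightarrow> nat set set \<Rightarrow> real" where
  "genus n X = (real n + 1 - real (num_vertex_classes n X)) / 2"

definition diagrams :: "nat \<Rightarrow> nat \<Rightarrow> nat set set set" where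
  "diagrams n g = {X. chord_diagram n X \<and> genus n X = real g}"

definition chord_swap :: "nat set set \<Rightarrow> nat set set \<Rightarrow> bool" where
  "chord_swap X Y \<longleftrightarrow>
     (\<exists>a b c d. {a, b} \<in> X \<and> {c, d} \<in> X \<and> {a, b} \<noteq> {c, d} \<and>
        (Y = (X - {{a, b}, {c, d}}) \<union> {{a, c}, {b, d}} \<or>
         Y = (X - {{a, b}, {c, d}}) \<union> {{a, d}, {b, c}}))"

definition swap_prob :: "nat \<Rightarrow> nat set set \<Rightarrow> nat set set \<Rightarrow> real" where
  "swap_prob n X Y = (if chord_swap X Y then 1 / (4 * real (n choose 2)) else 0)"

definition swap_kernel :: "nat \<Rightarrow> nat \<Rightarrow> nat set set \<Rightarrow> nat set set \<Rightarrow> real" where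
  "swap_kernel n g X Y =
     (if Y = X then 1 - (\<Sum>Z \<in> diagrams n g - {X}. swap_prob n X Z) else swap_prob n X Y)"

text \<open>
  The transition matrix of a kernel on a finite state space. It depends on the chosen
  enumeration of the states only up to a simultaneous permutation of rows and columns,
  so its characteristic polynomial does not depend on it.
\<close>

definition enumeration :: "'s set \<Rightarrow> 's list" where
  "enumeration S = (SOME xs. set xs = S \<and> distinct xs)"

definition transition_matrix :: "'s set \<Rightarrow> ('s \<Rightarrow> 's \<Rightarrow> real) \<Rightarrow> real mat" where
  "transition_matrix S p =
     mat (card S) (card S) (\<lambda>(i, j). p (enumeration S ! i) (enumeration S ! j))"

text \<open>
  The real eigenvalues in decreasing order, repeated according to multiplicity as roots of
  the characteristic polynomial. For a symmetric matrix these are all the eigenvalues, and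
  the multiplicities are the dimensions of the eigenspaces. The second largest eigenvalue
  is meaningful for matrices of dimension at least two.
\<close>

definition eigenvalues_desc :: "real mat \<Rightarrow> real list" where
  "eigenvalues_desc A = rev (sorted_list_of_multiset (proots (char_poly A)))"

definition second_largest_eigenvalue :: "real mat \<Rightarrow> real" where
  "second_largest_eigenvalue A = eigenvalues_desc A ! 1"

definition spectral_gap :: "nat \<Rightarrow> nat \<Rightarrow> real" where
  "spectral_gap n g =
     1 - second_largest_eigenvalue (transition_matrix (diagrams n g) (swap_kernel n g))"

end

theory Submission
  imports Defs "HOL-Combinatorics.Cycles" "HOL-Combinatorics.Orbits" "HOL-Library.Sublist" "HOL-Analysis.L2_Norm"
begin

unbundle no m_inv_syntax

text \<open>
  A chord diagram is a fixed-point-free involution \<open>s\<close> on the letters of a cyclic word; if \<open>c\<close> is the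
  cyclic successor, the glued vertices are the cycles of \<open>c \<circ> s\<close>. The Poincare inequality is proved by induction on the genus.

  Suppose \<open>{p1, p3}\<close> and \<open>{p2, p4}\<close> are crossing chords in the word \<open>p1 B p2 C p3 D p4 E\<close>. Bypassing these four
  letters in the cycles of \<open>c \<circ> s\<close> leaves the vertices of the remaining chords on the cyclic word \<open>D C B E\<close>.
  Hence the diagrams of genus \<open>g\<close> containing the two chords are in bijection with all diagrams of genus \<open>g - 1\<close> with two chords
  less, and swaps go to swaps. These classes all have the same size and cover the diagrams of genus \<open>g\<close>. Neighbouring
  classes are linked through a polynomially large part by swaps or by common elements, and the links connect all classes,
  so that each genus costs a factor that is polynomial in \<open>n\<close>.

  In genus 0 the diagrams are the non-crossing matchings, that is, Dyck paths, and flipping a corner of the path is a chord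
  swap. Path coupling with the weight \<open>i (2n - i)\<close> at position \<open>i\<close> contracts the Lipschitz constant, and
  log-convexity of the norms of the iterates turns this into contraction in mean square.
\<close>

section \<open>Orbits and transpositions\<close>

text \<open>The induction runs at a fixed number \<open>v = n + 1 - 2 g\<close> of vertices:
  deleting a crossing pair lowers \<open>n\<close> by two and the genus by one and leaves
  \<open>v\<close> alone. The condition \<open>n > 2 g\<close> says \<open>v \<ge> 2\<close>. It is
  needed because some links only carry gluings whose core has a leaf at a prescribed place, and
  cutting off this leaf costs one vertex. Such gluings fill a fraction of at least
  \<open>1 / (2 n)^2\<close> of a class; this follows by contracting a chord between two distinct
  vertices.

  The obstacle to connecting the classes is parity. Moving an end of a chord past a leaf shifts it
  by two letters, so the parities of the four arcs persist. Shifts by one letter and the passage to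
  a parallel chord exist only in special positions, into which the arcs have to be brought first.

  With \<open>m = 2 n\<close>, the cover by at most \<open>m^4\<close> classes costs
  \<open>4 (m^4)^6\<close> and a link costs \<open>9 m^2\<close>, so one genus costs
  \<open>36 m^26 \<le> m^28\<close>. Dyck paths contribute \<open>m^3\<close> and the swap
  probability \<open>n^2\<close>. The resulting exponent \<open>28 g + 5\<close> stays below
  \<open>1488 g - 616\<close> for every \<open>g \<ge> 1\<close>.\<close>

abbreviation swp :: "'a \<Rightarrow> 'a \<Rightarrow> 'a \<Rightarrow> 'a" where
  "swp \<equiv> Transposition.transpose"

definition num_orbits :: "'a set \<Rightarrow> ('a \<Rightarrow> 'a) \<Rightarrow> nat" where
  "num_orbits S f = card (orbit f ` S)"

lemma permutes_self_in_orbit: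
  assumes "finite S" "f permutes S"
  shows "x \<in> orbit f x"
proof -
  have "permutation f" unfolding permutation_permutes using assms by blast
  then show ?thesis by (rule permutation_self_in_orbit)
qed

lemma orbit_eq_of_mem:
  assumes "finite S" "f permutes S" "y \<in> orbit f x"
  shows "orbit f y = orbit f x"
proof -
  have "cyclic_on f (orbit f x)" using assms(1,2) by (intro cyclic_on_orbit)
  then show ?thesis using assms(3) by (rule orbit_cyclic_eq3)
qed

text \<open>The least positive hitting time also excludes an earlier return to \<open>x\<close>: a
  return at time \<open>j\<close> would make \<open>k - j\<close> a smaller hitting time.\<close>

lemma first_hit:
  assumes "finite S" "f permutes S" "u \<in> orbit f x"
  obtains k where "0 < k" "(f ^^ k) x = u" "\<And>j. 0 < j \<Longrightarrow> j < k \<Longrightarrow> (f ^^ j) x \<noteq> u \<and> (f ^^ j) x \<noteq> x"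
proof -
  have ex: "\<exists>k. 0 < k \<and> (f ^^ k) x = u"
    using assms(3) by (auto simp: orbit_altdef)
  define k where "k = (LEAST k. 0 < k \<and> (f ^^ k) x = u)"
  have k: "0 < k" "(f ^^ k) x = u"
    using LeastI_ex[OF ex] by (auto simp: k_def)
  have least: "(f ^^ j) x \<noteq> u" if "0 < j" "j < k" for j
    using that not_less_Least[of j "\<lambda>k. 0 < k \<and> (f ^^ k) x = u"] by (auto simp: k_def)
  have "(f ^^ j) x \<noteq> x" if "0 < j" "j < k" for j
  proof
    assume "(f ^^ j) x = x"
    then have "(f ^^ (k - j)) x = u"
      using k(2) that by (metis funpow_add le_add_diff_inverse2 less_imp_le o_apply)
    then show False using least[of "k - j"] that by auto
  qed
  with k least that show thesis by blast
qed

lemma orbit_subset_period: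
  assumes "0 < k" "(g ^^ k) x = x"
  shows "orbit g x \<subseteq> {(g ^^ j) x |j. 0 < j \<and> j \<le> k}"
proof
  fix z assume "z \<in> orbit g x"
  then have "\<exists>j. 0 < j \<and> j \<le> k \<and> z = (g ^^ j) x"
  proof induction
    case base
    show ?case using assms(1) by (intro exI[of _ 1]) auto
  next
    case (step z)
    then obtain j where j: "0 < j" "j \<le> k" "z = (g ^^ j) x" by blast
    show ?case
    proof (cases "j = k")
      case True
      then show ?thesis using assms j by (intro exI[of _ 1]) auto
    next
      case False
      then show ?thesis using j by (intro exI[of _ "Suc j"]) auto
    qed
  qed
  then show "z \<in> {(g ^^ j) x |j. 0 < j \<and> j \<le> k}" by blast
qed

text \<open>\<open>f \<circ> swp x y\<close> sends \<open>x\<close> to \<open>f y\<close> and from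
  there on agrees with \<open>f\<close> until one of the two exchanged points is met.\<close>

lemma funpow_swp:
  assumes "0 < j" "\<And>i. 0 < i \<Longrightarrow> i < j \<Longrightarrow> (f ^^ i) y \<noteq> x \<and> (f ^^ i) y \<noteq> y"
  shows "((f \<circ> swp x y) ^^ j) x = (f ^^ j) y"
  using assms
proof (induction j)
  case (Suc j)
  show ?case
  proof (cases "j = 0")
    case False
    have "(f ^^ j) y \<noteq> x" "(f ^^ j) y \<noteq> y" using Suc.prems(2)[of j] False by auto
    then have "(f \<circ> swp x y) ((f ^^ j) y) = f ((f ^^ j) y)" by simp
    moreover have "((f \<circ> swp x y) ^^ j) x = (f ^^ j) y"
      using Suc.prems False by (intro Suc.IH) auto
    ultimately show ?thesis by (metis funpow.simps(2) o_apply)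
  qed auto
qed auto

text \<open>The new orbit of \<open>x\<close> follows the old path from \<open>y\<close> to its
  first visit of \<open>x\<close> and closes up there, before it could reach
  \<open>y\<close>.\<close>

lemma orbit_swp_same:
  assumes S: "finite S" "f permutes S" and xy: "x \<in> S" "y \<in> S" "x \<noteq> y"
    and same: "x \<in> orbit f y"
  shows "y \<notin> orbit (f \<circ> swp x y) x"
proof
  obtain k where k: "0 < k" "(f ^^ k) y = x"
      "\<And>j. 0 < j \<Longrightarrow> j < k \<Longrightarrow> (f ^^ j) y \<noteq> x \<and> (f ^^ j) y \<noteq> y"
    using first_hit[OF S same] by metis
  have pow: "((f \<circ> swp x y) ^^ j) x = (f ^^ j) y" if "0 < j" "j \<le> k" for j
    using that k(3) by (intro funpow_swp) auto
  assume "y \<in> orbit (f \<circ> swp x y) x"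
  then obtain j where "0 < j" "j \<le> k" "y = (f ^^ j) y"
    using orbit_subset_period[of k "f \<circ> swp x y" x] pow k by auto
  then show False using k xy by (metis le_neq_implies_less)
qed

text \<open>The new orbit of \<open>x\<close> runs once around the old cycle of \<open>y\<close>, on
  which \<open>x\<close> does not occur, and so arrives at \<open>y\<close>.\<close>

lemma orbit_swp_diff:
  assumes S: "finite S" "f permutes S" and xy: "x \<in> S" "y \<in> S"
    and diff: "x \<notin> orbit f y"
  shows "y \<in> orbit (f \<circ> swp x y) x"
proof -
  have "y \<in> orbit f y" using S permutes_self_in_orbit by metis
  from first_hit[OF S this] obtain k where k: "0 < k" "(f ^^ k) y = y"
      "\<And>j. 0 < j \<Longrightarrow> j < k \<Longrightarrow> (f ^^ j) y \<noteq> y"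
    by metis
  have "(f ^^ j) y \<noteq> x" if "0 < j" for j
    using diff that unfolding orbit_altdef by blast
  then have "((f \<circ> swp x y) ^^ k) x = (f ^^ k) y"
    using k by (intro funpow_swp) metis+
  then have "((f \<circ> swp x y) ^^ k) x = y" using k by metis
  moreover have "((f \<circ> swp x y) ^^ k) x \<in> orbit (f \<circ> swp x y) x"
    using k(1) unfolding orbit_altdef by blast
  ultimately show ?thesis by metis
qed

text \<open>Away from \<open>x\<close> and \<open>y\<close> the two maps agree, so only the cycles
  through these two points change, and by \<open>orbit_swp_diff\<close> they become one.\<close>

lemma num_orbits_merge:
  assumes S: "finite S" "f permutes S" and xy: "x \<in> S" "y \<in> S"
    and diff: "x \<notin> orbit f y"
  shows "num_orbits S f = Suc (num_orbits S (f \<circ> swp x y))"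
proof -
  define g where "g = f \<circ> swp x y"
  have g: "g x = f y" "g y = f x" by (auto simp: g_def)
  have gS: "g permutes S"
    using S xy unfolding g_def by (intro permutes_compose permutes_swap_id)
  have eqf: "b \<in> orbit f a \<Longrightarrow> orbit f b = orbit f a" for a b
    using S orbit_eq_of_mem by metis
  have eqg: "b \<in> orbit g a \<Longrightarrow> orbit g b = orbit g a" for a b
    using S(1) gS orbit_eq_of_mem by metis
  have selff: "a \<in> orbit f a" for a using S permutes_self_in_orbit by metis
  have selfg: "a \<in> orbit g a" for a using S(1) gS permutes_self_in_orbit by metis
  have fg: "g a = f a" if "a \<noteq> x" "a \<noteq> y" for a using that by (auto simp: g_def)
  have disj: "orbit f x \<noteq> orbit f y" using diff selff by blast
  have xyg: "orbit g y = orbit g x" using orbit_swp_diff[OF S xy diff, folded g_def] eqg by metis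
  have fx: "f a \<in> orbit g a" for a
  proof (cases "a = x \<or> a = y")
    case True
    have "f x \<in> orbit g y" "f y \<in> orbit g x"
      using orbit.base[of g y] orbit.base[of g x] g by auto
    then show ?thesis using True xyg by metis
  next
    case False
    then show ?thesis using orbit.base[of g a] fg by auto
  qed
  have sub1: "orbit f a \<subseteq> orbit g a" for a
  proof
    fix b assume "b \<in> orbit f a"
    then show "b \<in> orbit g a"
    proof induction
      case base
      show ?case by (rule fx)
    next
      case (step b)
      show ?case using fx[of b] eqg[OF step(2)] by simp
    qed
  qed
  have gx: "g b \<in> orbit f b \<or> (g b \<in> orbit f x \<union> orbit f y \<and> b \<in> {x, y})" for b
    using g orbit.base[of f b] fg[of b] orbit.base[of f x] orbit.base[of f y] by (cases "b = x"; cases "b = y") auto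
  have sub2: "orbit g a \<subseteq> orbit f a" if "a \<notin> orbit f x" "a \<notin> orbit f y" for a
  proof
    fix b assume "b \<in> orbit g a"
    then show "b \<in> orbit f a"
    proof induction
      case base
      then show ?case using gx[of a] that selff by blast
    next
      case (step b)
      then show ?case using gx[of b] that selff eqf by blast
    qed
  qed
  have sub3: "orbit g x \<subseteq> orbit f x \<union> orbit f y"
  proof
    fix b assume "b \<in> orbit g x"
    then show "b \<in> orbit f x \<union> orbit f y"
    proof induction
      case base
      then show ?case using orbit.base[of f y] g by auto
    next
      case (step b)
      then show ?case using gx[of b] eqf by blast
    qed
  qed
  let ?R = "orbit f ` S - {orbit f x, orbit f y}"
  have join: "orbit g x = orbit f x \<union> orbit f y"
    using sub1[of x] sub1[of y] sub3 xyg by blast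
  have "orbit g ` S = insert (orbit g x) ?R"
  proof (intro subset_antisym subsetI)
    fix A assume "A \<in> orbit g ` S"
    then obtain a where a: "a \<in> S" "A = orbit g a" by auto
    show "A \<in> insert (orbit g x) ?R"
    proof (cases "a \<in> orbit f x \<or> a \<in> orbit f y")
      case True
      then have "a \<in> orbit g x" using join by auto
      then have "orbit g a = orbit g x" by (rule eqg)
      then show ?thesis using a by simp
    next
      case False
      then have "orbit g a = orbit f a" using sub1 sub2 by blast
      moreover have "orbit f a \<noteq> orbit f x" "orbit f a \<noteq> orbit f y"
        using False selff by blast+
      ultimately show ?thesis using a by auto
    qed
  next
    fix A assume "A \<in> insert (orbit g x) ?R"
    then consider "A = orbit g x" | a where "a \<in> S" "A = orbit f a" "A \<noteq> orbit f x" "A \<noteq> orbit f y"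
      by auto
    then show "A \<in> orbit g ` S"
    proof cases
      case 2
      then have "a \<notin> orbit f x" "a \<notin> orbit f y" using eqf by metis+
      then have "orbit g a = orbit f a" using sub1 sub2 by blast
      then show ?thesis using 2 by auto
    qed (use xy in auto)
  qed
  moreover have "orbit g x \<notin> ?R"
  proof
    assume "orbit g x \<in> ?R"
    then obtain a where "orbit f x \<union> orbit f y = orbit f a" using join by auto
    then have "x \<in> orbit f a" "y \<in> orbit f a" using selff by blast+
    then show False using eqf disj by metis
  qed
  ultimately have "num_orbits S g = Suc (card ?R)"
    using S(1) by (simp add: num_orbits_def)
  moreover have "card (orbit f ` S) = card ?R + 2"
  proof -
    have "orbit f ` S = insert (orbit f x) (insert (orbit f y) ?R)" using xy by auto
    moreover have "card (insert (orbit f x) (insert (orbit f y) ?R)) = card ?R + 2"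
      using S(1) disj by auto
    ultimately show ?thesis by simp
  qed
  ultimately show ?thesis by (simp add: num_orbits_def g_def)
qed

text \<open>A second composition with the transposition undoes the first, so this is the joining
  lemma read backwards.\<close>

lemma num_orbits_split:
  assumes S: "finite S" "f permutes S" and xy: "x \<in> S" "y \<in> S" "x \<noteq> y"
    and same: "x \<in> orbit f y"
  shows "num_orbits S (f \<circ> swp x y) = Suc (num_orbits S f)"
proof -
  have gS: "f \<circ> swp x y permutes S"
    using S xy by (intro permutes_compose permutes_swap_id)
  have "x \<notin> orbit (f \<circ> swp x y) y"
  proof
    assume "x \<in> orbit (f \<circ> swp x y) y"
    then have "orbit (f \<circ> swp x y) x = orbit (f \<circ> swp x y) y"
      by (rule orbit_eq_of_mem[OF S(1) gS])
    with permutes_self_in_orbit[OF S(1) gS, of y] orbit_swp_same[OF S xy same]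
    show False by metis
  qed
  from num_orbits_merge[OF S(1) gS xy(1,2) this] show ?thesis
    by (metis comp_assoc transpose_comp_involutory comp_id)
qed

lemma num_orbits_insert_fixed:
  assumes "finite S" "f permutes S" "x \<notin> S"
  shows "num_orbits (insert x S) f = Suc (num_orbits S f)"
proof -
  have "f x = x" using assms(2,3) by (simp add: permutes_def)
  then have "orbit f x = {x}" by (simp add: orbit_eq_singleton_iff)
  moreover have "orbit f a \<subseteq> S" if "a \<in> S" for a
    using that assms(2) by (simp add: permutes_orbit_subset)
  ultimately have "orbit f x \<notin> orbit f ` S" using assms(3) by auto
  then show ?thesis using assms(1) by (simp add: num_orbits_def)
qed

lemma orbit_conj:
  assumes "bij b"
  shows "orbit (b \<circ> f \<circ> inv b) (b x) = b ` orbit f x"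
proof -
  have "((b \<circ> f \<circ> inv b) ^^ n) (b x) = b ((f ^^ n) x)" for n
    using assms by (induction n) (auto simp: bij_is_inj)
  then show ?thesis by (auto simp: orbit_altdef)
qed

lemma num_orbits_conj:
  assumes "bij b"
  shows "num_orbits (b ` S) (b \<circ> f \<circ> inv b) = num_orbits S f"
proof -
  have "orbit (b \<circ> f \<circ> inv b) ` b ` S = (`) b ` (orbit f ` S)"
    by (simp add: image_image orbit_conj[OF assms] del: o_apply)
  moreover have "inj ((`) b)" using assms by (auto intro!: injI simp: inj_image_eq_iff bij_is_inj)
  ultimately show ?thesis by (simp add: num_orbits_def card_image inj_on_subset)
qed

section \<open>Cyclic words\<close>

lemma conj_swp_cycle:
  assumes "distinct (x # B)" "y \<notin> set B"
  shows "swp x y \<circ> cycle_of_list (y # B) \<circ> swp x y = cycle_of_list (x # B)"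
proof (cases "x = y")
  case False
  have "map (swp x y) B = B"
    using assms by (intro map_idI) (metis distinct.simps(2) transpose_apply_other)
  moreover have "distinct (y # B)" using assms by simp
  ultimately show ?thesis
    using conjugation_of_cycle[of "y # B" "swp x y"] by simp
qed auto

text \<open>Multiplying a cycle by a transposition of two of its letters cuts the cyclic word at
  these letters. The induction peels off the first letter \<open>a\<close> of \<open>A\<close>,
  since the cycle of \<open>x # a # w\<close> is \<open>swp x a\<close> times the cycle of
  \<open>a # w\<close>.\<close>

lemma cycle_split:
  assumes "distinct (x # A @ y # B)"
  shows "cycle_of_list (x # A @ y # B) \<circ> swp x y = cycle_of_list (x # B) \<circ> cycle_of_list (y # A)"
  using assms
proof (induction A arbitrary: x)
  case Nil
  then have "swp x y \<circ> cycle_of_list (y # B) \<circ> swp x y = cycle_of_list (x # B)"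
    by (intro conj_swp_cycle) auto
  then show ?case by (simp only: append_Nil cycle_of_list.simps comp_id)
next
  case (Cons a A)
  have IH: "cycle_of_list (a # A @ y # B) \<circ> swp a y = cycle_of_list (a # B) \<circ> cycle_of_list (y # A)"
    using Cons.prems by (intro Cons.IH) auto
  have 1: "cycle_of_list (x # B) = swp x a \<circ> cycle_of_list (a # B) \<circ> swp x a"
    using conj_swp_cycle[of x B a] Cons.prems by simp
  have 2: "cycle_of_list (a # A) = swp a y \<circ> cycle_of_list (y # A) \<circ> swp a y"
    using conj_swp_cycle[of a A y] Cons.prems by simp
  have 3: "swp a y \<circ> swp x y = swp x a \<circ> swp a y"
    using Cons.prems by (auto simp: fun_eq_iff transpose_def)
  have 4: "cycle_of_list (y # A) \<circ> swp x a = swp x a \<circ> cycle_of_list (y # A)"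
    using cycles_commute[of "y # A" "[x, a]"] Cons.prems by simp
  have 5: "swp y a \<circ> swp a y = id" by (simp add: transpose_commute[of y a])
  have 6: "cycle_of_list (a # A @ y # B) = cycle_of_list (a # B) \<circ> cycle_of_list (y # A) \<circ> swp a y"
    unfolding IH[symmetric] by (simp add: fun_eq_iff)
  have "cycle_of_list (x # (a # A) @ y # B) \<circ> swp x y
      = swp x a \<circ> cycle_of_list (a # B) \<circ> cycle_of_list (y # A) \<circ> (swp a y \<circ> swp x y)"
    by (simp add: 6 comp_assoc)
  also have "\<dots> = swp x a \<circ> cycle_of_list (a # B) \<circ> (cycle_of_list (y # A) \<circ> swp x a) \<circ> swp a y"
    by (simp only: 3 comp_assoc)
  also have "\<dots> = (swp x a \<circ> cycle_of_list (a # B) \<circ> swp x a) \<circ> (swp y a \<circ> swp a y) \<circ> cycle_of_list (y # A) \<circ> swp a y"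
    by (simp only: 4 5 comp_assoc comp_id id_comp)
  also have "\<dots> = cycle_of_list (x # B) \<circ> (swp y a \<circ> cycle_of_list (a # A))"
    by (simp only: 1 2 comp_assoc)
  finally show ?case by (simp only: append_Cons cycle_of_list.simps)
qed

lemma cycle_rotate_append:
  assumes "distinct (A @ B)"
  shows "cycle_of_list (B @ A) = cycle_of_list (A @ B)"
  using cycle_of_list_rotate_independent[OF assms, of "length A"] by (simp add: rotate_append)

text \<open>The first transposition cuts the cycle in two, with \<open>p2\<close> in one piece and
  \<open>p4\<close> in the other, and the second joins the pieces again. This return to a single
  word is what distinguishes crossing chords; two chords that do not cross would leave three
  pieces.\<close>

lemma cycle_cross:
  assumes d: "distinct (p1 # B @ p2 # C @ p3 # D @ p4 # E)"
  shows "cycle_of_list (p1 # B @ p2 # C @ p3 # D @ p4 # E) \<circ> swp p1 p3 \<circ> swp p2 p4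
       = cycle_of_list (p1 # D @ p4 # C @ p3 # B @ p2 # E)"
proof -
  have d': "distinct (p4 # (C @ p3 # B) @ p2 # (E @ p1 # D))" using d by auto
  have "cycle_of_list (p1 # B @ p2 # C @ p3 # D @ p4 # E) \<circ> swp p1 p3
      = cycle_of_list (p1 # D @ p4 # E) \<circ> cycle_of_list (p3 # B @ p2 # C)"
    using cycle_split[of p1 "B @ p2 # C" p3 "D @ p4 # E"] d by simp
  also have "cycle_of_list (p1 # D @ p4 # E) = cycle_of_list (p4 # E @ p1 # D)"
    using cycle_rotate_append[of "p4 # E" "p1 # D"] d by auto
  also have "cycle_of_list (p3 # B @ p2 # C) = cycle_of_list (p2 # C @ p3 # B)"
    using cycle_rotate_append[of "p2 # C" "p3 # B"] d by auto
  also have "cycle_of_list (p4 # E @ p1 # D) \<circ> cycle_of_list (p2 # C @ p3 # B)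
     = cycle_of_list (p4 # (C @ p3 # B) @ p2 # (E @ p1 # D)) \<circ> swp p4 p2"
    using cycle_split[OF d', symmetric] by simp
  also have "cycle_of_list (p4 # (C @ p3 # B) @ p2 # (E @ p1 # D)) = cycle_of_list (p1 # D @ p4 # C @ p3 # B @ p2 # E)"
    using cycle_rotate_append[of "p1 # D" "p4 # C @ p3 # B @ p2 # E"] d by auto
  finally have "cycle_of_list (p1 # B @ p2 # C @ p3 # D @ p4 # E) \<circ> swp p1 p3 =
    cycle_of_list (p1 # D @ p4 # C @ p3 # B @ p2 # E) \<circ> swp p4 p2" .
  then show ?thesis by (simp only: transpose_commute[of p4 p2] comp_assoc transpose_comp_involutory comp_id)
qed

text \<open>The empty word glues to a sphere with a single vertex, hence the value 1.\<close>

definition num_vertices :: "'a list \<Rightarrow> ('a \<Rightarrow> 'a) \<Rightarrow> nat" where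
  "num_vertices xs r = (if xs = [] then 1 else num_orbits (set xs) (cycle_of_list xs \<circ> r))"

lemma num_vertices_rotate_append:
  assumes "distinct (A @ B)"
  shows "num_vertices (B @ A) r = num_vertices (A @ B) r"
  using cycle_rotate_append[OF assms] by (auto simp: num_vertices_def Un_commute)

text \<open>Putting \<open>x\<close> in front multiplies the successor map by the transposition of
  \<open>x\<close> with the last letter. As a fixed point \<open>x\<close> adds one orbit, and the
  transposition joins this orbit to another one, so the two effects cancel. For empty
  \<open>ys\<close> the value 1 given to the empty word is exactly what is needed.\<close>

lemma num_vertices_Cons:
  assumes d: "distinct (x # ys)" and r: "r permutes set ys"
  shows "num_vertices (x # ys) r = num_vertices ys r"
proof (cases ys rule: rev_cases)
  case Nil
  then have "r = id" using r by simp
  moreover have "orbit id x = {x}" by (simp add: orbit_eq_singleton_iff)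
  ultimately show ?thesis using Nil by (simp add: num_vertices_def num_orbits_def)
next
  case (snoc A y)
  let ?f = "cycle_of_list ys \<circ> r"
  \<comment> \<open>Moving the transposition of \<open>x\<close> and \<open>y\<close> to the right
    of \<open>r\<close> turns it into the transposition of \<open>x\<close> and the preimage of
    \<open>y\<close>.\<close>
  define u where "u = inv r y"
  have u: "u \<in> set ys" using r snoc by (metis in_set_conv_decomp permutes_in_image permutes_inv u_def)
  have f: "?f permutes set ys" using r cycle_permutes permutes_compose by blast
  have fi: "?f permutes insert x (set ys)" using f by (rule permutes_imp_permutes_insert)
  have rx: "inv r x = x" using r d by (metis distinct.simps(2) permutes_inv permutes_not_in)
  have "cycle_of_list (x # A @ [y]) \<circ> swp x y = cycle_of_list (y # A)"
    using cycle_split[of x A y "[]"] d snoc by simp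
  also have "\<dots> = cycle_of_list ys"
    using cycle_rotate_append[of A "[y]"] d snoc by simp
  finally have "cycle_of_list (x # ys) = cycle_of_list ys \<circ> swp x y"
    unfolding snoc by (auto simp: fun_eq_iff) (metis transpose_involutory)
  then have "cycle_of_list (x # ys) \<circ> r = ?f \<circ> swp x u"
    using transpose_comp_eq[of r x y] permutes_bij[OF r] rx by (simp add: comp_assoc u_def)
  moreover have "x \<notin> orbit ?f u"
    using permutes_orbit_subset[OF f u] d by auto
  then have "num_orbits (insert x (set ys)) ?f = Suc (num_orbits (insert x (set ys)) (?f \<circ> swp x u))"
    using fi u by (intro num_orbits_merge) auto
  moreover have "num_orbits (insert x (set ys)) ?f = Suc (num_orbits (set ys) ?f)"
    using d f by (intro num_orbits_insert_fixed) auto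
  ultimately show ?thesis using snoc by (simp add: num_vertices_def)
qed

lemma num_vertices_remove:
  assumes d: "distinct (A @ x # B)" and r: "r permutes set (A @ B)"
  shows "num_vertices (A @ x # B) r = num_vertices (A @ B) r"
proof -
  have "num_vertices (A @ x # B) r = num_vertices (x # B @ A) r"
    using num_vertices_rotate_append[of A "x # B" r] d by simp
  also have "\<dots> = num_vertices (B @ A) r"
    using d r by (intro num_vertices_Cons) (auto simp: Un_commute)
  finally show ?thesis using num_vertices_rotate_append[of A B r] d by simp
qed

text \<open>After \<open>cycle_cross\<close> the four letters are fixed points of \<open>r\<close>
  in a single cyclic word, and fixed letters can be deleted one by one.\<close>

lemma num_vertices_crossing:
  assumes d: "distinct (p1 # B @ p2 # C @ p3 # D @ p4 # E)" and r: "r permutes set (D @ C @ B @ E)"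
  shows "num_vertices (p1 # B @ p2 # C @ p3 # D @ p4 # E) (swp p1 p3 \<circ> swp p2 p4 \<circ> r) = num_vertices (D @ C @ B @ E) r"
proof -
  have "num_vertices (p1 # B @ p2 # C @ p3 # D @ p4 # E) (swp p1 p3 \<circ> swp p2 p4 \<circ> r)
    = num_vertices (p1 # D @ p4 # C @ p3 # B @ p2 # E) r"
    using cycle_cross[OF d] by (simp add: num_vertices_def comp_assoc[symmetric] insert_commute Un_commute Un_left_commute)
  also have "\<dots> = num_vertices (D @ p4 # C @ p3 # B @ p2 # E) r"
    using d r by (intro num_vertices_Cons) (auto intro: permutes_subset)
  also have "\<dots> = num_vertices (D @ C @ p3 # B @ p2 # E) r"
    using d r by (intro num_vertices_remove) (auto intro: permutes_subset)
  also have "\<dots> = num_vertices ((D @ C) @ B @ p2 # E) r"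
    using d r num_vertices_remove[of "D @ C" p3 "B @ p2 # E" r] by (auto intro: permutes_subset)
  also have "\<dots> = num_vertices ((D @ C @ B) @ E) r"
    using d r num_vertices_remove[of "D @ C @ B" p2 E r] by (auto intro: permutes_subset)
  finally show ?thesis by simp
qed

text \<open>The letter \<open>y\<close> becomes a fixed point of the vertex permutation, hence a
  vertex of its own, the tip of the leaf.\<close>

lemma num_vertices_leaf:
  assumes d: "distinct (x # y # B)" and r: "r permutes set B"
  shows "num_vertices (x # y # B) (swp x y \<circ> r) = Suc (num_vertices B r)"
proof -
  let ?f = "cycle_of_list (x # B) \<circ> r"
  have f: "?f permutes set (x # B)"
    using r cycle_permutes[of "x # B"] permutes_compose permutes_imp_permutes_insert
    by (metis list.simps(15))
  have "cycle_of_list (x # y # B) \<circ> swp x y = cycle_of_list (x # B)"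
    using cycle_split[of x "[]" y B] d by simp
  then have "num_vertices (x # y # B) (swp x y \<circ> r) = num_orbits (insert y (set (x # B))) ?f"
    by (simp add: num_vertices_def comp_assoc[symmetric] insert_commute)
  also have "\<dots> = Suc (num_vertices (x # B) r)"
  proof -
    have "y \<notin> set (x # B)" using d by auto
    then show ?thesis using num_orbits_insert_fixed[OF _ f, of y] by (simp add: num_vertices_def)
  qed
  finally show ?thesis using num_vertices_Cons[of x B r] d r by simp
qed

text \<open>Since \<open>r\<close> fixes \<open>x\<close> and \<open>y\<close>, deleting the chord
  multiplies the vertex permutation by one transposition. This merges two orbits if \<open>x\<close>
  and \<open>y\<close> lie on different ones and splits an orbit otherwise.\<close>

lemma num_vertices_chord:
  assumes d: "distinct (x # A @ y # B)" and r: "r permutes set (A @ B)"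
  defines "s \<equiv> swp x y \<circ> r"
  shows "num_vertices (x # A @ y # B) s \<le> Suc (num_vertices (A @ B) r)"
    and "x \<notin> orbit (cycle_of_list (x # A @ y # B) \<circ> s) y \<Longrightarrow>
         num_vertices (x # A @ y # B) s = Suc (num_vertices (A @ B) r)"
proof -
  let ?L = "x # A @ y # B"
  let ?f = "cycle_of_list ?L \<circ> s"
  have rL: "r permutes set ?L" using r by (rule permutes_subset) auto
  then have f: "?f permutes set ?L" unfolding s_def
    by (intro permutes_compose cycle_permutes permutes_swap_id) auto
  have "r x = x" "r y = y" using d r by (auto simp: permutes_def)
  then have "swp x y \<circ> r = r \<circ> swp x y"
    using transpose_comp_eq[of r x y] permutes_bij[OF r] by (metis bij_inv_eq_iff)
  then have "?f \<circ> swp x y = cycle_of_list ?L \<circ> r"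
    by (simp add: s_def comp_assoc)
  moreover have "num_vertices ?L r = num_vertices (A @ y # B) r"
    using d r by (intro num_vertices_Cons) (auto intro: permutes_subset)
  moreover have "num_vertices (A @ y # B) r = num_vertices (A @ B) r"
    using d r by (intro num_vertices_remove) auto
  ultimately have eq: "num_orbits (set ?L) (?f \<circ> swp x y) = num_vertices (A @ B) r" by (simp add: num_vertices_def)
  show 2: "num_vertices ?L s = Suc (num_vertices (A @ B) r)" if "x \<notin> orbit ?f y"
    using num_orbits_merge[OF _ f _ _ that] eq by (simp add: num_vertices_def)
  show "num_vertices ?L s \<le> Suc (num_vertices (A @ B) r)"
  proof (cases "x \<in> orbit ?f y")
    case True
    then show ?thesis
      using num_orbits_split[OF _ f _ _ _ True] eq d by (simp add: num_vertices_def)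
  qed (use 2 in simp)
qed

lemma num_vertices_conj:
  assumes "bij b" "distinct xs"
  shows "num_vertices (map b xs) (b \<circ> r \<circ> inv b) = num_vertices xs r"
proof -
  have "cycle_of_list (map b xs) \<circ> (b \<circ> r \<circ> inv b) = b \<circ> (cycle_of_list xs \<circ> r) \<circ> inv b"
    unfolding conjugation_of_cycle[OF assms(2,1), symmetric]
    using assms(1) by (auto simp: fun_eq_iff bij_is_inj)
  then show ?thesis using num_orbits_conj[OF assms(1), of "set xs"] by (simp add: num_vertices_def)
qed

section \<open>Gluings of a cyclic word\<close>

text \<open>Extended by the identity outside \<open>S\<close>, so that matchings are permutations of
  the whole type and chords are added or removed by composing with a transposition.\<close>

definition matching :: "'a set \<Rightarrow> ('a \<Rightarrow> 'a) set" where
  "matching S = {r. (\<forall>x\<in>S. r x \<in> S \<and> r x \<noteq> x \<and> r (r x) = x) \<and> (\<forall>x. x \<notin> S \<longrightarrow> r x = x)}"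

text \<open>Indexed by the number of vertices and not by the genus, because this number survives the
  removal of a crossing pair.\<close>

definition gluings :: "'a list \<Rightarrow> nat \<Rightarrow> ('a \<Rightarrow> 'a) set" where
  "gluings xs v = {r \<in> matching (set xs). num_vertices xs r = v}"

lemma matching_invol: "r \<in> matching S \<Longrightarrow> r (r x) = x"
  by (cases "x \<in> S") (auto simp: matching_def)

lemma matching_permutes: "r \<in> matching S \<Longrightarrow> r permutes S"
  unfolding permutes_def using matching_invol[of r S]
  by (auto simp: matching_def) metis

lemma finite_matching: "finite S \<Longrightarrow> finite (matching S)"
  by (rule finite_subset[OF _ finite_permutations[of S]]) (auto dest: matching_permutes)

lemma finite_dg: "finite (gluings xs v)"
  by (simp add: gluings_def finite_matching)

lemma matching_add:
  assumes "r \<in> matching S" "x \<noteq> y" "x \<notin> S" "y \<notin> S"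
  shows "swp x y \<circ> r \<in> matching (insert x (insert y S))"
  using assms by (auto simp: matching_def transpose_def)

text \<open>Composition with the transposition turns both ends of the chord into fixed points, which
  deletes the chord.\<close>

lemma matching_sub:
  assumes "s \<in> matching S" "x \<in> S" "s x = y"
  shows "swp x y \<circ> s \<in> matching (S - {x, y})"
proof -
  have "s y = x" using assms matching_invol by metis
  moreover have "s z \<noteq> x" "s z \<noteq> y" if "z \<noteq> x" "z \<noteq> y" for z
    using that assms matching_invol by metis+
  moreover have "swp x y z = z" if "z \<notin> S" for z
    using that assms by (auto simp: matching_def transpose_def)
  ultimately show ?thesis using assms by (auto simp: matching_def)
qed

lemma swp_swp_comp [simp]: "swp x y \<circ> (swp x y \<circ> r) = r"
  by (simp add: fun_eq_iff)

lemma matching_conj: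
  assumes "r \<in> matching S" "bij b"
  shows "b \<circ> r \<circ> inv b \<in> matching (b ` S)"
proof -
  have "b (r (inv b x)) = x" if "x \<notin> b ` S" for x
  proof -
    have "inv b x \<notin> S" using that assms(2) by (metis bij_inv_eq_iff image_eqI)
    then show ?thesis using assms by (auto simp: matching_def bij_is_surj surj_f_inv_f)
  qed
  then show ?thesis using assms by (auto simp: matching_def bij_is_inj inj_eq)
qed

lemma gluings_rotate: "distinct (A @ B) \<Longrightarrow> gluings (B @ A) v = gluings (A @ B) v"
  using num_vertices_rotate_append[of A B] by (simp add: gluings_def Un_commute)

lemma gluings_conj_mem:
  assumes "bij b" "distinct xs" "r \<in> gluings xs v"
  shows "b \<circ> r \<circ> inv b \<in> gluings (map b xs) v"
  using assms matching_conj[of r "set xs" b] num_vertices_conj[of b xs r] by (simp add: gluings_def)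

lemma conj_inv_conj: "bij b \<Longrightarrow> inv b \<circ> (b \<circ> r \<circ> inv b) \<circ> b = r"
  by (simp add: fun_eq_iff bij_is_inj)

lemma conj_conj_inv: "bij b \<Longrightarrow> b \<circ> (inv b \<circ> r \<circ> b) \<circ> inv b = r"
  by (simp add: fun_eq_iff bij_is_surj surj_f_inv_f)

lemma gluings_conj:
  assumes "bij b" "distinct xs"
  shows "bij_betw (\<lambda>r. b \<circ> r \<circ> inv b) (gluings xs v) (gluings (map b xs) v)"
proof (rule bij_betwI[where g = "\<lambda>r. inv b \<circ> r \<circ> b"])
  show "(\<lambda>r. b \<circ> r \<circ> inv b) \<in> gluings xs v \<rightarrow> gluings (map b xs) v"
    using gluings_conj_mem[OF assms] by blast
  have "inv b \<circ> r \<circ> b \<in> gluings xs v" if "r \<in> gluings (map b xs) v" for r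
  proof -
    have "distinct (map b xs)" using assms by (simp add: distinct_map) (metis bij_is_inj inj_on_subset subset_UNIV)
    from gluings_conj_mem[OF bij_imp_bij_inv[OF assms(1)] this that]
    show ?thesis using assms by (simp add: inv_inv_eq bij_is_inj o_def)
  qed
  then show "(\<lambda>r. inv b \<circ> r \<circ> b) \<in> gluings (map b xs) v \<rightarrow> gluings xs v" by blast
qed (use conj_conj_inv[OF assms(1)] conj_inv_conj[OF assms(1)] in auto)

text \<open>A bijection of the whole type is wanted, since gluings are functions on it and are
  renamed by conjugation. Once the tails are matched, one transposition corrects the image of the
  head.\<close>

lemma ex_bij_map:
  fixes xs ys :: "'a list"
  assumes "distinct xs" "distinct ys" "length xs = length ys"
  shows "\<exists>b. bij b \<and> map b xs = ys"
  using assms(3,1,2)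
proof (induction xs ys rule: list_induct2)
  case Nil
  show ?case using bij_id by auto
next
  case (Cons x xs y ys)
  then obtain b where b: "bij b" "map b xs = ys" by auto
  have "b x \<notin> set ys" using b Cons.prems by (auto simp: bij_is_inj inj_eq)
  have "swp (b x) y (b z) = b z" if "z \<in> set xs" for z
  proof (rule transpose_apply_other)
    show "b z \<noteq> b x" using that Cons.prems b(1) by (auto simp: bij_is_inj inj_eq)
    show "b z \<noteq> y" using that Cons.prems b(2) by auto
  qed
  then have "map (swp (b x) y \<circ> b) xs = ys"
    unfolding b(2)[symmetric] by (intro map_cong refl) (simp only: o_apply)
  then have 1: "map (swp (b x) y \<circ> b) (x # xs) = y # ys"
    by (simp only: list.map o_apply transpose_apply_first)
  show ?case
    by (rule exI, rule conjI, rule bij_comp[OF b(1) bij_transpose], rule 1)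
qed

lemma card_dg_eq:
  fixes xs ys :: "'a list"
  assumes "distinct xs" "distinct ys" "length xs = length ys"
  shows "card (gluings xs v) = card (gluings ys v)"
proof -
  obtain b where "bij b" "map b xs = ys" using ex_bij_map[OF assms] by blast
  then show ?thesis using gluings_conj[of b xs v] assms by (auto dest: bij_betw_same_card)
qed

lemma gluings_crossing_mem:
  assumes d: "distinct (p1 # B @ p2 # C @ p3 # D @ p4 # E)" and r: "r \<in> gluings (D @ C @ B @ E) v"
  shows "swp p1 p3 \<circ> swp p2 p4 \<circ> r \<in> gluings (p1 # B @ p2 # C @ p3 # D @ p4 # E) v"
    and "(swp p1 p3 \<circ> swp p2 p4 \<circ> r) p1 = p3" "(swp p1 p3 \<circ> swp p2 p4 \<circ> r) p2 = p4"
proof -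
  have r': "r \<in> matching (set (D @ C @ B @ E))" using r by (simp add: gluings_def)
  have "swp p2 p4 \<circ> r \<in> matching (insert p2 (insert p4 (set (D @ C @ B @ E))))"
    using d by (intro matching_add[OF r']) auto
  from matching_add[OF this, of p1 p3] have "swp p1 p3 \<circ> (swp p2 p4 \<circ> r) \<in> matching (insert p1 (insert p3 (insert p2 (insert p4 (set (D @ C @ B @ E))))))"
    using d by auto
  also have "insert p1 (insert p3 (insert p2 (insert p4 (set (D @ C @ B @ E))))) = set (p1 # B @ p2 # C @ p3 # D @ p4 # E)"
    by auto
  finally show "swp p1 p3 \<circ> swp p2 p4 \<circ> r \<in> gluings (p1 # B @ p2 # C @ p3 # D @ p4 # E) v"
    using num_vertices_crossing[OF d matching_permutes[OF r']] r unfolding gluings_def comp_assoc by blast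
  have "r p1 = p1" "r p2 = p2" using d r' by (auto simp: matching_def)
  then show "(swp p1 p3 \<circ> swp p2 p4 \<circ> r) p1 = p3" "(swp p1 p3 \<circ> swp p2 p4 \<circ> r) p2 = p4"
    using d by (auto simp: transpose_def)
qed

lemma gluings_crossing_core:
  assumes d: "distinct (p1 # B @ p2 # C @ p3 # D @ p4 # E)"
    and s: "s \<in> gluings (p1 # B @ p2 # C @ p3 # D @ p4 # E) v" "s p1 = p3" "s p2 = p4"
  obtains r where "r \<in> gluings (D @ C @ B @ E) v" "s = swp p1 p3 \<circ> swp p2 p4 \<circ> r"
proof
  let ?L = "p1 # B @ p2 # C @ p3 # D @ p4 # E"
  let ?r = "swp p2 p4 \<circ> (swp p1 p3 \<circ> s)"
  have s': "s \<in> matching (set ?L)" using s by (simp add: gluings_def)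
  have "swp p1 p3 \<circ> s \<in> matching (set ?L - {p1, p3})"
    using matching_sub[OF s' _ s(2)] by simp
  moreover have "(swp p1 p3 \<circ> s) p2 = p4" using s d by (auto simp: transpose_def)
  ultimately have "?r \<in> matching (set ?L - {p1, p3} - {p2, p4})"
    using matching_sub[of "swp p1 p3 \<circ> s" "set ?L - {p1, p3}" p2 p4] d by auto
  also have "set ?L - {p1, p3} - {p2, p4} = set (D @ C @ B @ E)" using d by auto
  finally have r: "?r \<in> matching (set (D @ C @ B @ E))" .
  show eq: "s = swp p1 p3 \<circ> swp p2 p4 \<circ> ?r" by (simp add: comp_assoc)
  show "?r \<in> gluings (D @ C @ B @ E) v"
    using num_vertices_crossing[OF d matching_permutes[OF r]] r s(1) eq by (simp add: gluings_def)
qed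

lemma gluings_leaf_mem:
  assumes d: "distinct (x # y # B)" and r: "r \<in> gluings B v"
  shows "swp x y \<circ> r \<in> gluings (x # y # B) (Suc v)" "(swp x y \<circ> r) x = y"
proof -
  have r': "r \<in> matching (set B)" using r by (simp add: gluings_def)
  then show "swp x y \<circ> r \<in> gluings (x # y # B) (Suc v)"
    using num_vertices_leaf[OF d matching_permutes[OF r']] matching_add[OF r', of x y] d r
    by (simp add: gluings_def)
  have "r x = x" using d r' by (auto simp: matching_def)
  then show "(swp x y \<circ> r) x = y" by simp
qed

section \<open>Crossings, leaves and the possible numbers of vertices\<close>

lemma split_index2:
  assumes "i < j" "j < length xs"
  shows "\<exists>A B C. xs = A @ xs ! i # B @ xs ! j # C \<and> length A = i \<and> length (A @ xs ! i # B) = j"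
proof -
  define T where "T = take j xs"
  have 1: "xs = T @ xs ! j # drop (Suc j) xs" using assms by (simp add: T_def id_take_nth_drop)
  have lT: "length T = j" using assms by (simp add: T_def)
  have "T = take i T @ T ! i # drop (Suc i) T"
    using assms lT by (intro id_take_nth_drop) simp
  moreover have "T ! i = xs ! i" using assms by (simp add: T_def)
  ultimately have 2: "T = take i T @ xs ! i # drop (Suc i) T" by simp
  have "xs = (take i T @ xs ! i # drop (Suc i) T) @ xs ! j # drop (Suc j) xs"
    using 1 arg_cong[OF 2, of "\<lambda>t. t @ xs ! j # drop (Suc j) xs"] by (rule trans)
  then have 3: "xs = take i T @ xs ! i # drop (Suc i) T @ xs ! j # drop (Suc j) xs"
    by (simp only: append_assoc append_Cons)
  show ?thesis
    by (rule exI, rule exI, rule exI, rule conjI, rule 3) (use assms lT in simp)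
qed

lemma split_index4:
  assumes "i < k" "k < j" "j < l" "l < length xs"
  shows "\<exists>A B C D E. xs = A @ xs ! i # B @ xs ! k # C @ xs ! j # D @ xs ! l # E"
proof -
  obtain A B C where 1: "xs = A @ xs ! j # B @ xs ! l # C" "length A = j"
    using split_index2[OF assms(3,4)] by blast
  then have "k < length A" using assms by simp
  from split_index2[OF assms(1) this] obtain A1 A2 A3 where "A = A1 @ A ! i # A2 @ A ! k # A3" by blast
  moreover have "A ! i = xs ! i" "A ! k = xs ! k" using 1 assms by (metis nth_append order.strict_trans)+
  ultimately have "xs = A1 @ xs ! i # A2 @ xs ! k # A3 @ xs ! j # B @ xs ! l # C"
    using 1 by (metis append_Cons append_assoc)
  then show ?thesis by blast
qed

lemma subseq_Cons_iff: "subseq (x # xs) ys \<longleftrightarrow> (\<exists>us vs. ys = us @ x # vs \<and> subseq xs vs)"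
proof
  assume "subseq (x # xs) ys"
  from list_emb_ConsD[OF this] show "\<exists>us vs. ys = us @ x # vs \<and> subseq xs vs" by blast
qed (auto intro: list_emb_append2)

lemma subseq4_iff:
  "subseq [p1, p2, p3, p4] xs \<longleftrightarrow> (\<exists>A B C D E. xs = A @ p1 # B @ p2 # C @ p3 # D @ p4 # E)"
proof
  assume "subseq [p1, p2, p3, p4] xs"
  then obtain A xs1 where 1: "xs = A @ p1 # xs1" "subseq [p2, p3, p4] xs1"
    unfolding subseq_Cons_iff[of p1] by blast
  then obtain B xs2 where 2: "xs1 = B @ p2 # xs2" "subseq [p3, p4] xs2"
    unfolding subseq_Cons_iff[of p2] by blast
  then obtain C xs3 where 3: "xs2 = C @ p3 # xs3" "subseq [p4] xs3"
    unfolding subseq_Cons_iff[of p3] by blast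
  then obtain D xs4 where "xs3 = D @ p4 # xs4"
    unfolding subseq_Cons_iff[of p4] by blast
  then show "\<exists>A B C D E. xs = A @ p1 # B @ p2 # C @ p3 # D @ p4 # E"
    using 1 2 3 by blast
next
  assume "\<exists>A B C D E. xs = A @ p1 # B @ p2 # C @ p3 # D @ p4 # E"
  then show "subseq [p1, p2, p3, p4] xs"
    unfolding subseq_Cons_iff by (metis list_emb_Nil)
qed

definition has_crossing :: "'a list \<Rightarrow> ('a \<Rightarrow> 'a) \<Rightarrow> bool" where
  "has_crossing xs s \<longleftrightarrow> (\<exists>p1 p2. subseq [p1, p2, s p1, s p2] xs)"

text \<open>Take the first position \<open>j\<close> that closes a chord. If its partner is not the
  letter just before it, then that letter opens a chord that closes after \<open>j\<close>, and the
  two chords cross.\<close>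

lemma leaf_or_crossing:
  assumes s: "s \<in> matching (set xs)" and ne: "xs \<noteq> []" and d: "distinct xs"
    and nc: "\<not> has_crossing xs s"
  obtains A x y B where "xs = A @ x # y # B" "s x = y"
proof -
  define P where "P j \<longleftrightarrow> (\<exists>i<j. j < length xs \<and> s (xs ! j) = xs ! i)" for j
  have idx: "\<exists>j<length xs. s (xs ! i) = xs ! j \<and> j \<noteq> i \<and> s (xs ! j) = xs ! i" if "i < length xs" for i
  proof -
    have "xs ! i \<in> set xs" using that by simp
    then have "s (xs ! i) \<in> set xs" "s (xs ! i) \<noteq> xs ! i" "s (s (xs ! i)) = xs ! i"
      using s by (auto simp: matching_def)
    then show ?thesis by (metis in_set_conv_nth)
  qed
  have "\<exists>j. P j"
  proof -
    obtain j where "j < length xs" "s (xs ! 0) = xs ! j" "j \<noteq> 0" "s (xs ! j) = xs ! 0"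
      using idx[of 0] ne by auto
    then have "P j" by (auto simp: P_def)
    then show ?thesis ..
  qed
  then have Pj: "P (LEAST j. P j)" by (rule LeastI_ex)
  define j where "j = (LEAST j. P j)"
  have least: "\<not> P k" if "k < j" for k using that not_less_Least unfolding j_def by blast
  from Pj obtain i where i: "i < j" "j < length xs" "s (xs ! j) = xs ! i"
    unfolding P_def j_def by blast
  have si: "s (xs ! i) = xs ! j" using i matching_invol[OF s] by metis
  show thesis
  proof (cases "Suc i = j")
    case True
    obtain A B C where "xs = A @ xs ! i # B @ xs ! j # C \<and> length A = i \<and> length (A @ xs ! i # B) = j"
      using split_index2[OF i(1,2)] by blast
    with True have "xs = A @ xs ! i # xs ! j # C" by auto
    then show ?thesis using that si by blast
  next
    case False
    define k where "k = j - 1"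
    have k: "i < k" "k < j" using False i by (auto simp: k_def)
    then obtain l where l: "l < length xs" "s (xs ! k) = xs ! l" "l \<noteq> k"
      using idx[of k] i by auto
    have "\<not> l < k" using least[OF k(2)] l k i unfolding P_def by auto
    moreover have "l \<noteq> j"
    proof
      assume "l = j"
      then have "xs ! i = xs ! k" using l(2) i(3) matching_invol[OF s, of "xs ! k"] by simp
      then show False using nth_eq_iff_index_eq[OF d, of i k] k i(2) by simp
    qed
    ultimately have "j < l" using l k_def by linarith
    from split_index4[OF k this l(1)] have "subseq [xs ! i, xs ! k, xs ! j, xs ! l] xs"
      unfolding subseq4_iff .
    then have "has_crossing xs s"
      unfolding has_crossing_def using si l(2) by metis
    then show ?thesis using nc by simp
  qed
qed

lemma has_crossing_insert:
  assumes "has_crossing (A @ B) r" "x \<notin> set (A @ B)" "y \<notin> set (A @ B)"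
  shows "has_crossing (A @ x # y # B) (swp x y \<circ> r)"
proof -
  obtain p1 p2 where p: "subseq [p1, p2, r p1, r p2] (A @ B)"
    using assms(1) unfolding has_crossing_def by blast
  then have "set [p1, p2, r p1, r p2] \<subseteq> set (A @ B)" using notin_set_nthsI by (metis subseq_conv_nths set_nths_subset)
  moreover have "swp x y z = z" if "z \<in> set (A @ B)" for z
    using that assms(2,3) by (metis transpose_apply_other)
  ultimately have "swp x y (r p1) = r p1" "swp x y (r p2) = r p2" by simp_all
  moreover have "subseq (A @ B) (A @ x # y # B)" by (intro list_emb_append_mono subseq_order.refl) auto
  ultimately show ?thesis using p unfolding has_crossing_def by (metis o_apply subseq_order.trans)
qed

lemma gluings_extract_chord:
  assumes d: "distinct (x # A @ y # B)" and s: "s \<in> matching (set (x # A @ y # B))" "s x = y"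
  shows "swp x y \<circ> s \<in> matching (set (A @ B))"
proof -
  have "swp x y \<circ> s \<in> matching (set (x # A @ y # B) - {x, y})"
    using s by (intro matching_sub) auto
  also have "set (x # A @ y # B) - {x, y} = set (A @ B)" using d by auto
  finally show ?thesis .
qed

text \<open>Each chord adds at most one vertex to the single vertex of the empty word. This is the
  nonnegativity of the genus.\<close>

lemma num_vertices_bound:
  assumes "distinct xs" "s \<in> matching (set xs)" "length xs = 2 * n"
  shows "num_vertices xs s \<le> Suc n"
  using assms
proof (induction n arbitrary: xs s)
  case 0
  then show ?case by (simp add: num_vertices_def)
next
  case (Suc n)
  then obtain x ys where xs: "xs = x # ys" by (cases xs) auto
  have "s x \<in> set ys" using Suc.prems xs by (auto simp: matching_def)
  then obtain A B where ys: "ys = A @ s x # B" by (meson split_list)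
  have d: "distinct (x # A @ s x # B)" using Suc.prems xs ys by simp
  have r: "swp x (s x) \<circ> s \<in> matching (set (A @ B))"
    using gluings_extract_chord[OF d] Suc.prems xs ys by simp
  have "num_vertices (A @ B) (swp x (s x) \<circ> s) \<le> Suc n"
    using Suc.IH[of "A @ B"] r d Suc.prems xs ys by auto
  then show ?case
    using num_vertices_chord(1)[OF d matching_permutes[OF r]] xs ys by simp
qed

lemma crossing_rotation:
  assumes "has_crossing xs s"
  obtains A p1 B p2 C D E where "xs = A @ p1 # B @ p2 # C @ s p1 # D @ s p2 # E"
  using assms unfolding has_crossing_def subseq4_iff by blast

text \<open>The core has the same vertices but only \<open>n - 2\<close> chords, so the general
  bound improves by two: a crossing forces positive genus.\<close>

lemma crossing_nv_bound:
  assumes d: "distinct xs" and s: "s \<in> matching (set xs)" and n: "length xs = 2 * n" and c: "has_crossing xs s"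
  shows "Suc (num_vertices xs s) \<le> n"
proof -
  obtain A p1 B p2 C D E where xs: "xs = A @ p1 # B @ p2 # C @ s p1 # D @ s p2 # E"
    using crossing_rotation[OF c] by blast
  let ?L = "p1 # B @ p2 # C @ s p1 # D @ s p2 # (E @ A)"
  have dL: "distinct ?L" using d xs by auto
  have "s \<in> gluings ?L (num_vertices xs s)"
    using gluings_rotate[of A "p1 # B @ p2 # C @ s p1 # D @ s p2 # E" "num_vertices xs s"] d s xs by (simp add: gluings_def)
  from gluings_crossing_core[OF dL this] obtain r where r: "r \<in> gluings (D @ C @ B @ E @ A) (num_vertices xs s)" by auto
  moreover have "length (D @ C @ B @ E @ A) = 2 * (n - 2)" "n \<ge> 2" using n xs by auto
  moreover have "distinct (D @ C @ B @ E @ A)" using dL by auto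
  ultimately show ?thesis using num_vertices_bound[of "D @ C @ B @ E @ A" r "n - 2"] by (simp add: gluings_def)
qed

text \<open>Without crossings the word shrinks to the empty one by cutting off leaves, and each leaf
  carries one vertex.\<close>

lemma no_crossing_nv:
  assumes "distinct xs" "s \<in> matching (set xs)" "length xs = 2 * n" "\<not> has_crossing xs s"
  shows "num_vertices xs s = Suc n"
  using assms
proof (induction n arbitrary: xs s)
  case 0
  then show ?case by (simp add: num_vertices_def)
next
  case (Suc n)
  have "xs \<noteq> []" using Suc.prems by auto
  then obtain A x B where xs: "xs = A @ x # s x # B"
    using leaf_or_crossing[of s xs] Suc.prems by metis
  have d: "distinct (x # (s x) # B @ A)" "distinct (x # [] @ (s x) # B @ A)" using Suc.prems xs by auto
  have r: "swp x (s x) \<circ> s \<in> matching (set (B @ A))"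
    using gluings_extract_chord[OF d(2)] Suc.prems xs by (simp add: Un_commute)
  have "\<not> has_crossing (A @ B) (swp x (s x) \<circ> s)"
    using has_crossing_insert[of A B "swp x (s x) \<circ> s" x "s x"] Suc.prems xs by auto
  then have "num_vertices (A @ B) (swp x (s x) \<circ> s) = Suc n"
  proof (intro Suc.IH)
    show "swp x (s x) \<circ> s \<in> matching (set (A @ B))" using r by (simp only: set_append Un_commute)
    show "distinct (A @ B)" "length (A @ B) = 2 * n" using Suc.prems xs by auto
  qed
  moreover have "num_vertices (B @ A) (swp x (s x) \<circ> s) = num_vertices (A @ B) (swp x (s x) \<circ> s)"
    using d by (intro num_vertices_rotate_append) auto
  moreover have "num_vertices xs s = num_vertices (x # s x # B @ A) s"
    using num_vertices_rotate_append[of A "x # s x # B" s] Suc.prems xs by simp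
  ultimately show ?case using num_vertices_leaf[OF d(1) matching_permutes[OF r]] by simp
qed

text \<open>The vertex permutation sends \<open>s z\<close> to the successor of \<open>z\<close>. If
  \<open>z\<close> and \<open>s z\<close> always share an orbit, then so do \<open>z\<close> and its
  successor, and walking around the word reaches every letter. Read backwards, a second vertex
  yields a chord whose ends lie in different orbits.\<close>

lemma orbits_const_imp_nv1:
  assumes d: "distinct xs" and s: "s \<in> matching (set xs)"
    and *: "\<And>x. x \<in> set xs \<Longrightarrow> x \<in> orbit (cycle_of_list xs \<circ> s) (s x)"
  shows "num_vertices xs s = 1"
proof (cases "xs = []")
  case False
  let ?c = "cycle_of_list xs" and ?f = "cycle_of_list xs \<circ> s"
  have f: "?f permutes set xs"
    using matching_permutes[OF s] cycle_permutes permutes_compose by blast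
  have step: "orbit ?f (?c z) = orbit ?f z" if "z \<in> set xs" for z
  proof -
    have "?f (s z) = ?c z" using matching_invol[OF s] by simp
    then have "?c z \<in> orbit ?f (s z)" by (metis orbit.base)
    then have "orbit ?f (?c z) = orbit ?f (s z)" by (rule orbit_eq_of_mem[OF finite_set f])
    moreover have "orbit ?f z = orbit ?f (s z)" using *[OF that] by (rule orbit_eq_of_mem[OF finite_set f])
    ultimately show ?thesis by simp
  qed
  have iter: "(?c ^^ k) z \<in> set xs \<and> orbit ?f ((?c ^^ k) z) = orbit ?f z" if "z \<in> set xs" for k z
  proof (induction k)
    case (Suc k)
    then have "?c ((?c ^^ k) z) \<in> set xs" using cycle_permutes[of xs] permutes_in_image by metis
    then show ?case using Suc step[of "(?c ^^ k) z"] by (metis funpow.simps(2) o_apply)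
  qed (use that in simp)
  have "orbit ?f (xs ! n) = orbit ?f (xs ! 0)" if "n < length xs" for n
  proof -
    have "map (?c ^^ n) xs ! 0 = rotate n xs ! 0" using cyclic_rotation[OF d] by simp
    then have "(?c ^^ n) (xs ! 0) = xs ! n" using that False by (simp add: nth_rotate)
    then show ?thesis using iter[of "xs ! 0" n] False by auto
  qed
  then have const: "orbit ?f z = orbit ?f (xs ! 0)" if "z \<in> set xs" for z
    using that by (metis in_set_conv_nth)
  have "orbit ?f ` set xs = (\<lambda>_. orbit ?f (xs ! 0)) ` set xs"
    by (intro image_cong refl const)
  also have "\<dots> = {orbit ?f (xs ! 0)}" using False by (simp add: image_constant_conv)
  finally have "orbit ?f ` set xs = {orbit ?f (xs ! 0)}" .
  then show ?thesis using False by (simp add: num_vertices_def num_orbits_def)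
qed (simp add: num_vertices_def)

text \<open>With more than one vertex some chord has its ends in different orbits. Deleting it loses
  one vertex and keeps the genus, and the gluing is recovered from the two ends and what is left.
  This later bounds from below how often a prescribed leaf occurs.\<close>

lemma gluings_contract_bound:
  fixes xs ys :: "'a list"
  assumes d: "distinct xs" and d': "distinct ys" and len: "length xs = length ys + 2" and v: "v \<ge> 1"
  shows "card (gluings xs (Suc v)) \<le> length xs ^ 2 * card (gluings ys v)"
proof -
  let ?S = "set xs \<times> set xs"
  \<comment> \<open>The word that remains after deleting \<open>x\<close> and \<open>y\<close> from
    a rotation of \<open>xs\<close>. It depends on the pair only, so a single choice serves all
    gluings that match \<open>x\<close> with \<open>y\<close>.\<close>
  define l where "l x y = (SOME l. distinct l \<and> length l = length ys \<and>
      (\<forall>s\<in>gluings xs (Suc v). s x = y \<longrightarrow> x \<notin> orbit (cycle_of_list xs \<circ> s) y \<longrightarrow> swp x y \<circ> s \<in> gluings l v))" for x y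
  have l: "distinct (l x y) \<and> length (l x y) = length ys \<and>
      (\<forall>s\<in>gluings xs (Suc v). s x = y \<longrightarrow> x \<notin> orbit (cycle_of_list xs \<circ> s) y \<longrightarrow> swp x y \<circ> s \<in> gluings (l x y) v)"
    if xy: "x \<in> set xs" "y \<in> set xs" "x \<noteq> y" for x y
  proof -
    obtain P Q where xs: "xs = P @ x # Q" using xy by (meson split_list)
    then have "y \<in> set (Q @ P)" using xy by auto
    then obtain A B where AB: "Q @ P = A @ y # B" by (meson split_list)
    have xs': "x # A @ y # B = (x # Q) @ P" using AB by simp
    have dL: "distinct (x # A @ y # B)" unfolding xs' using d xs by auto
    have lL: "length (x # A @ y # B) = length xs" unfolding xs' using xs by simp
    have cyc: "cycle_of_list (x # A @ y # B) = cycle_of_list xs"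
      unfolding xs' using cycle_rotate_append[of P "x # Q"] d xs by simp
    have dgL: "gluings (x # A @ y # B) w = gluings xs w" for w
      unfolding xs' using gluings_rotate[of P "x # Q"] d xs by simp
    have "swp x y \<circ> s \<in> gluings (A @ B) v"
      if s: "s \<in> gluings xs (Suc v)" "s x = y" "x \<notin> orbit (cycle_of_list xs \<circ> s) y" for s
    proof -
      have sL: "s \<in> gluings (x # A @ y # B) (Suc v)" using s dgL by simp
      then have r: "swp x y \<circ> s \<in> matching (set (A @ B))"
        using s by (intro gluings_extract_chord[OF dL]) (auto simp: gluings_def)
      have "x \<notin> orbit (cycle_of_list (x # A @ y # B) \<circ> (swp x y \<circ> (swp x y \<circ> s))) y"
        using s cyc by simp
      from num_vertices_chord(2)[OF dL matching_permutes[OF r] this] sL r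
      show ?thesis by (simp add: gluings_def)
    qed
    then have "\<forall>s\<in>gluings xs (Suc v). s x = y \<longrightarrow> x \<notin> orbit (cycle_of_list xs \<circ> s) y \<longrightarrow> swp x y \<circ> s \<in> gluings (A @ B) v"
      by (intro ballI impI)
    moreover have "distinct (A @ B)" "length (A @ B) = length ys" using dL lL len by auto
    ultimately have "\<exists>l. distinct l \<and> length l = length ys \<and>
      (\<forall>s\<in>gluings xs (Suc v). s x = y \<longrightarrow> x \<notin> orbit (cycle_of_list xs \<circ> s) y \<longrightarrow> swp x y \<circ> s \<in> gluings l v)"
      by (intro exI[of _ "A @ B"] conjI)
    then show ?thesis unfolding l_def by (rule someI_ex)
  qed
  let ?T = "\<lambda>(x, y). if x \<noteq> y then (\<lambda>r. swp x y \<circ> r) ` gluings (l x y) v else {}"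
  have "gluings xs (Suc v) \<subseteq> (\<Union>p\<in>?S. ?T p)"
  proof
    fix s assume s: "s \<in> gluings xs (Suc v)"
    then have m: "s \<in> matching (set xs)" "num_vertices xs s \<noteq> 1" using v by (auto simp: gluings_def)
    then obtain x where x: "x \<in> set xs" "x \<notin> orbit (cycle_of_list xs \<circ> s) (s x)"
      using orbits_const_imp_nv1[OF d m(1)] by blast
    have y: "s x \<in> set xs" "x \<noteq> s x" using m x by (auto simp: matching_def)
    have "swp x (s x) \<circ> s \<in> gluings (l x (s x)) v" using l[OF x(1) y] s x by blast
    then have "swp x (s x) \<circ> (swp x (s x) \<circ> s) \<in> (\<lambda>r. swp x (s x) \<circ> r) ` gluings (l x (s x)) v" by (rule imageI)
    then have "s \<in> ?T (x, s x)" using y by simp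
    then show "s \<in> (\<Union>p\<in>?S. ?T p)" using x(1) y(1) by blast
  qed
  moreover have "finite (\<Union>p\<in>?S. ?T p)" by (auto simp: finite_dg)
  ultimately have "card (gluings xs (Suc v)) \<le> card (\<Union>p\<in>?S. ?T p)" by (rule card_mono[rotated])
  also have "\<dots> \<le> (\<Sum>p\<in>?S. card (?T p))" by (intro card_UN_le) auto
  also have "\<dots> \<le> (\<Sum>p\<in>?S. card (gluings ys v))"
  proof (intro sum_mono)
    fix p assume p: "p \<in> ?S"
    obtain x y where xy: "p = (x, y)" by (cases p)
    show "card (?T p) \<le> card (gluings ys v)"
    proof (cases "x = y")
      case False
      then have "card (gluings (l x y) v) = card (gluings ys v)"
        using l[of x y] p xy d' by (intro card_dg_eq) auto
      then show ?thesis using xy False card_image_le[OF finite_dg, of "\<lambda>r. swp x y \<circ> r" "l x y" v] by simp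
    qed (use xy in simp)
  qed
  also have "\<dots> = length xs ^ 2 * card (gluings ys v)"
    using d by (simp add: card_cartesian_product distinct_card power2_eq_square)
  finally show ?thesis .
qed

section \<open>Poincare inequalities\<close>

definition edge_energy :: "('b \<Rightarrow> 'b \<Rightarrow> bool) \<Rightarrow> 'b set \<Rightarrow> ('b \<Rightarrow> real) \<Rightarrow> real" where
  "edge_energy W S F = (\<Sum>p\<in>{p \<in> S \<times> S. W (fst p) (snd p)}. (F (fst p) - F (snd p))\<^sup>2)"

definition pair_energy :: "'b set \<Rightarrow> 'b set \<Rightarrow> ('b \<Rightarrow> real) \<Rightarrow> real" where
  "pair_energy A B F = (\<Sum>s\<in>A. \<Sum>t\<in>B. (F s - F t)\<^sup>2)"

text \<open>\<open>pair_energy S S F\<close> is \<open>2 |S|^2\<close> times the variance of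
  \<open>F\<close> under the uniform distribution, and \<open>edge_energy\<close> runs over ordered
  pairs. Without divisions such inequalities can be summed over overlapping subsets.\<close>

definition Poincare :: "('b \<Rightarrow> 'b \<Rightarrow> bool) \<Rightarrow> 'b set \<Rightarrow> real \<Rightarrow> bool" where
  "Poincare W S K \<longleftrightarrow> (\<forall>F. pair_energy S S F \<le> K * real (card S) * edge_energy W S F)"

lemma edge_energy_nonneg: "0 \<le> edge_energy W S F"
  by (simp add: edge_energy_def sum_nonneg)

lemma pair_energy_nonneg: "0 \<le> pair_energy A B F"
  by (simp add: pair_energy_def sum_nonneg)

lemma pair_energy_mono:
  assumes "finite B" "finite D" "A \<subseteq> B" "C \<subseteq> D"
  shows "pair_energy A C F \<le> pair_energy B D F"
proof -
  have "pair_energy A C F \<le> (\<Sum>s\<in>A. \<Sum>t\<in>D. (F s - F t)\<^sup>2)"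
    unfolding pair_energy_def using assms by (intro sum_mono sum_mono2) auto
  also have "\<dots> \<le> pair_energy B D F"
    unfolding pair_energy_def using assms by (intro sum_mono2 sum_nonneg) auto
  finally show ?thesis .
qed

lemma sum_product3: "(\<Sum>x\<in>P \<times> (Q \<times> R). g x) = (\<Sum>p\<in>P. \<Sum>q\<in>Q. \<Sum>r\<in>R. g (p, q, r))"
  by (simp add: sum.cartesian_product case_prod_unfold)

text \<open>Minkowski's inequality on the product of the three sets. As all sizes are
  \<open>N\<close>, summing over the variable that a term lacks multiplies each of the three
  energies by the same \<open>N\<close>.\<close>

lemma pair_energy_triangle:
  assumes fin: "finite P" "finite Q" "finite R"
    and card: "card P = N" "card Q = N" "card R = N" "N > 0"
  shows "sqrt (pair_energy P R F) \<le> sqrt (pair_energy P Q F) + sqrt (pair_energy Q R F)"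
proof -
  let ?X = "P \<times> (Q \<times> R)"
  define f where "f = (\<lambda>(p, q, r :: 'a). F p - F q)"
  define h where "h = (\<lambda>(p :: 'a, q, r). F q - F r)"
  have PR: "sqrt (real N * pair_energy P R F) = L2_set (\<lambda>x. f x + h x) ?X"
  proof -
    have "(\<Sum>x\<in>?X. (f x + h x)\<^sup>2) = (\<Sum>p\<in>P. \<Sum>q\<in>Q. \<Sum>r\<in>R. (F p - F r)\<^sup>2)"
      by (simp add: f_def h_def sum_product3)
    also have "\<dots> = real N * pair_energy P R F"
      using card by (simp add: pair_energy_def sum_distrib_left)
    finally show ?thesis by (simp add: L2_set_def)
  qed
  have PQ: "sqrt (real N * pair_energy P Q F) = L2_set f ?X"
  proof -
    have "(\<Sum>x\<in>?X. (f x)\<^sup>2) = (\<Sum>p\<in>P. \<Sum>q\<in>Q. \<Sum>r\<in>R. (F p - F q)\<^sup>2)"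
      by (simp add: f_def sum_product3)
    also have "\<dots> = real N * pair_energy P Q F"
      using card by (simp add: pair_energy_def sum_distrib_left)
    finally show ?thesis by (simp add: L2_set_def)
  qed
  have QR: "sqrt (real N * pair_energy Q R F) = L2_set h ?X"
  proof -
    have "(\<Sum>x\<in>?X. (h x)\<^sup>2) = (\<Sum>p\<in>P. \<Sum>q\<in>Q. \<Sum>r\<in>R. (F q - F r)\<^sup>2)"
      by (simp add: h_def sum_product3)
    also have "\<dots> = real N * pair_energy Q R F"
      using card by (simp add: pair_energy_def sum_distrib_left)
    finally show ?thesis by (simp add: L2_set_def)
  qed
  have "sqrt (real N * pair_energy P R F) \<le> sqrt (real N * pair_energy P Q F) + sqrt (real N * pair_energy Q R F)"
    unfolding PR PQ QR by (rule L2_set_triangle_ineq)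
  then have "sqrt (real N) * sqrt (pair_energy P R F) \<le> sqrt (real N) * (sqrt (pair_energy P Q F) + sqrt (pair_energy Q R F))"
    by (simp add: real_sqrt_mult distrib_left)
  then show ?thesis using card(4) by simp
qed

lemma square_three: "(a - d)\<^sup>2 \<le> 3 * ((a - b)\<^sup>2 + (b - c)\<^sup>2 + (c - d)\<^sup>2)" for a b c d :: real
proof -
  have "0 \<le> ((a - b) - (b - c))\<^sup>2 + ((b - c) - (c - d))\<^sup>2 + ((a - b) - (c - d))\<^sup>2" by simp
  then show ?thesis by (simp add: power2_eq_square algebra_simps)
qed

lemma sum_edges_le_dirich:
  assumes "finite S" "A \<subseteq> S" "j ` A \<subseteq> S" "\<And>z. z \<in> A \<Longrightarrow> j z = z \<or> W z (j z)"
  shows "(\<Sum>z\<in>A. (F z - F (j z))\<^sup>2) \<le> edge_energy W S F"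
proof -
  let ?E = "{p \<in> S \<times> S. W (fst p) (snd p)}" and ?A = "{z \<in> A. W z (j z)}"
  have fA: "finite A" using assms finite_subset by blast
  have "(\<Sum>z\<in>A. (F z - F (j z))\<^sup>2) = (\<Sum>z\<in>?A. (F z - F (j z))\<^sup>2)"
    using fA assms(4) by (intro sum.mono_neutral_right) fastforce+
  also have "\<dots> = (\<Sum>p\<in>(\<lambda>z. (z, j z)) ` ?A. (F (fst p) - F (snd p))\<^sup>2)"
    by (subst sum.reindex) (auto simp: inj_on_def)
  also have "\<dots> \<le> edge_energy W S F"
    unfolding edge_energy_def using assms(1-3) by (intro sum_mono2) auto
  finally show ?thesis .
qed

text \<open>Every pair \<open>(p, q)\<close> is routed through all \<open>z\<close> in
  \<open>A\<close> and averaged: from \<open>p\<close> to \<open>z\<close> inside \<open>P\<close>,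
  then along one edge to \<open>j z\<close>, then to \<open>q\<close> inside \<open>Q\<close>. The
  loss \<open>L\<close> bounds the inverse density of \<open>A\<close>.\<close>

lemma pair_energy_link:
  assumes fin: "finite S" and sub: "P \<subseteq> S" "Q \<subseteq> S"
    and card: "card P = N" "card Q = N"
    and A: "A \<subseteq> P" "inj_on j A" "j ` A \<subseteq> Q" "\<And>z. z \<in> A \<Longrightarrow> j z = z \<or> W z (j z)"
    and L: "real N \<le> L * real (card A)"
    and K: "K \<ge> 1" "pair_energy P P F \<le> K * real N * edge_energy W S F" "pair_energy Q Q F \<le> K * real N * edge_energy W S F"
    and L0: "L \<ge> 0"
  shows "pair_energy P Q F \<le> 9 * K * L * real N * edge_energy W S F"
proof (cases "card A = 0")
  case True
  then have "N = 0" using L by simp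
  moreover have "finite P" using fin sub finite_subset by blast
  ultimately have "P = {}" using card by simp
  then show ?thesis using K L0 edge_energy_nonneg[of W S F] by (simp add: pair_energy_def)
next
  case False
  let ?D = "edge_energy W S F"
  have fP: "finite P" "finite Q" using fin sub finite_subset by blast+
  have fA: "finite A" using fP A finite_subset by blast
  have E: "(\<Sum>z\<in>A. (F z - F (j z))\<^sup>2) \<le> ?D"
    using A sub by (intro sum_edges_le_dirich[OF fin]) auto
  have "real (card A) * pair_energy P Q F = (\<Sum>p\<in>P. \<Sum>q\<in>Q. \<Sum>z\<in>A. (F p - F q)\<^sup>2)"
    by (simp add: pair_energy_def sum_distrib_left)
  also have "\<dots> \<le> (\<Sum>p\<in>P. \<Sum>q\<in>Q. \<Sum>z\<in>A. 3 * ((F p - F z)\<^sup>2 + (F z - F (j z))\<^sup>2 + (F (j z) - F q)\<^sup>2))"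
    by (intro sum_mono square_three)
  also have "\<dots> = 3 * ((\<Sum>p\<in>P. \<Sum>q\<in>Q. \<Sum>z\<in>A. (F p - F z)\<^sup>2) + (\<Sum>p\<in>P. \<Sum>q\<in>Q. \<Sum>z\<in>A. (F z - F (j z))\<^sup>2)
       + (\<Sum>p\<in>P. \<Sum>q\<in>Q. \<Sum>z\<in>A. (F (j z) - F q)\<^sup>2))"
    by (simp only: sum.distrib sum_distrib_left[symmetric])
  also have "(\<Sum>p\<in>P. \<Sum>q\<in>Q. \<Sum>z\<in>A. (F p - F z)\<^sup>2) = real N * pair_energy P A F"
    using card by (simp add: pair_energy_def sum_distrib_left)
  also have "(\<Sum>p\<in>P. \<Sum>q\<in>Q. \<Sum>z\<in>A. (F z - F (j z))\<^sup>2) = real N * real N * (\<Sum>z\<in>A. (F z - F (j z))\<^sup>2)"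
    using card by (simp add: sum_distrib_left mult.assoc)
  also have "(\<Sum>p\<in>P. \<Sum>q\<in>Q. \<Sum>z\<in>A. (F (j z) - F q)\<^sup>2) = real N * pair_energy (j ` A) Q F"
    using card A(2) by (simp add: pair_energy_def sum.reindex) (subst sum.swap, simp)
  finally have "real (card A) * pair_energy P Q F
     \<le> 3 * (real N * pair_energy P A F + real N * real N * (\<Sum>z\<in>A. (F z - F (j z))\<^sup>2) + real N * pair_energy (j ` A) Q F)" .
  \<comment> \<open>Each of the three terms is at most \<open>K N^2\<close> times the edge energy,
    where \<open>K \<ge> 1\<close> serves for the middle one. With the factor 3 from
    \<open>square_three\<close> this makes 9.\<close>
  also have "\<dots> \<le> 3 * (real N * (K * real N * ?D) + real N * real N * (K * ?D) + real N * (K * real N * ?D))"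
  proof -
    have "pair_energy P A F \<le> K * real N * ?D"
      using pair_energy_mono[OF fP(1) fP(1) order.refl A(1), of F] K by simp
    moreover have "pair_energy (j ` A) Q F \<le> K * real N * ?D"
      using pair_energy_mono[OF fP(2) fP(2) A(3) order.refl, of F] K by simp
    moreover have "(\<Sum>z\<in>A. (F z - F (j z))\<^sup>2) \<le> K * ?D"
      using E K(1) mult_right_mono[of 1 K ?D] edge_energy_nonneg[of W S F] by simp
    ultimately show ?thesis by (intro mult_left_mono add_mono) auto
  qed
  also have "\<dots> = 9 * K * real N * ?D * real N" by (simp add: algebra_simps)
  also have "\<dots> \<le> 9 * K * real N * ?D * (L * real (card A))"
    using L K(1) edge_energy_nonneg[of W S F] by (intro mult_left_mono) auto
  finally have "real (card A) * pair_energy P Q F \<le> real (card A) * (9 * K * L * real N * ?D)"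
    by (simp add: algebra_simps)
  then show ?thesis using False by (simp add: mult_le_cancel_left_pos)
qed

text \<open>Here \<open>with_crossing\<close> stands for an arbitrary family of sets of equal size.
  Square roots of pair energies add up along a chain, so the loss is quadratic in its length and not
  exponential.\<close>

lemma pair_energy_chain:
  assumes fin: "\<And>p. p \<in> I \<Longrightarrow> finite (with_crossing p)" and card: "\<And>p. p \<in> I \<Longrightarrow> card (with_crossing p) = N" and N: "N > 0"
    and R: "R \<subseteq> I \<times> I" "\<And>p q. (p, q) \<in> R \<Longrightarrow> sqrt (pair_energy (with_crossing p) (with_crossing q) F) \<le> c"
    and self: "\<And>p. p \<in> I \<Longrightarrow> sqrt (pair_energy (with_crossing p) (with_crossing p) F) \<le> c"
    and p: "p \<in> I" "(p, q) \<in> R ^^ l"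
  shows "q \<in> I \<and> sqrt (pair_energy (with_crossing p) (with_crossing q) F) \<le> real (Suc l) * c"
  using p(2)
proof (induction l arbitrary: q)
  case 0
  then show ?case using self p by simp
next
  case (Suc l)
  then obtain r where r: "(p, r) \<in> R ^^ l" "(r, q) \<in> R" by auto
  have I: "q \<in> I" "r \<in> I" using r R by auto
  have "sqrt (pair_energy (with_crossing p) (with_crossing q) F) \<le> sqrt (pair_energy (with_crossing p) (with_crossing r) F) + sqrt (pair_energy (with_crossing r) (with_crossing q) F)"
    using p I fin card N by (intro pair_energy_triangle) auto
  also have "\<dots> \<le> real (Suc l) * c + c" using Suc.IH[OF r(1)] R(2)[OF r(2)] by simp
  finally show ?case using I by (simp add: algebra_simps)
qed

text \<open>The sets, again an arbitrary family, may overlap, so the energy of the union is bounded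
  by the sum over all ordered pairs of members. Two members are joined by a chain in
  \<open>R\<close>, which need not be longer than the number of elements of \<open>R\<close>, hence
  than \<open>M^2\<close>.\<close>

lemma Poincare_union:
  assumes finS: "finite S" and finI: "finite I"
    and cover: "S = (\<Union>p\<in>I. with_crossing p)"
    and card: "\<And>p. p \<in> I \<Longrightarrow> card (with_crossing p) = N"
    and R: "R \<subseteq> I \<times> I" "\<And>p q. (p, q) \<in> R \<Longrightarrow> pair_energy (with_crossing p) (with_crossing q) F \<le> c * real N"
    and self: "\<And>p. p \<in> I \<Longrightarrow> pair_energy (with_crossing p) (with_crossing p) F \<le> c * real N"
    and conn: "\<And>p q. p \<in> I \<Longrightarrow> q \<in> I \<Longrightarrow> (p, q) \<in> R\<^sup>*"
    and M: "card I \<le> M" "M \<ge> 1" and c: "c \<ge> 0"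
  shows "pair_energy S S F \<le> 4 * real M ^ 6 * c * real (card S)"
proof (cases "S = {}")
  case True
  then show ?thesis by (simp add: pair_energy_def)
next
  case False
  then obtain p0 where p0: "p0 \<in> I" "with_crossing p0 \<noteq> {}" using cover by auto
  have sub: "with_crossing p \<subseteq> S" if "p \<in> I" for p using that cover by auto
  have fin: "finite (with_crossing p)" if "p \<in> I" for p using sub[OF that] finS finite_subset by blast
  have N: "N > 0" using p0 card fin by (metis card_gt_0_iff)
  have NS: "N \<le> card S" using card_mono[OF finS sub[OF p0(1)]] card[OF p0(1)] by simp
  have fR: "finite R" using R(1) finI finite_subset by blast
  have "card R \<le> card (I \<times> I)" using R(1) finI by (intro card_mono) auto
  then have cR: "card R \<le> M\<^sup>2"
    using M(1) mult_le_mono[OF M(1) M(1)] by (simp add: card_cartesian_product power2_eq_square)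
  have pair: "pair_energy (with_crossing p) (with_crossing q) F \<le> (real (Suc (M\<^sup>2)))\<^sup>2 * (c * real N)" if pq: "p \<in> I" "q \<in> I" for p q
  proof -
    obtain l where l: "(p, q) \<in> R ^^ l" "l \<le> card R"
      using conn[OF pq] rtrancl_finite_eq_relpow[OF fR] by auto
    have "sqrt (pair_energy (with_crossing p) (with_crossing q) F) \<le> real (Suc l) * sqrt (c * real N)"
    proof (intro pair_energy_chain[of I with_crossing N R F "sqrt (c * real N)" p q l, THEN conjunct2] fin card N R(1) pq l)
      show "sqrt (pair_energy (with_crossing p) (with_crossing q) F) \<le> sqrt (c * real N)" if "(p, q) \<in> R" for p q
        using R(2)[OF that] by simp
      show "sqrt (pair_energy (with_crossing p) (with_crossing p) F) \<le> sqrt (c * real N)" if "p \<in> I" for p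
        using self[OF that] by simp
    qed
    also have "\<dots> \<le> real (Suc (M\<^sup>2)) * sqrt (c * real N)"
      using l(2) cR c by (intro mult_right_mono) auto
    finally have "(sqrt (pair_energy (with_crossing p) (with_crossing q) F))\<^sup>2 \<le> (real (Suc (M\<^sup>2)) * sqrt (c * real N))\<^sup>2"
      by (intro power_mono) (auto simp: pair_energy_nonneg)
    then show ?thesis using c by (simp add: power_mult_distrib pair_energy_nonneg)
  qed
  have UN: "(\<Sum>s\<in>S. f s) \<le> (\<Sum>p\<in>I. \<Sum>s\<in>with_crossing p. f s)" if "\<And>s. f s \<ge> 0" for f :: "_ \<Rightarrow> real"
    unfolding cover using finI
  proof (induction I)
    case (insert i J)
    show ?case
    proof (cases "finite (with_crossing i) \<and> finite (\<Union>p\<in>J. with_crossing p)")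
      case True
      then have "sum f (\<Union>p\<in>insert i J. with_crossing p) \<le> sum f (with_crossing i) + sum f (\<Union>p\<in>J. with_crossing p)"
        using sum_Un[of "with_crossing i" "\<Union>p\<in>J. with_crossing p" f] sum_nonneg[of "with_crossing i \<inter> (\<Union>p\<in>J. with_crossing p)" f] that by simp
      then show ?thesis using insert by simp
    next
      case False
      then have "infinite (\<Union>p\<in>insert i J. with_crossing p)" by (auto dest: finite_subset[rotated])
      then show ?thesis using that by (simp add: sum_nonneg)
    qed
  qed simp
  have "pair_energy S S F \<le> (\<Sum>p\<in>I. \<Sum>s\<in>with_crossing p. \<Sum>t\<in>S. (F s - F t)\<^sup>2)"
    unfolding pair_energy_def by (intro UN sum_nonneg) auto
  also have "\<dots> \<le> (\<Sum>p\<in>I. \<Sum>s\<in>with_crossing p. \<Sum>q\<in>I. \<Sum>t\<in>with_crossing q. (F s - F t)\<^sup>2)"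
    by (intro sum_mono UN) auto
  also have "\<dots> = (\<Sum>p\<in>I. \<Sum>q\<in>I. pair_energy (with_crossing p) (with_crossing q) F)"
    unfolding pair_energy_def by (intro sum.cong refl sum.swap)
  also have "\<dots> \<le> (\<Sum>p\<in>I. \<Sum>q\<in>I. (real (Suc (M\<^sup>2)))\<^sup>2 * (c * real N))"
    by (intro sum_mono pair)
  also have "\<dots> = real (card I) * real (card I) * ((real (Suc (M\<^sup>2)))\<^sup>2 * (c * real N))"
    by simp
  \<comment> \<open>There are at most \<open>M^2\<close> pairs, and each costs the square of
    \<open>M^2 + 1 \<le> 2 M^2\<close>.\<close>
  also have "\<dots> \<le> (real M * real M) * ((2 * real M ^ 2)\<^sup>2 * (c * real (card S)))"
  proof -
    have "1 \<le> real M ^ 2" using M(2) by (intro one_le_power) simp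
    then have "real (Suc (M\<^sup>2)) \<le> 2 * real M ^ 2" by (simp only: of_nat_Suc of_nat_power)
    then have "(real (Suc (M\<^sup>2)))\<^sup>2 \<le> (2 * real M ^ 2)\<^sup>2" by (intro power_mono) auto
    moreover have "c * real N \<le> c * real (card S)" using c NS by (intro mult_left_mono) auto
    ultimately show ?thesis using M(1) c NS by (intro mult_mono mult_nonneg_nonneg) auto
  qed
  also have "\<dots> = 4 * real M ^ 6 * c * real (card S)"
    by (simp add: power_mult_distrib power2_eq_square eval_nat_numeral)
  finally show ?thesis .
qed

text \<open>The image \<open>B\<close> is compared with the edges of the larger set
  \<open>S\<close>: in this form an inequality for a core word bounds the energy of a class inside
  all gluings.\<close>

lemma Poincare_image:
  assumes bij: "bij_betw f A B" and fin: "finite S" and B: "B \<subseteq> S" and p: "Poincare W A K"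
    and W: "\<And>x y. x \<in> A \<Longrightarrow> y \<in> A \<Longrightarrow> W x y \<Longrightarrow> W' (f x) (f y)" and K: "K \<ge> 0"
  shows "pair_energy B B F \<le> K * real (card B) * edge_energy W' S F"
proof -
  have inj: "inj_on f A" and im: "f ` A = B" using bij by (auto simp: bij_betw_def)
  have "pair_energy B B F = pair_energy A A (F \<circ> f)"
    unfolding pair_energy_def im[symmetric] by (simp add: sum.reindex[OF inj])
  also have "\<dots> \<le> K * real (card A) * edge_energy W A (F \<circ> f)" using p by (simp add: Poincare_def)
  also have "card A = card B" using bij by (rule bij_betw_same_card)
  also have "edge_energy W A (F \<circ> f) \<le> edge_energy W' S F"
  proof -
    let ?E = "{p \<in> A \<times> A. W (fst p) (snd p)}" and ?g = "\<lambda>p. (f (fst p), f (snd p))"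
    have "inj_on ?g ?E" using inj by (auto simp: inj_on_def)
    then have "edge_energy W A (F \<circ> f) = (\<Sum>p\<in>?g ` ?E. (F (fst p) - F (snd p))\<^sup>2)"
      unfolding edge_energy_def by (simp add: sum.reindex)
    also have "\<dots> \<le> edge_energy W' S F"
      unfolding edge_energy_def
    proof (intro sum_mono2)
      show "?g ` ?E \<subseteq> {p \<in> S \<times> S. W' (fst p) (snd p)}"
        using W im B by auto
    qed (use fin in auto)
    finally show ?thesis .
  qed
  then have "K * real (card B) * edge_energy W A (F \<circ> f) \<le> K * real (card B) * edge_energy W' S F"
    using K by (intro mult_left_mono) auto
  finally show ?thesis .
qed

section \<open>Crossing pairs of chords\<close>

text \<open>Conjugation renames \<open>x\<close> and \<open>y\<close>, so the chords
  \<open>{x, s x}\<close> and \<open>{y, s y}\<close> become \<open>{x, s y}\<close> and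
  \<open>{y, s x}\<close>; the other recombination arises with \<open>s y\<close> in place of
  \<open>y\<close>. The side conditions make these two distinct chords.\<close>

definition sw :: "('a \<Rightarrow> 'a) \<Rightarrow> ('a \<Rightarrow> 'a) \<Rightarrow> bool" where
  "sw s t \<longleftrightarrow> (\<exists>x y. x \<noteq> y \<and> s x \<noteq> x \<and> s y \<noteq> y \<and> s x \<noteq> y \<and> t = swp x y \<circ> s \<circ> swp x y)"

lemma conj_swp_twice: "swp x y \<circ> (swp x y \<circ> s \<circ> swp x y) \<circ> swp x y = s"
  by (simp add: fun_eq_iff)

lemma inj_conj_swp: "inj_on (\<lambda>s. swp x y \<circ> s \<circ> swp x y) A"
proof (rule inj_onI)
  fix s s' assume "swp x y \<circ> s \<circ> swp x y = swp x y \<circ> s' \<circ> swp x y"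
  then have "swp x y \<circ> (swp x y \<circ> s \<circ> swp x y) \<circ> swp x y = swp x y \<circ> (swp x y \<circ> s' \<circ> swp x y) \<circ> swp x y"
    by (rule arg_cong)
  then show "s = s'" by (simp only: conj_swp_twice)
qed

lemma sw_conj:
  assumes "s \<in> matching S" "x \<in> S" "y \<in> S" "x \<noteq> y" "s x \<noteq> y"
  shows "sw s (swp x y \<circ> s \<circ> swp x y)"
  unfolding sw_def using assms by (intro exI[of _ x] exI[of _ y]) (simp add: matching_def)

lemma sw_sym:
  assumes s: "s \<in> matching S" and st: "sw s t"
  shows "sw t s"
proof -
  obtain x y where xy: "x \<noteq> y" "s x \<noteq> x" "s y \<noteq> y" "s x \<noteq> y" "t = swp x y \<circ> s \<circ> swp x y"
    using st unfolding sw_def by blast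
  have inv: "s (s z) = z" for z using matching_invol[OF s] .
  have syx: "s y \<noteq> x" using inv xy by metis
  have "t x = s y" "t y = s x" using xy syx by (simp_all add: transpose_def)
  moreover have "s = swp x y \<circ> t \<circ> swp x y" unfolding xy(5) by (simp only: conj_swp_twice)
  ultimately show ?thesis unfolding sw_def using xy syx by metis
qed

text \<open>A pair of crossing chords \<open>{p1, p3}\<close>, \<open>{p2, p4}\<close> cuts the cyclic word \<open>xs\<close> into the four arcs \<open>B\<close>, \<open>C\<close>, \<open>D\<close>, \<open>E\<close>.\<close>

definition conf :: "'a list \<Rightarrow> 'a \<Rightarrow> 'a list \<Rightarrow> 'a \<Rightarrow> 'a list \<Rightarrow> 'a \<Rightarrow> 'a list \<Rightarrow> 'a \<Rightarrow> 'a list \<Rightarrow> bool" where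
  "conf xs p1 B p2 C p3 D p4 E \<longleftrightarrow> (\<exists>k. rotate k xs = p1 # B @ p2 # C @ p3 # D @ p4 # E)"

definition with_crossing :: "'a list \<Rightarrow> nat \<Rightarrow> 'a \<times> 'a \<times> 'a \<times> 'a \<Rightarrow> ('a \<Rightarrow> 'a) set" where
  "with_crossing xs v = (\<lambda>(p1, p2, p3, p4). {s \<in> gluings xs v. s p1 = p3 \<and> s p2 = p4})"

text \<open>In a word with distinct letters each crossing pair occurs four times, once for each
  letter to start with, always with the same class of gluings.\<close>

definition crossing_quads :: "'a list \<Rightarrow> ('a \<times> 'a \<times> 'a \<times> 'a) set" where
  "crossing_quads xs = {(p1, p2, p3, p4) | p1 p2 p3 p4. \<exists>B C D E. conf xs p1 B p2 C p3 D p4 E}"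

lemma crossing_quadsI: "conf xs p1 B p2 C p3 D p4 E \<Longrightarrow> (p1, p2, p3, p4) \<in> crossing_quads xs"
  by (auto simp: crossing_quads_def)

lemma rotate_append_rotate: "rotate k xs = A @ B \<Longrightarrow> \<exists>k. rotate k xs = B @ A"
  by (metis rotate_append rotate_rotate)

lemma conf_rotate:
  assumes "conf xs p1 B p2 C p3 D p4 E"
  shows "conf xs p2 C p3 D p4 E p1 B"
proof -
  obtain k where "rotate k xs = (p1 # B) @ (p2 # C @ p3 # D @ p4 # E)"
    using assms by (auto simp: conf_def)
  from rotate_append_rotate[OF this] show ?thesis by (simp add: conf_def)
qed

lemma gluings_rotate_eq: "distinct xs \<Longrightarrow> gluings (rotate k xs) v = gluings xs v"
  by (metis append_take_drop_id gluings_rotate rotate_drop_take)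

lemma conf_facts:
  assumes "conf xs p1 B p2 C p3 D p4 E" "distinct xs"
  shows "distinct (p1 # B @ p2 # C @ p3 # D @ p4 # E)"
    and "gluings (p1 # B @ p2 # C @ p3 # D @ p4 # E) v = gluings xs v"
    and "length B + length C + length D + length E + 4 = length xs"
    and "set (p1 # B @ p2 # C @ p3 # D @ p4 # E) = set xs"
proof -
  obtain k where k: "rotate k xs = p1 # B @ p2 # C @ p3 # D @ p4 # E"
    using assms by (auto simp: conf_def)
  show "distinct (p1 # B @ p2 # C @ p3 # D @ p4 # E)" unfolding k[symmetric] using assms by simp
  show "gluings (p1 # B @ p2 # C @ p3 # D @ p4 # E) v = gluings xs v"
    unfolding k[symmetric] using assms by (simp add: gluings_rotate_eq)
  show "length B + length C + length D + length E + 4 = length xs"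
    using arg_cong[OF k, of length] by simp
  show "set (p1 # B @ p2 # C @ p3 # D @ p4 # E) = set xs" unfolding k[symmetric] by simp
qed

text \<open>Composing with the two transpositions is invertible and keeps the number of vertices, so
  a class is a copy of all gluings of a shorter word. This is where the induction hypothesis
  enters.\<close>

lemma with_crossing_core:
  assumes c: "conf xs p1 B p2 C p3 D p4 E" and d: "distinct xs"
  shows "bij_betw (\<lambda>r. swp p1 p3 \<circ> swp p2 p4 \<circ> r) (gluings (D @ C @ B @ E) v) (with_crossing xs v (p1, p2, p3, p4))"
  unfolding bij_betw_def
proof
  note f = conf_facts[OF c d]
  show "inj_on (\<lambda>r. swp p1 p3 \<circ> swp p2 p4 \<circ> r) (gluings (D @ C @ B @ E) v)"
  proof (rule inj_onI)
    fix r r' assume "swp p1 p3 \<circ> swp p2 p4 \<circ> r = swp p1 p3 \<circ> swp p2 p4 \<circ> r'"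
    then show "r = r'" by (metis comp_assoc swp_swp_comp)
  qed
  show "(\<lambda>r. swp p1 p3 \<circ> swp p2 p4 \<circ> r) ` gluings (D @ C @ B @ E) v = with_crossing xs v (p1, p2, p3, p4)"
  proof (intro subset_antisym subsetI)
    fix s assume "s \<in> (\<lambda>r. swp p1 p3 \<circ> swp p2 p4 \<circ> r) ` gluings (D @ C @ B @ E) v"
    then obtain r where r: "r \<in> gluings (D @ C @ B @ E) v" "s = swp p1 p3 \<circ> swp p2 p4 \<circ> r" by blast
    show "s \<in> with_crossing xs v (p1, p2, p3, p4)"
      using gluings_crossing_mem[OF f(1) r(1)] f(2)[of v] unfolding r(2) with_crossing_def by simp
  next
    fix s assume "s \<in> with_crossing xs v (p1, p2, p3, p4)"
    then have "s \<in> gluings (p1 # B @ p2 # C @ p3 # D @ p4 # E) v" "s p1 = p3" "s p2 = p4"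
      using f(2)[of v] by (auto simp: with_crossing_def)
    from gluings_crossing_core[OF f(1) this] obtain r where "r \<in> gluings (D @ C @ B @ E) v" "s = swp p1 p3 \<circ> swp p2 p4 \<circ> r" by blast
    then show "s \<in> (\<lambda>r. swp p1 p3 \<circ> swp p2 p4 \<circ> r) ` gluings (D @ C @ B @ E) v" by blast
  qed
qed

lemma with_crossing_coreI:
  assumes c: "conf xs p1 B p2 C p3 D p4 E" and d: "distinct xs" and r: "r \<in> gluings (D @ C @ B @ E) v"
  shows "swp p1 p3 \<circ> swp p2 p4 \<circ> r \<in> with_crossing xs v (p1, p2, p3, p4)"
  using imageI[OF r, of "\<lambda>r. swp p1 p3 \<circ> swp p2 p4 \<circ> r"]
  by (simp only: bij_betw_imp_surj_on[OF with_crossing_core[OF c d, of v]])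

lemma with_crossing_coreE:
  assumes c: "conf xs p1 B p2 C p3 D p4 E" and d: "distinct xs" and s: "s \<in> with_crossing xs v (p1, p2, p3, p4)"
  obtains r where "r \<in> gluings (D @ C @ B @ E) v" "s = swp p1 p3 \<circ> swp p2 p4 \<circ> r"
  using s unfolding bij_betw_imp_surj_on[OF with_crossing_core[OF c d, of v], symmetric] by (rule imageE)

lemma comp_swp_inv:
  assumes "bij t"
  shows "t \<circ> swp a b = swp (t a) (t b) \<circ> t"
  using assms by (auto simp: fun_eq_iff transpose_def bij_is_inj inj_eq)

lemma comp_swp_assoc:
  assumes "bij t"
  shows "t \<circ> (swp a b \<circ> z) = swp (t a) (t b) \<circ> (t \<circ> z)"
  unfolding comp_assoc[symmetric] comp_swp_inv[OF assms] by (rule refl)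

text \<open>A link carries at least a fraction \<open>1 / length xs ^ 2\<close> of the \<open>N\<close> elements of one class injectively into the other.\<close>

definition link :: "'a list \<Rightarrow> nat \<Rightarrow> nat \<Rightarrow> (('a \<times> 'a \<times> 'a \<times> 'a) \<times> ('a \<times> 'a \<times> 'a \<times> 'a)) set" where
  "link xs v N = {(p, q). p \<in> crossing_quads xs \<and> q \<in> crossing_quads xs \<and>
     (\<exists>A j. A \<subseteq> with_crossing xs v p \<and> inj_on j A \<and> j ` A \<subseteq> with_crossing xs v q \<and> (\<forall>z\<in>A. j z = z \<or> sw z (j z)) \<and>
       N \<le> length xs ^ 2 * card A)}"

lemma linkI:
  assumes "p \<in> crossing_quads xs" "q \<in> crossing_quads xs" "A \<subseteq> with_crossing xs v p" "inj_on j A" "j ` A \<subseteq> with_crossing xs v q"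
    "\<And>z. z \<in> A \<Longrightarrow> j z = z \<or> sw z (j z)" "N \<le> length xs ^ 2 * card A"
  shows "(p, q) \<in> link xs v N"
  unfolding link_def using assms by blast

lemma with_crossing_matching: "s \<in> with_crossing xs v p \<Longrightarrow> s \<in> matching (set xs)"
  by (auto simp: with_crossing_def gluings_def split: prod.splits)

lemma link_sym: "sym (link xs v N)"
proof (rule symI)
  fix p q assume "(p, q) \<in> link xs v N"
  then obtain A j where A: "p \<in> crossing_quads xs" "q \<in> crossing_quads xs" "A \<subseteq> with_crossing xs v p" "inj_on j A" "j ` A \<subseteq> with_crossing xs v q"
    "\<forall>z\<in>A. j z = z \<or> sw z (j z)" "N \<le> length xs ^ 2 * card A"
    unfolding link_def by blast
  show "(q, p) \<in> link xs v N"
  proof (rule linkI[of _ _ _ "j ` A" _ "inv_into A j"])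
    show "inv_into A j ` j ` A \<subseteq> with_crossing xs v p" using A by auto
    show "inj_on (inv_into A j) (j ` A)" by (rule inj_on_inv_into) simp
    show "N \<le> length xs ^ 2 * card (j ` A)" using A by (simp add: card_image)
    fix z assume "z \<in> j ` A"
    then obtain a where a: "a \<in> A" "z = j a" by blast
    then have "inv_into A j z = a" using A(4) by simp
    moreover have "sw a (j a) \<Longrightarrow> sw (j a) a" using A(3) a with_crossing_matching sw_sym by blast
    ultimately show "inv_into A j z = z \<or> sw z (inv_into A j z)" using A(6) a by metis
  qed (use A in auto)
qed

section \<open>Moves between neighbouring classes\<close>

context
  fixes xs :: "nat list" and v N :: nat
  assumes d: "distinct xs" and len: "length xs \<ge> 6" and v: "v \<ge> 2"
    and N: "\<And>ys :: nat list. distinct ys \<Longrightarrow> length ys + 4 = length xs \<Longrightarrow> card (gluings ys v) = N"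
begin

lemma sq_pos: "length xs ^ 2 \<ge> 1"
  using len by simp

lemma card_Om:
  assumes c: "conf xs p1 B p2 C p3 D p4 E"
  shows "card (with_crossing xs v (p1, p2, p3, p4)) = N"
proof -
  have "card (gluings (D @ C @ B @ E) v) = N"
    using conf_facts(1,3)[OF c d] by (intro N) auto
  then show ?thesis using bij_betw_same_card[OF with_crossing_core[OF c d, of v]] by simp
qed

text \<open>\<open>ys\<close> is a core word with a leaf cut off, hence six letters less and
  \<open>v - 1\<close> vertices, which is positive. Gluings with this leaf thus make up at least
  \<open>1 / length xs ^ 2\<close> of a class.\<close>

lemma card_smaller:
  fixes ys :: "nat list"
  assumes "distinct ys" "length ys + 6 = length xs"
  shows "N \<le> length xs ^ 2 * card (gluings ys (v - 1))"
proof -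
  let ?z = "take (length ys + 2) xs"
  have z: "distinct ?z" "length ?z = length ys + 2" using d assms by auto
  have "N = card (gluings ?z (Suc (v - 1)))" using N[of ?z] z assms v by simp
  also have "\<dots> \<le> length ?z ^ 2 * card (gluings ys (v - 1))"
    using z assms v by (intro gluings_contract_bound) auto
  also have "\<dots> \<le> length xs ^ 2 * card (gluings ys (v - 1))"
    using z assms by (intro mult_right_mono power_mono) auto
  finally show ?thesis .
qed

text \<open>Both quadruples name the same two chords, so the classes coincide and the identity
  serves as the link.\<close>

lemma link_rotate:
  assumes c: "conf xs p1 B p2 C p3 D p4 E"
  shows "((p1, p2, p3, p4), (p2, p3, p4, p1)) \<in> link xs v N"
proof (rule linkI[where A = "with_crossing xs v (p1, p2, p3, p4)" and j = id])
  show "id ` with_crossing xs v (p1, p2, p3, p4) \<subseteq> with_crossing xs v (p2, p3, p4, p1)"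
    using matching_invol by (fastforce simp: with_crossing_def gluings_def)
  show "N \<le> length xs ^ 2 * card (with_crossing xs v (p1, p2, p3, p4))"
    using card_Om[OF c] sq_pos by simp
qed (use crossing_quadsI[OF c] crossing_quadsI[OF conf_rotate[OF c]] in auto)

text \<open>Conjugation exchanges an end \<open>x\<close> of the first chord with a letter
  \<open>w\<close> of the core, which is a swap of two chords. It carries class to class as soon as
  it carries the gluings of one core word to those of the other.\<close>

lemma link_conj:
  assumes c: "conf xs p1 B p2 C p3 D p4 E" and c': "conf xs q1 B' q2 C' q3 D' q4 E'"
    and x: "x \<in> {p1, p3}" and w: "w \<in> set xs - {p1, p2, p3, p4}"
    and q: "q1 = swp x w p1" "q2 = swp x w p2" "q3 = swp x w p3" "q4 = swp x w p4"
    and core: "gluings (map (swp x w) (D @ C @ B @ E)) v = gluings (D' @ C' @ B' @ E') v"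
  shows "((p1, p2, p3, p4), (q1, q2, q3, q4)) \<in> link xs v N"
proof (rule linkI[where A = "with_crossing xs v (p1, p2, p3, p4)" and j = "\<lambda>s. swp x w \<circ> s \<circ> swp x w"])
  let ?t = "swp x w"
  show "N \<le> length xs ^ 2 * card (with_crossing xs v (p1, p2, p3, p4))"
    using card_Om[OF c] sq_pos by simp
  show "inj_on (\<lambda>s. ?t \<circ> s \<circ> ?t) (with_crossing xs v (p1, p2, p3, p4))"
    by (rule inj_conj_swp)
  show "(\<lambda>s. ?t \<circ> s \<circ> ?t) ` with_crossing xs v (p1, p2, p3, p4) \<subseteq> with_crossing xs v (q1, q2, q3, q4)"
  proof
    fix u assume "u \<in> (\<lambda>s. ?t \<circ> s \<circ> ?t) ` with_crossing xs v (p1, p2, p3, p4)"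
    then obtain s where s: "s \<in> with_crossing xs v (p1, p2, p3, p4)" and us: "u = ?t \<circ> s \<circ> ?t"
      by (rule imageE)
    from with_crossing_coreE[OF c d s] obtain r where r: "r \<in> gluings (D @ C @ B @ E) v"
      and sr: "s = swp p1 p3 \<circ> swp p2 p4 \<circ> r" .
    have u: "u = ?t \<circ> (swp p1 p3 \<circ> swp p2 p4 \<circ> r) \<circ> ?t" by (simp only: us sr)
    have "distinct (D @ C @ B @ E)" using conf_facts(1)[OF c d] by auto
    from gluings_conj_mem[OF bij_transpose this r, of x w] core
    have r': "?t \<circ> r \<circ> ?t \<in> gluings (D' @ C' @ B' @ E') v" by (simp only: inv_transpose_eq)
    have "u = swp q1 q3 \<circ> swp q2 q4 \<circ> (?t \<circ> r \<circ> ?t)"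
      unfolding u q comp_assoc comp_swp_assoc[OF bij_transpose, of x w p1 p3]
        comp_swp_assoc[OF bij_transpose, of x w p2 p4] by (rule refl)
    then show "u \<in> with_crossing xs v (q1, q2, q3, q4)"
      using with_crossing_coreI[OF c' d r'] by (simp only:)
  qed
  fix s assume s: "s \<in> with_crossing xs v (p1, p2, p3, p4)"
  have m: "s \<in> matching (set xs)" using with_crossing_matching[OF s] .
  have "s p1 = p3" "s p3 = p1" using s matching_invol[OF m] by (auto simp: with_crossing_def)
  moreover have "p1 \<in> set xs" "p3 \<in> set xs" using conf_facts(4)[OF c d] by auto
  ultimately have "sw s (?t \<circ> s \<circ> ?t)" using x w by (intro sw_conj[OF m]) auto
  then show "?t \<circ> s \<circ> ?t = s \<or> sw s (?t \<circ> s \<circ> ?t)" ..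
qed (use crossing_quadsI[OF c] crossing_quadsI[OF c'] in auto)

text \<open>In this and the next lemma the core words before and after the move agree up to rotation and renaming,
  so the move is defined on the whole class.\<close>

lemma link_slide_free:
  assumes c: "conf xs p1 (w # B) p2 [] p3 [] p4 E"
  shows "conf xs w B p2 [] p3 [] p4 (E @ [p1])" "((p1, p2, p3, p4), (w, p2, p3, p4)) \<in> link xs v N"
proof -
  note f = conf_facts[OF c d]
  obtain k where "rotate k xs = [p1] @ (w # B @ p2 # p3 # p4 # E)"
    using c by (auto simp: conf_def)
  from rotate_append_rotate[OF this] show c': "conf xs w B p2 [] p3 [] p4 (E @ [p1])" by (simp add: conf_def)
  have fix_: "map (swp p1 w) l = l" if "p1 \<notin> set l" "w \<notin> set l" for l
    using that by (intro map_idI) (metis transpose_apply_other)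
  have "map (swp p1 w) ([] @ [] @ (w # B) @ E) = [p1] @ (B @ E)"
    using f(1) by (simp add: fix_)
  moreover have "gluings ([p1] @ (B @ E)) v = gluings ((B @ E) @ [p1]) v"
    using f(1) by (intro gluings_rotate) auto
  ultimately show "((p1, p2, p3, p4), (w, p2, p3, p4)) \<in> link xs v N"
    using f(1,4) by (intro link_conj[OF c c', of p1]) auto
qed

lemma link_slide_over:
  assumes c: "conf xs p1 B p2 [w] p3 [] p4 E"
  shows "conf xs p1 B p2 [] w [p3] p4 E" "((p1, p2, p3, p4), (p1, p2, w, p4)) \<in> link xs v N"
proof -
  note f = conf_facts[OF c d]
  show c': "conf xs p1 B p2 [] w [p3] p4 E" using c by (simp add: conf_def)
  have fix_: "map (swp p3 w) l = l" if "p3 \<notin> set l" "w \<notin> set l" for l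
    using that by (intro map_idI) (metis transpose_apply_other)
  have "map (swp p3 w) ([] @ [w] @ B @ E) = [p3] @ [] @ B @ E"
    using f(1) by (simp add: fix_)
  then show "((p1, p2, p3, p4), (p1, p2, w, p4)) \<in> link xs v N"
    using f(1,4) by (intro link_conj[OF c c', of p3]) auto
qed

text \<open>If \<open>{x, y}\<close> is a leaf next to \<open>p1\<close>, exchanging
  \<open>p1\<close> and \<open>y\<close> turns \<open>{p1, x}\<close> into the leaf and lets the
  crossing chord start two letters further on. Only the gluings with this leaf are carried
  along.\<close>

lemma link_slide_leaf:
  assumes c: "conf xs p1 (x # y # B) p2 C p3 D p4 E"
  shows "conf xs y B p2 C p3 D p4 (E @ [p1, x])" "((p1, p2, p3, p4), (y, p2, p3, p4)) \<in> link xs v N"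
proof -
  note f = conf_facts[OF c d]
  obtain k where "rotate k xs = [p1, x] @ (y # B @ p2 # C @ p3 # D @ p4 # E)"
    using c by (auto simp: conf_def)
  from rotate_append_rotate[OF this] show c': "conf xs y B p2 C p3 D p4 (E @ [p1, x])" by (simp add: conf_def)
  let ?T = "gluings (D @ C @ B @ E) (v - 1)" and ?t = "swp p1 y"
  let ?f = "\<lambda>r. swp p1 p3 \<circ> swp p2 p4 \<circ> (swp x y \<circ> r)"
  have sv: "Suc (v - 1) = v" using v by simp
  have fT: "?f r \<in> with_crossing xs v (p1, p2, p3, p4)" if r: "r \<in> ?T" for r
  proof -
    \<comment> \<open>The leaf lies inside the core word, but \<open>gluings_leaf_mem\<close>
      attaches it in front, hence one rotation before and one after.\<close>
    have "gluings (D @ C @ B @ E) (v - 1) = gluings (B @ E @ D @ C) (v - 1)"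
      using gluings_rotate[of "B @ E" "D @ C"] f(1) by auto
    with r have "r \<in> gluings (B @ E @ D @ C) (v - 1)" by simp
    moreover have "distinct (x # y # B @ E @ D @ C)" using f(1) by auto
    ultimately have "swp x y \<circ> r \<in> gluings (x # y # B @ E @ D @ C) v"
      using gluings_leaf_mem(1)[of x y "B @ E @ D @ C" r "v - 1"] sv by simp
    also have "\<dots> = gluings (D @ C @ (x # y # B) @ E) v"
      using gluings_rotate[of "D @ C" "x # y # B @ E"] f(1) by auto
    finally show ?thesis by (rule with_crossing_coreI[OF c d])
  qed
  have jT: "?t \<circ> ?f r \<circ> ?t \<in> with_crossing xs v (y, p2, p3, p4)" if r: "r \<in> ?T" for r
  proof -
    have m: "r \<in> matching (set (D @ C @ B @ E))" using r by (simp add: gluings_def)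
    have "r \<circ> ?t = ?t \<circ> r"
    proof -
      have "r p1 = p1" "r y = y" using m f(1) by (auto simp: matching_def)
      moreover have "bij r" using matching_permutes[OF m] by (rule permutes_bij)
      ultimately show ?thesis using comp_swp_inv[of r p1 y] by simp
    qed
    then have tr: "?t \<circ> (r \<circ> ?t) = r" by (simp only: swp_swp_comp)
    have ts: "?t p1 = y" "?t p3 = p3" "?t p2 = p2" "?t p4 = p4" "?t x = x" "?t y = p1"
      using f(1) by auto
    have eq: "?t \<circ> ?f r \<circ> ?t = swp y p3 \<circ> swp p2 p4 \<circ> (swp p1 x \<circ> r)"
      unfolding comp_assoc comp_swp_assoc[OF bij_transpose, of p1 y p1 p3]
        comp_swp_assoc[OF bij_transpose, of p1 y p2 p4] comp_swp_assoc[OF bij_transpose, of p1 y x y]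
        ts tr transpose_commute[of x p1] by (rule refl)
    have "distinct (p1 # x # D @ C @ B @ E)" using f(1) by auto
    then have "swp p1 x \<circ> r \<in> gluings (p1 # x # D @ C @ B @ E) v"
      using gluings_leaf_mem(1)[of p1 x "D @ C @ B @ E" r "v - 1"] r sv by simp
    also have "\<dots> = gluings (D @ C @ B @ (E @ [p1, x])) v"
      using gluings_rotate[of "D @ C @ B @ E" "[p1, x]"] f(1) by auto
    finally show ?thesis unfolding eq by (rule with_crossing_coreI[OF c' d])
  qed
  have injf: "inj_on ?f ?T"
  proof (rule inj_onI)
    fix r r' assume "?f r = ?f r'"
    then show "r = r'" by (metis comp_assoc swp_swp_comp)
  qed
  show "((p1, p2, p3, p4), (y, p2, p3, p4)) \<in> link xs v N"
  proof (rule linkI[where A = "?f ` ?T" and j = "\<lambda>s. ?t \<circ> s \<circ> ?t"])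
    show "?f ` ?T \<subseteq> with_crossing xs v (p1, p2, p3, p4)" using fT by blast
    show "(\<lambda>s. ?t \<circ> s \<circ> ?t) ` ?f ` ?T \<subseteq> with_crossing xs v (y, p2, p3, p4)" using jT by blast
    show "inj_on (\<lambda>s. ?t \<circ> s \<circ> ?t) (?f ` ?T)" by (rule inj_conj_swp)
    have "N \<le> length xs ^ 2 * card ?T" using f(1,3) by (intro card_smaller) auto
    then show "N \<le> length xs ^ 2 * card (?f ` ?T)" by (simp only: card_image[OF injf])
    fix s assume "s \<in> ?f ` ?T"
    then have s: "s \<in> with_crossing xs v (p1, p2, p3, p4)" using fT by blast
    then have m: "s \<in> matching (set xs)" by (rule with_crossing_matching)
    have "s p1 = p3" using s by (auto simp: with_crossing_def)
    then have "sw s (?t \<circ> s \<circ> ?t)" using f(1,4) by (intro sw_conj[OF m]) auto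
    then show "?t \<circ> s \<circ> ?t = s \<or> sw s (?t \<circ> s \<circ> ?t)" ..
  qed (use crossing_quadsI[OF c] crossing_quadsI[OF c'] in auto)
qed

text \<open>The chord \<open>{u, w}\<close> is parallel to \<open>{p2, p4}\<close>; in the core word \<open>D C B E\<close> the two letters are adjacent, so it is a leaf there.\<close>

lemma link_parallel:
  assumes c: "conf xs p1 B p2 (u # C) p3 (D @ [w]) p4 E"
  shows "conf xs p1 (B @ [p2]) u C p3 D w (p4 # E)" "((p1, p2, p3, p4), (p1, u, p3, w)) \<in> link xs v N"
proof -
  note f = conf_facts[OF c d]
  show c': "conf xs p1 (B @ [p2]) u C p3 D w (p4 # E)" using c by (simp add: conf_def)
  let ?T = "gluings (C @ B @ E @ D) (v - 1)"
  let ?f = "\<lambda>r. swp p1 p3 \<circ> swp p2 p4 \<circ> (swp w u \<circ> r)"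
  have sv: "Suc (v - 1) = v" using v by simp
  have fT: "?f r \<in> with_crossing xs v (p1, p2, p3, p4)" "?f r u = w" if r: "r \<in> ?T" for r
  proof -
    have "distinct (w # u # C @ B @ E @ D)" using f(1) by auto
    from gluings_leaf_mem[OF this r] sv
    have "swp w u \<circ> r \<in> gluings (w # u # C @ B @ E @ D) v" by simp
    also have "\<dots> = gluings ((D @ [w]) @ (u # C) @ B @ E) v"
      using gluings_rotate[of D "w # u # C @ B @ E"] f(1) by auto
    finally show "?f r \<in> with_crossing xs v (p1, p2, p3, p4)" by (rule with_crossing_coreI[OF c d])
    have "r u = u" using r f(1) by (auto simp: gluings_def matching_def)
    then show "?f r u = w" using f(1) by auto
  qed
  have injf: "inj_on ?f ?T"
  proof (rule inj_onI)
    fix r r' assume "?f r = ?f r'"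
    then show "r = r'" by (metis comp_assoc swp_swp_comp)
  qed
  show "((p1, p2, p3, p4), (p1, u, p3, w)) \<in> link xs v N"
  proof (rule linkI[where A = "?f ` ?T" and j = id])
    show "?f ` ?T \<subseteq> with_crossing xs v (p1, p2, p3, p4)" using fT(1) by blast
    have "?f r \<in> with_crossing xs v (p1, u, p3, w)" if "r \<in> ?T" for r
      using fT[OF that] unfolding with_crossing_def by blast
    then show "id ` ?f ` ?T \<subseteq> with_crossing xs v (p1, u, p3, w)" unfolding image_id id_apply by blast
    have "N \<le> length xs ^ 2 * card ?T" using f(1,3) by (intro card_smaller) auto
    then show "N \<le> length xs ^ 2 * card (?f ` ?T)" by (simp only: card_image[OF injf])
  qed (use crossing_quadsI[OF c] crossing_quadsI[OF c'] in auto)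
qed

end

section \<open>Connecting the crossing pairs\<close>

context
  fixes xs :: "nat list" and v N :: nat
  assumes d: "distinct xs" and len: "length xs \<ge> 6" and v: "v \<ge> 2"
    and N: "\<And>ys :: nat list. distinct ys \<Longrightarrow> length ys + 4 = length xs \<Longrightarrow> card (gluings ys v) = N"
begin

abbreviation eqv (infix "\<sim>" 50) where
  "p \<sim> q \<equiv> (p, q) \<in> (link xs v N)\<^sup>*"

lemma eqv_sym: "p \<sim> q \<Longrightarrow> q \<sim> p"
  using sym_rtrancl[OF link_sym] by (rule symD)

lemma eqv_trans: "p \<sim> q \<Longrightarrow> q \<sim> r \<Longrightarrow> p \<sim> r"
  by (rule rtrancl_trans)

lemma eqv_rotate1:
  assumes "conf xs p1 B p2 C p3 D p4 E"
  shows "(p1, p2, p3, p4) \<sim> (p2, p3, p4, p1)"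
  using link_rotate[OF d len v N assms] by (rule r_into_rtrancl)

lemma eqv_rotate2:
  assumes "conf xs p1 B p2 C p3 D p4 E"
  shows "(p1, p2, p3, p4) \<sim> (p3, p4, p1, p2)"
  using eqv_trans[OF eqv_rotate1[OF assms] eqv_rotate1[OF conf_rotate[OF assms]]] .

lemma eqv_rotate3:
  assumes "conf xs p1 B p2 C p3 D p4 E"
  shows "(p1, p2, p3, p4) \<sim> (p4, p1, p2, p3)"
  using eqv_trans[OF eqv_rotate2[OF assms] eqv_rotate1[OF conf_rotate[OF conf_rotate[OF assms]]]] .

text \<open>Each passage over a leaf brings \<open>p1\<close> two letters closer to
  \<open>p2\<close>. The arc \<open>B\<close> loses and \<open>E\<close> gains two letters, so the
  parities persist.\<close>

lemma gather_first:
  assumes "conf xs p1 B p2 C p3 D p4 E"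
  shows "\<exists>p1' B' E'. (p1, p2, p3, p4) \<sim> (p1', p2, p3, p4) \<and> conf xs p1' B' p2 C p3 D p4 E' \<and>
     length B' \<le> 1 \<and> (even (length B') \<longleftrightarrow> even (length B)) \<and> (even (length E') \<longleftrightarrow> even (length E))"
  using assms
proof (induction "length B" arbitrary: p1 B E rule: less_induct)
  case less
  show ?case
  proof (cases "length B \<le> 1")
    case True
    then show ?thesis using less.prems by blast
  next
    case False
    then obtain x y B0 where B: "B = x # y # B0" by (cases B rule: remdups_adj.cases) auto
    have c: "conf xs p1 (x # y # B0) p2 C p3 D p4 E" using less.prems B by simp
    from less.hyps[of B0 y "E @ [p1, x]"] link_slide_leaf(1)[OF d len v N c] B
    obtain p1' B' E' where *: "(y, p2, p3, p4) \<sim> (p1', p2, p3, p4)" "conf xs p1' B' p2 C p3 D p4 E'"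
      "length B' \<le> 1" "even (length B') \<longleftrightarrow> even (length B0)" "even (length E') \<longleftrightarrow> even (length (E @ [p1, x]))"
      by auto
    have "(p1, p2, p3, p4) \<sim> (p1', p2, p3, p4)"
      using eqv_trans[OF r_into_rtrancl[OF link_slide_leaf(2)[OF d len v N c]] *(1)] .
    moreover have "even (length B') \<longleftrightarrow> even (length B)" "even (length E') \<longleftrightarrow> even (length E)"
      using * B by auto
    ultimately show ?thesis using *(2,3) by blast
  qed
qed

lemma gather_second:
  assumes c: "conf xs p1 B p2 C p3 D p4 E"
  shows "\<exists>p2' B' C'. (p1, p2, p3, p4) \<sim> (p1, p2', p3, p4) \<and> conf xs p1 B' p2' C' p3 D p4 E \<and>
     length C' \<le> 1 \<and> (even (length C') \<longleftrightarrow> even (length C)) \<and> (even (length B') \<longleftrightarrow> even (length B))"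
proof -
  from gather_first[OF conf_rotate[OF c]] obtain p2' C' B' where *:
    "(p2, p3, p4, p1) \<sim> (p2', p3, p4, p1)" "conf xs p2' C' p3 D p4 E p1 B'"
    "length C' \<le> 1" "even (length C') \<longleftrightarrow> even (length C)" "even (length B') \<longleftrightarrow> even (length B)"
    by blast
  have "(p1, p2, p3, p4) \<sim> (p1, p2', p3, p4)"
    using eqv_trans[OF eqv_trans[OF eqv_rotate1[OF c] *(1)] eqv_rotate3[OF *(2)]] .
  moreover have "conf xs p1 B' p2' C' p3 D p4 E"
    using conf_rotate[OF conf_rotate[OF conf_rotate[OF *(2)]]] .
  ultimately show ?thesis using * by blast
qed

lemma gather_third:
  assumes c: "conf xs p1 B p2 C p3 D p4 E"
  shows "\<exists>p3' C' D'. (p1, p2, p3, p4) \<sim> (p1, p2, p3', p4) \<and> conf xs p1 B p2 C' p3' D' p4 E \<and>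
     length D' \<le> 1 \<and> (even (length D') \<longleftrightarrow> even (length D)) \<and> (even (length C') \<longleftrightarrow> even (length C))"
proof -
  from gather_second[OF conf_rotate[OF c]] obtain p3' C' D' where *:
    "(p2, p3, p4, p1) \<sim> (p2, p3', p4, p1)" "conf xs p2 C' p3' D' p4 E p1 B"
    "length D' \<le> 1" "even (length D') \<longleftrightarrow> even (length D)" "even (length C') \<longleftrightarrow> even (length C)"
    by blast
  have "(p1, p2, p3, p4) \<sim> (p1, p2, p3', p4)"
    using eqv_trans[OF eqv_trans[OF eqv_rotate1[OF c] *(1)] eqv_rotate3[OF *(2)]] .
  moreover have "conf xs p1 B p2 C' p3' D' p4 E"
    using conf_rotate[OF conf_rotate[OF conf_rotate[OF *(2)]]] .
  ultimately show ?thesis using * by blast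
qed

text \<open>The order matters: moving the third letter shrinks \<open>D\<close> at the expense of
  \<open>C\<close>, and moving the second letter afterwards shrinks \<open>C\<close> into
  \<open>B\<close> and leaves \<open>D\<close> short.\<close>

lemma gather:
  assumes c: "conf xs p1 B p2 C p3 D p4 E"
  shows "\<exists>p2' p3' B' C' D'. (p1, p2, p3, p4) \<sim> (p1, p2', p3', p4) \<and> conf xs p1 B' p2' C' p3' D' p4 E \<and>
     length C' \<le> 1 \<and> length D' \<le> 1 \<and> (even (length B') \<longleftrightarrow> even (length B)) \<and>
     (even (length C') \<longleftrightarrow> even (length C)) \<and> (even (length D') \<longleftrightarrow> even (length D))"
proof -
  from gather_third[OF c] obtain p3' C1 D' where 1:
    "(p1, p2, p3, p4) \<sim> (p1, p2, p3', p4)" "conf xs p1 B p2 C1 p3' D' p4 E"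
    "length D' \<le> 1" "even (length D') \<longleftrightarrow> even (length D)" "even (length C1) \<longleftrightarrow> even (length C)" by blast
  from gather_second[OF 1(2)] obtain p2' B' C' where 2:
    "(p1, p2, p3', p4) \<sim> (p1, p2', p3', p4)" "conf xs p1 B' p2' C' p3' D' p4 E"
    "length C' \<le> 1" "even (length C') \<longleftrightarrow> even (length C1)" "even (length B') \<longleftrightarrow> even (length B)" by blast
  show ?thesis using eqv_trans[OF 1(1) 2(1)] 1 2 by metis
qed

text \<open>While \<open>p2\<close>, \<open>p3\<close>, \<open>p4\<close> are consecutive the core
  word is \<open>B E\<close>, and a move of \<open>p1\<close> by a single letter merely renames and
  rotates it. So \<open>p1\<close> can walk through all of \<open>B\<close>.\<close>

lemma slide_first:
  assumes "conf xs p1 B p2 [] p3 [] p4 E"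
  shows "\<exists>E'. (p1, p2, p3, p4) \<sim> (last (p1 # B), p2, p3, p4) \<and> conf xs (last (p1 # B)) [] p2 [] p3 [] p4 E'"
  using assms
proof (induction B arbitrary: p1 E)
  case Nil
  then show ?case by auto
next
  case (Cons w B)
  from Cons.IH[OF link_slide_free(1)[OF d len v N Cons.prems]] obtain E' where
    "(w, p2, p3, p4) \<sim> (last (w # B), p2, p3, p4)" "conf xs (last (w # B)) [] p2 [] p3 [] p4 E'" by blast
  moreover have "(p1, p2, p3, p4) \<sim> (w, p2, p3, p4)"
    using link_slide_free(2)[OF d len v N Cons.prems] by (rule r_into_rtrancl)
  moreover have "last (p1 # w # B) = last (w # B)" by simp
  ultimately show ?case using eqv_trans by metis
qed

definition hub :: "nat \<times> nat \<times> nat \<times> nat" where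
  "hub = (xs ! 0, xs ! 1, xs ! 2, xs ! 3)"

text \<open>A block of four consecutive letters moves back by one letter when its last element
  travels around the rest of the word to the place just before \<open>p1\<close>.\<close>

lemma consecutive_hub:
  assumes "rotate k xs = p1 # p2 # p3 # p4 # E"
  shows "(p1, p2, p3, p4) \<sim> hub"
  using assms
proof (induction k arbitrary: p1 p2 p3 p4 E)
  case 0
  then show ?case unfolding hub_def by (simp add: numeral_2_eq_2 numeral_3_eq_3)
next
  case (Suc k)
  have "length E + 4 = length xs" using arg_cong[OF Suc.prems, of length] by simp
  then have "E \<noteq> []" using len by auto
  then obtain E0 z where E: "E = E0 @ [z]" by (metis rev_exhaust)
  have "rotate1 (rotate k xs) = rotate1 (z # p1 # p2 # p3 # p4 # E0)" using Suc.prems E by simp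
  then have k: "rotate k xs = z # p1 # p2 # p3 # p4 # E0"
    by (rule injD[OF inj_rotate1])
  have c: "conf xs p1 [] p2 [] p3 [] p4 (E0 @ [z])" 
    unfolding conf_def by (rule exI[of _ "Suc k"]) (use Suc.prems E in simp)
  have c4: "conf xs p4 (E0 @ [z]) p1 [] p2 [] p3 []"
    using conf_rotate[OF conf_rotate[OF conf_rotate[OF c]]] .
  from slide_first[OF c4] have "(p4, p1, p2, p3) \<sim> (z, p1, p2, p3)" by auto
  moreover have "(z, p1, p2, p3) \<sim> hub" using Suc.IH[OF k] .
  ultimately show ?case using eqv_rotate3[OF c] eqv_trans by metis
qed

lemma three_consecutive_hub:
  assumes "conf xs p1 B p2 [] p3 [] p4 E"
  shows "(p1, p2, p3, p4) \<sim> hub"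
proof -
  from slide_first[OF assms] obtain E' where *:
    "(p1, p2, p3, p4) \<sim> (last (p1 # B), p2, p3, p4)" "conf xs (last (p1 # B)) [] p2 [] p3 [] p4 E'" by blast
  from *(2) obtain k where "rotate k xs = last (p1 # B) # p2 # p3 # p4 # E'" by (auto simp: conf_def)
  from eqv_trans[OF *(1) consecutive_hub[OF this]] show ?thesis .
qed

text \<open>After gathering, the arcs \<open>C\<close> and \<open>D\<close> are both empty or both
  single letters. In the second case the chord through these two letters is parallel to
  \<open>{p2, p4}\<close> and is adjacent to \<open>p3\<close> on both sides.\<close>

lemma hub_CD:
  assumes c: "conf xs p1 B p2 C p3 D p4 E" and par: "even (length C) \<longleftrightarrow> even (length D)"
  shows "(p1, p2, p3, p4) \<sim> hub"
proof -
  from gather[OF c] obtain p2' p3' B' C' D' where g: "(p1, p2, p3, p4) \<sim> (p1, p2', p3', p4)"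
     "conf xs p1 B' p2' C' p3' D' p4 E" "length C' \<le> 1" "length D' \<le> 1"
     "even (length C') \<longleftrightarrow> even (length C)" "even (length D') \<longleftrightarrow> even (length D)" by blast
  have "(p1, p2', p3', p4) \<sim> hub"
  proof (cases C')
    case Nil
    then have "D' = []" using g par by (cases D') auto
    then show ?thesis using three_consecutive_hub g(2) Nil by simp
  next
    case (Cons a C0)
    then have C': "C' = [a]" using g by simp
    then obtain b where "D' = [b]" using g par by (cases D') auto
    then have c': "conf xs p1 B' p2' (a # []) p3' ([] @ [b]) p4 E" using g(2) C' by simp
    have "(p1, a, p3', b) \<sim> hub"
      by (rule three_consecutive_hub[OF link_parallel(1)[OF d len v N c']])
    moreover have "(p1, p2', p3', p4) \<sim> (p1, a, p3', b)"
      by (rule r_into_rtrancl[OF link_parallel(2)[OF d len v N c']])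
    ultimately show ?thesis by (rule eqv_trans[rotated])
  qed
  then show ?thesis by (rule eqv_trans[OF g(1)])
qed

text \<open>The arcs have even total length, so if \<open>B\<close> and \<open>C\<close> agree in
  parity then so do \<open>D\<close> and \<open>E\<close>, which take the place of \<open>C\<close>
  and \<open>D\<close> in the rotated quadruple.\<close>

lemma hub_BC:
  assumes c: "conf xs p1 B p2 C p3 D p4 E" and par: "even (length B) \<longleftrightarrow> even (length C)"
    and ev: "even (length xs)"
  shows "(p1, p2, p3, p4) \<sim> hub"
proof -
  have "even (length B + length C + length D + length E + 4)" using conf_facts(3)[OF c d] ev by simp
  then have "even (length D) \<longleftrightarrow> even (length E)" using par by auto
  from eqv_trans[OF eqv_rotate1[OF c] hub_CD[OF conf_rotate[OF c] this]] show ?thesis .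
qed

text \<open>What remains are alternating parities, which passages over leaves cannot change. After
  gathering, one of \<open>C\<close> and \<open>D\<close> is empty and the other a single letter;
  sliding \<open>p3\<close> over this letter flips both parities and leads to
  \<open>hub_BC\<close>.\<close>

lemma conf_hub:
  assumes c: "conf xs p1 B p2 C p3 D p4 E" and ev: "even (length xs)"
  shows "(p1, p2, p3, p4) \<sim> hub"
proof (cases "(even (length C) \<longleftrightarrow> even (length D)) \<or> (even (length B) \<longleftrightarrow> even (length C))")
  case True
  then show ?thesis using hub_CD[OF c] hub_BC[OF c _ ev] by blast
next
  case False
  from gather[OF c] obtain p2' p3' B' C' D' where g: "(p1, p2, p3, p4) \<sim> (p1, p2', p3', p4)"
     "conf xs p1 B' p2' C' p3' D' p4 E" "length C' \<le> 1" "length D' \<le> 1"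
     "even (length B') \<longleftrightarrow> even (length B)"
     "even (length C') \<longleftrightarrow> even (length C)" "even (length D') \<longleftrightarrow> even (length D)" by blast
  have "(p1, p2', p3', p4) \<sim> hub"
  proof (cases C')
    case (Cons w C0)
    then have C': "C' = [w]" using g by simp
    then have "D' = []" using g False by (cases D') auto
    then have c': "conf xs p1 B' p2' [w] p3' [] p4 E" using g(2) C' by simp
    have par: "even (length B') \<longleftrightarrow> even (length [])" using False g C' by simp
    have "(p1, p2', w, p4) \<sim> hub"
      by (rule hub_BC[OF link_slide_over(1)[OF d len v N c'] par ev])
    moreover have "(p1, p2', p3', p4) \<sim> (p1, p2', w, p4)"
      by (rule r_into_rtrancl[OF link_slide_over(2)[OF d len v N c']])
    ultimately show ?thesis by (rule eqv_trans[rotated])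
  next
    case Nil
    then obtain w where D': "D' = [w]" using g False by (cases D') auto
    then have c': "conf xs p1 B' p2' [p3'] w [] p4 E" using g(2) Nil by (simp add: conf_def)
    have "even (length B') \<longleftrightarrow> even (length [p3'])" using False g Nil by simp
    from hub_BC[OF c' this ev] have "(p1, p2', w, p4) \<sim> hub" .
    moreover have "(p1, p2', w, p4) \<sim> (p1, p2', p3', p4)"
      by (rule r_into_rtrancl[OF link_slide_over(2)[OF d len v N c']])
    ultimately show ?thesis by (rule eqv_trans[OF eqv_sym, rotated])
  qed
  then show ?thesis by (rule eqv_trans[OF g(1)])
qed

lemma crossing_quads_connected:
  assumes "p \<in> crossing_quads xs" "q \<in> crossing_quads xs" "even (length xs)"
  shows "(p, q) \<in> (link xs v N)\<^sup>*"
proof -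
  have "r \<sim> hub" if "r \<in> crossing_quads xs" for r
    using that conf_hub[OF _ assms(3)] unfolding crossing_quads_def by blast
  then show ?thesis using assms eqv_sym eqv_trans by metis
qed

end

section \<open>From Lipschitz contraction to a Poincare inequality\<close>

lemma Cauchy_Schwarz_sum:
  fixes f g :: "'b \<Rightarrow> real"
  shows "(\<Sum>x\<in>S. f x * g x)\<^sup>2 \<le> (\<Sum>x\<in>S. (f x)\<^sup>2) * (\<Sum>x\<in>S. (g x)\<^sup>2)"
proof -
  have "(\<Sum>x\<in>S. \<bar>f x\<bar> * \<bar>g x\<bar>) \<le> L2_set f S * L2_set g S"
    by (rule L2_set_mult_ineq)
  moreover have "\<bar>\<Sum>x\<in>S. f x * g x\<bar> \<le> (\<Sum>x\<in>S. \<bar>f x\<bar> * \<bar>g x\<bar>)"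
    using sum_abs[of "\<lambda>x. f x * g x" S] by (simp add: abs_mult)
  ultimately have "\<bar>\<Sum>x\<in>S. f x * g x\<bar> \<le> L2_set f S * L2_set g S" by linarith
  then have "\<bar>\<Sum>x\<in>S. f x * g x\<bar>\<^sup>2 \<le> (L2_set f S * L2_set g S)\<^sup>2"
    by (intro power_mono) auto
  then show ?thesis by (simp add: L2_set_def power_mult_distrib sum_nonneg)
qed

text \<open>\<open>a k\<close> plays the role of the squared norm of the \<open>k\<close>-th iterate of a self-adjoint operator: such a sequence is
  log-convex, so its first ratio is bounded by its asymptotic growth rate.\<close>

lemma log_convex_ratio:
  fixes a :: "nat \<Rightarrow> real"
  assumes nn: "\<And>k. 0 \<le> a k" and conv: "\<And>k. (a (Suc k))\<^sup>2 \<le> a k * a (Suc (Suc k))"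
    and bnd: "\<And>k. a k \<le> B * q ^ k" and q: "q > 0"
  shows "a 1 \<le> q * a 0"
proof (rule ccontr)
  assume "\<not> a 1 \<le> q * a 0"
  then have gt: "q * a 0 < a 1" by simp
  have a1: "a 1 > 0" using gt nn[of 0] q by (meson le_less_trans mult_nonneg_nonneg less_imp_le)
  have a0: "a 0 > 0"
  proof (rule ccontr)
    assume "\<not> 0 < a 0"
    then have "a 0 = 0" using nn[of 0] by simp
    then have "(a 1)\<^sup>2 \<le> 0" using conv[of 0] by simp
    then show False using a1 by simp
  qed
  define \<rho> where "\<rho> = a 1 / a 0"
  have \<rho>: "\<rho> > q" using gt a0 by (simp add: \<rho>_def field_simps)
  then have \<rho>0: "\<rho> > 0" using q by simp
  have step: "0 < a k \<and> \<rho> * a k \<le> a (Suc k)" for k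
  proof (induction k)
    case 0
    then show ?case using a0 by (simp add: \<rho>_def)
  next
    case (Suc k)
    then have pos: "0 < a (Suc k)" using \<rho>0 by (meson less_le_trans mult_pos_pos)
    have "a k * (\<rho> * a (Suc k)) \<le> a (Suc k) * a (Suc k)"
      using mult_right_mono[of "\<rho> * a k" "a (Suc k)" "a (Suc k)"] Suc pos by (simp add: mult_ac)
    also have "\<dots> \<le> a k * a (Suc (Suc k))" using conv[of k] by (simp add: power2_eq_square)
    finally show ?case using Suc pos by (simp add: mult_le_cancel_left_pos)
  qed
  have low: "\<rho> ^ k * a 0 \<le> a k" for k
  proof (induction k)
    case (Suc k)
    have "\<rho> ^ Suc k * a 0 \<le> \<rho> * a k" using Suc \<rho>0 by simp
    then show ?case using step[of k] by linarith
  qed simp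
  have "(\<rho> / q) ^ k \<le> B / a 0" for k
  proof -
    have "\<rho> ^ k * a 0 \<le> B * q ^ k" using low[of k] bnd[of k] by linarith
    then show ?thesis using a0 q by (simp add: field_simps power_divide)
  qed
  moreover obtain k where "B / a 0 < (\<rho> / q) ^ k"
    using real_arch_pow[of "\<rho> / q" "B / a 0"] \<rho> q by auto
  ultimately show False by (meson not_le)
qed

text \<open>The notion of Lipschitz constant stays abstract: it must exist, control oscillations and
  contract. The constant \<open>C\<close> enters only as a prefactor of the decay of the iterates,
  which log-convexity discards, so it may be arbitrarily large.\<close>

locale flip_chain =
  fixes H :: "'b set" and I :: "nat set" and phi :: "nat \<Rightarrow> 'b \<Rightarrow> 'b"
    and lip :: "real \<Rightarrow> ('b \<Rightarrow> real) \<Rightarrow> bool" and \<theta> C :: real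
  assumes finH: "finite H" and neH: "H \<noteq> {}" and finI: "finite I" and neI: "I \<noteq> {}"
    and phi: "\<And>i h. i \<in> I \<Longrightarrow> h \<in> H \<Longrightarrow> phi i h \<in> H \<and> phi i (phi i h) = h"
    and lip_ex: "\<And>f. \<exists>L\<ge>0. lip L f"
    and lip_osc: "\<And>L f x y. L \<ge> 0 \<Longrightarrow> lip L f \<Longrightarrow> x \<in> H \<Longrightarrow> y \<in> H \<Longrightarrow> \<bar>f x - f y\<bar> \<le> C * L"
    and lip_contr: "\<And>L f. L \<ge> 0 \<Longrightarrow> lip L f \<Longrightarrow> lip (\<theta> * L) (\<lambda>h. (\<Sum>i\<in>I. (f h + f (phi i h)) / 2) / real (card I))"
    and theta: "0 < \<theta>" "\<theta> < 1"
begin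

definition P :: "('b \<Rightarrow> real) \<Rightarrow> 'b \<Rightarrow> real" where
  "P f h = (\<Sum>i\<in>I. (f h + f (phi i h)) / 2) / real (card I)"

lemma sum_phi: "i \<in> I \<Longrightarrow> (\<Sum>h\<in>H. g (phi i h)) = (\<Sum>h\<in>H. g h)"
  by (rule sum.reindex_bij_witness[of _ "phi i" "phi i"]) (use phi in auto)

lemma cardI: "real (card I) > 0"
  using finI neI by (simp add: card_gt_0_iff)

text \<open>Each \<open>phi i\<close> is an involution of \<open>H\<close>, so composition with it
  is a symmetric operator.\<close>

lemma P_selfadj: "(\<Sum>h\<in>H. f h * P g h) = (\<Sum>h\<in>H. P f h * g h)"
proof -
  have "(\<Sum>h\<in>H. f h * P g h) = (\<Sum>h\<in>H. \<Sum>i\<in>I. (f h * g h + f h * g (phi i h)) / 2 / real (card I))"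
    unfolding P_def sum_divide_distrib sum_distrib_left by (intro sum.cong refl) (simp add: field_simps)
  also have "\<dots> = (\<Sum>i\<in>I. \<Sum>h\<in>H. (f h * g h + f h * g (phi i h)) / 2 / real (card I))"
    by (rule sum.swap)
  also have "\<dots> = (\<Sum>i\<in>I. \<Sum>h\<in>H. (f h * g h + f (phi i h) * g h) / 2 / real (card I))"
  proof (rule sum.cong[OF refl])
    fix i assume i: "i \<in> I"
    have "(\<Sum>h\<in>H. f h * g (phi i h)) = (\<Sum>h\<in>H. f (phi i (phi i h)) * g (phi i h))"
      using phi i by (intro sum.cong) auto
    also have "\<dots> = (\<Sum>h\<in>H. f (phi i h) * g h)" by (rule sum_phi[OF i, of "\<lambda>h. f (phi i h) * g h"])
    finally show "(\<Sum>h\<in>H. (f h * g h + f h * g (phi i h)) / 2 / real (card I)) =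
        (\<Sum>h\<in>H. (f h * g h + f (phi i h) * g h) / 2 / real (card I))"
      by (simp add: sum_divide_distrib[symmetric] sum.distrib)
  qed
  also have "\<dots> = (\<Sum>h\<in>H. \<Sum>i\<in>I. (f h * g h + f (phi i h) * g h) / 2 / real (card I))"
    by (rule sum.swap)
  also have "\<dots> = (\<Sum>h\<in>H. P f h * g h)"
    unfolding P_def sum_divide_distrib sum_distrib_right by (intro sum.cong refl) (simp add: field_simps)
  finally show ?thesis .
qed

lemma P_sum: "(\<Sum>h\<in>H. P f h) = (\<Sum>h\<in>H. f h)"
proof -
  have "P (\<lambda>_. 1) h = 1" for h using cardI by (simp add: P_def)
  then show ?thesis using P_selfadj[of "\<lambda>_. 1" f] by simp
qed

text \<open>Lipschitz contraction gives decay of the iterates like \<open>\<theta> ^ k\<close>, with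
  an uncontrolled prefactor. By self-adjointness the squared norm of an iterate is the inner product
  of its two neighbours, so Cauchy-Schwarz makes the norms log-convex and the rate holds already at
  the first step.\<close>

lemma P_norm_contr:
  assumes z: "(\<Sum>h\<in>H. f h) = 0"
  shows "(\<Sum>h\<in>H. (P f h)\<^sup>2) \<le> \<theta>\<^sup>2 * (\<Sum>h\<in>H. (f h)\<^sup>2)"
proof -
  obtain L where L: "L \<ge> 0" "lip L f" using lip_ex by blast
  define a where "a k = (\<Sum>h\<in>H. ((P ^^ k) f h)\<^sup>2)" for k
  have sum0: "(\<Sum>h\<in>H. (P ^^ k) f h) = 0" for k
    by (induction k) (simp_all add: z P_sum)
  have lipk: "lip (\<theta> ^ k * L) ((P ^^ k) f)" for k
  proof (induction k)
    case (Suc k)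
    have "0 \<le> \<theta> ^ k * L" using theta L by simp
    from lip_contr[OF this Suc] show ?case by (simp add: P_def[abs_def] mult.assoc)
  qed (simp add: L)
  have pt: "\<bar>(P ^^ k) f h\<bar> \<le> C * (\<theta> ^ k * L)" if h: "h \<in> H" for k h
  proof -
    let ?g = "(P ^^ k) f"
    \<comment> \<open>For a function with sum zero, a value is the average of its differences to all
      other values.\<close>
    have "real (card H) * ?g h = (\<Sum>y\<in>H. ?g h - ?g y)" using sum0[of k] by (simp add: sum_subtractf)
    then have "real (card H) * \<bar>?g h\<bar> = \<bar>\<Sum>y\<in>H. ?g h - ?g y\<bar>" by (metis abs_mult abs_of_nat)
    also have "\<dots> \<le> (\<Sum>y\<in>H. \<bar>?g h - ?g y\<bar>)" by (rule sum_abs)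
    also have "\<dots> \<le> (\<Sum>y\<in>H. C * (\<theta> ^ k * L))"
      using theta L by (intro sum_mono lip_osc[OF _ lipk h]) auto
    also have "\<dots> = real (card H) * (C * (\<theta> ^ k * L))" by simp
    finally show ?thesis using finH neH by (simp add: mult_le_cancel_left_pos card_gt_0_iff)
  qed
  have "a 1 \<le> \<theta>\<^sup>2 * a 0"
  proof (rule log_convex_ratio[where B = "real (card H) * (C * L)\<^sup>2"])
    show "0 \<le> a k" for k by (simp add: a_def sum_nonneg)
    show "0 < \<theta>\<^sup>2" using theta by simp
    show "(a (Suc k))\<^sup>2 \<le> a k * a (Suc (Suc k))" for k
    proof -
      have "a (Suc k) = (\<Sum>h\<in>H. P ((P ^^ k) f) h * P ((P ^^ k) f) h)"
        by (simp add: a_def power2_eq_square)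
      also have "\<dots> = (\<Sum>h\<in>H. (P ^^ k) f h * P (P ((P ^^ k) f)) h)" by (rule P_selfadj[symmetric])
      finally show ?thesis
        using Cauchy_Schwarz_sum[of "(P ^^ k) f" "P (P ((P ^^ k) f))" H] by (simp add: a_def)
    qed
    show "a k \<le> real (card H) * (C * L)\<^sup>2 * (\<theta>\<^sup>2) ^ k" for k
    proof -
      have "a k \<le> (\<Sum>h\<in>H. (C * (\<theta> ^ k * L))\<^sup>2)"
        unfolding a_def
      proof (rule sum_mono)
        fix h assume "h \<in> H"
        from power_mono[OF pt[OF this, of k], of 2] show "((P ^^ k) f h)\<^sup>2 \<le> (C * (\<theta> ^ k * L))\<^sup>2" by simp
      qed
      also have "\<dots> = real (card H) * (C * L)\<^sup>2 * (\<theta>\<^sup>2) ^ k"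
        by (simp add: power_mult_distrib power_mult[symmetric] mult_ac)
      finally show ?thesis .
    qed
  qed
  then show ?thesis by (simp add: a_def)
qed

text \<open>In the denominator, one factor 2 comes from the laziness of \<open>P\<close> and the
  other from expanding the square, where \<open>f h\<close> and \<open>f (phi i h)\<close>
  contribute equally.\<close>

lemma energy:
  "(\<Sum>h\<in>H. (f h)\<^sup>2) - (\<Sum>h\<in>H. f h * P f h) = (\<Sum>i\<in>I. \<Sum>h\<in>H. (f h - f (phi i h))\<^sup>2) / (4 * real (card I))"
proof -
  have sq: "(\<Sum>h\<in>H. (f h - f (phi i h))\<^sup>2) = 2 * (\<Sum>h\<in>H. (f h)\<^sup>2) - 2 * (\<Sum>h\<in>H. f h * f (phi i h))"
    if "i \<in> I" for i
    using sum_phi[OF that, of "\<lambda>h. (f h)\<^sup>2"]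
    by (simp add: power2_diff sum.distrib sum_subtractf sum_distrib_left mult.assoc)
  have "(\<Sum>h\<in>H. f h * P f h) = (\<Sum>h\<in>H. \<Sum>i\<in>I. ((f h)\<^sup>2 + f h * f (phi i h)) / 2 / real (card I))"
    unfolding P_def sum_divide_distrib sum_distrib_left
    by (intro sum.cong refl) (simp add: field_simps power2_eq_square)
  also have "\<dots> = (\<Sum>i\<in>I. \<Sum>h\<in>H. ((f h)\<^sup>2 + f h * f (phi i h)) / 2 / real (card I))"
    by (rule sum.swap)
  also have "\<dots> = (\<Sum>i\<in>I. ((\<Sum>h\<in>H. (f h)\<^sup>2) + (\<Sum>h\<in>H. f h * f (phi i h))) / 2 / real (card I))"
    by (simp add: sum_divide_distrib[symmetric] sum.distrib)
  finally have "(\<Sum>h\<in>H. (f h)\<^sup>2) - (\<Sum>h\<in>H. f h * P f h)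
     = (\<Sum>i\<in>I. (\<Sum>h\<in>H. (f h)\<^sup>2) / real (card I)) - (\<Sum>i\<in>I. ((\<Sum>h\<in>H. (f h)\<^sup>2) + (\<Sum>h\<in>H. f h * f (phi i h))) / 2 / real (card I))"
    using cardI by simp
  also have "\<dots> = (\<Sum>i\<in>I. (\<Sum>h\<in>H. (f h - f (phi i h))\<^sup>2) / (4 * real (card I)))"
    unfolding sum_subtractf[symmetric] using cardI by (intro sum.cong refl) (simp add: sq field_simps)
  finally show ?thesis by (simp add: sum_divide_distrib)
qed

text \<open>For the centred function, Cauchy-Schwarz turns the norm contraction of \<open>P\<close>
  into a bound on its quadratic form, which is the edge energy up to a factor.\<close>

lemma poincare:
  "pair_energy H H F \<le> real (card H) / (1 - \<theta>) * ((\<Sum>i\<in>I. \<Sum>h\<in>H. (F h - F (phi i h))\<^sup>2) / (2 * real (card I)))"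
proof -
  define c where "c = (\<Sum>h\<in>H. F h) / real (card H)"
  define f where "f h = F h - c" for h
  have cH: "real (card H) > 0" using finH neH by (simp add: card_gt_0_iff)
  have z: "(\<Sum>h\<in>H. f h) = 0" using cH by (simp add: f_def sum_subtractf c_def)
  let ?n = "\<Sum>h\<in>H. (f h)\<^sup>2" and ?E = "\<Sum>i\<in>I. \<Sum>h\<in>H. (F h - F (phi i h))\<^sup>2"
  have "pair_energy H H F = (\<Sum>s\<in>H. \<Sum>t\<in>H. (f s)\<^sup>2 + (f t)\<^sup>2 - 2 * f s * f t)"
    unfolding pair_energy_def f_def by (intro sum.cong refl) (simp add: power2_eq_square algebra_simps)
  also have "\<dots> = 2 * real (card H) * ?n - 2 * ((\<Sum>s\<in>H. f s) * (\<Sum>t\<in>H. f t))"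
    by (simp add: sum.distrib sum_subtractf sum_distrib_left sum_distrib_right mult_ac)
  finally have t: "pair_energy H H F = 2 * real (card H) * ?n" using z by simp
  have "(\<Sum>h\<in>H. f h * P f h)\<^sup>2 \<le> ?n * (\<Sum>h\<in>H. (P f h)\<^sup>2)" by (rule Cauchy_Schwarz_sum)
  also have "\<dots> \<le> ?n * (\<theta>\<^sup>2 * ?n)" using P_norm_contr[OF z] by (intro mult_left_mono) (auto simp: sum_nonneg)
  also have "\<dots> = (\<theta> * ?n)\<^sup>2" by (simp add: power2_eq_square)
  finally have sq: "(\<Sum>h\<in>H. f h * P f h)\<^sup>2 \<le> (\<theta> * ?n)\<^sup>2" .
  have "0 \<le> \<theta> * ?n" using theta by (simp add: sum_nonneg)
  with sq have "(\<Sum>h\<in>H. f h * P f h) \<le> \<theta> * ?n" by (rule power2_le_imp_le)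
  moreover have "f x - f y = F x - F y" for x y by (simp add: f_def)
  then have "?n - (\<Sum>h\<in>H. f h * P f h) = ?E / (4 * real (card I))"
    using energy[of f] by presburger
  moreover have "?n * (1 - \<theta>) = ?n - \<theta> * ?n" by (simp add: algebra_simps)
  ultimately have "?n * (1 - \<theta>) \<le> ?E / (4 * real (card I))" by linarith
  then have "?n \<le> ?E / (4 * real (card I)) / (1 - \<theta>)"
    by (rule mult_imp_le_div_pos[rotated]) (use theta in simp)
  then have "2 * real (card H) * ?n \<le> 2 * real (card H) * (?E / (4 * real (card I)) / (1 - \<theta>))"
    by (intro mult_left_mono) auto
  also have "\<dots> = real (card H) / (1 - \<theta>) * (?E / (2 * real (card I)))" by (simp add: mult_ac)
  finally show ?thesis by (simp only: t)
qed

end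

section \<open>Height functions\<close>

text \<open>Dyck paths of length \<open>2 n\<close>, extended by zero so that equal paths are equal
  functions.\<close>

definition heights :: "nat \<Rightarrow> (nat \<Rightarrow> int) set" where
  "heights n = {h. h 0 = 0 \<and> (\<forall>i\<ge>2 * n. h i = 0) \<and> (\<forall>i. 0 \<le> h i) \<and> (\<forall>i<2 * n. \<bar>h (Suc i) - h i\<bar> = 1)}"

text \<open>A corner is reflected at the common height of its neighbours. At height 0 this is
  blocked, since the reflected path would become negative.\<close>

definition flip :: "nat \<Rightarrow> (nat \<Rightarrow> int) \<Rightarrow> nat \<Rightarrow> int" where
  "flip i h = (if h (i - 1) = h (Suc i) \<and> h (i - 1) \<noteq> 0 then h(i := 2 * h (i - 1) - h i) else h)"

text \<open>Heat-bath form of the flip: the coin \<open>e\<close> prescribes peak or valley,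
  independently of the present state, except that the floor forces a peak. This allows two paths to
  be driven by the same coin.\<close>

definition upd :: "nat \<Rightarrow> bool \<Rightarrow> (nat \<Rightarrow> int) \<Rightarrow> nat \<Rightarrow> int" where
  "upd i e h = (if h (i - 1) = h (Suc i) then h(i := if e \<or> h (i - 1) = 0 then h (i - 1) + 1 else h (i - 1) - 1) else h)"

definition zig :: "nat \<Rightarrow> nat \<Rightarrow> int" where
  "zig n i = (if odd i \<and> i < 2 * n then 1 else 0)"

lemma zig_hts: "zig n \<in> heights n"
proof -
  have "\<bar>zig n (Suc i) - zig n i\<bar> = 1" if "i < 2 * n" for i
  proof (cases "odd i")
    case False
    then have "Suc i \<noteq> 2 * n" by presburger
    then show ?thesis using that False by (simp add: zig_def)
  qed (use that in \<open>simp add: zig_def\<close>)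
  then show ?thesis by (auto simp: heights_def) (auto simp: zig_def)
qed

section \<open>Local moves of a Dyck path\<close>

context
  fixes n :: nat
begin

lemma heights_nonneg: "h \<in> heights n \<Longrightarrow> 0 \<le> h i"
  by (simp add: heights_def)

lemma heights_step: "h \<in> heights n \<Longrightarrow> i < 2 * n \<Longrightarrow> h (Suc i) = h i + 1 \<or> h (Suc i) = h i - 1"
  unfolding heights_def by (auto simp: abs_if split: if_splits)

lemma heights_pred: "h \<in> heights n \<Longrightarrow> i \<in> {1..<2 * n} \<Longrightarrow> h i = h (i - 1) + 1 \<or> h i = h (i - 1) - 1"
  using heights_step[of h "i - 1"] by auto

lemma heights_upd_at:
  assumes h: "h \<in> heights n" and i: "i \<in> {1..<2 * n}" and x: "\<bar>x - h (i - 1)\<bar> = 1" "\<bar>h (Suc i) - x\<bar> = 1" "0 \<le> x"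
  shows "h(i := x) \<in> heights n"
proof -
  have "\<bar>(h(i := x)) (Suc j) - (h(i := x)) j\<bar> = 1" if "j < 2 * n" for j
  proof -
    consider "j = i" | "Suc j = i" | "j \<noteq> i" "Suc j \<noteq> i" by blast
    then show ?thesis
    proof cases
      case 2
      then have "i - 1 = j" by simp
      then show ?thesis using x 2 by simp
    qed (use x h that in \<open>auto simp: heights_def\<close>)
  qed
  then show ?thesis using h i x(3) by (auto simp: heights_def)
qed

lemma finite_hts: "finite (heights n)"
proof (rule finite_subset)
  show "finite {h. \<forall>i. (i \<in> {..<2 * n} \<longrightarrow> h i \<in> {0..int (2 * n)}) \<and> (i \<notin> {..<2 * n} \<longrightarrow> h i = (0 :: int))}"
    by (rule finite_set_of_finite_funs) auto
  have le: "h i \<le> int i" if h: "h \<in> heights n" and "i \<le> 2 * n" for h i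
    using that(2)
  proof (induction i)
    case 0
    then show ?case using h by (simp add: heights_def)
  next
    case (Suc i)
    then show ?case using heights_step[OF h, of i] by auto
  qed
  show "heights n \<subseteq> {h. \<forall>i. (i \<in> {..<2 * n} \<longrightarrow> h i \<in> {0..int (2 * n)}) \<and> (i \<notin> {..<2 * n} \<longrightarrow> h i = (0 :: int))}"
  proof
    fix h assume h: "h \<in> heights n"
    have "h i \<in> {0..int (2 * n)}" if "i < 2 * n" for i
      using le[OF h, of i] heights_nonneg[OF h, of i] that by simp
    moreover have "h i = 0" if "\<not> i < 2 * n" for i using h that by (simp add: heights_def)
    ultimately show "h \<in> {h. \<forall>i. (i \<in> {..<2 * n} \<longrightarrow> h i \<in> {0..int (2 * n)}) \<and> (i \<notin> {..<2 * n} \<longrightarrow> h i = (0 :: int))}"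
      by simp
  qed
qed

lemma peak_cases:
  assumes h: "h \<in> heights n" and i: "i \<in> {1..<2 * n}" and e: "h (i - 1) = h (Suc i)"
  shows "(h i = h (i - 1) + 1) \<or> (h i = h (i - 1) - 1 \<and> h (i - 1) \<ge> 1)"
  using heights_pred[OF h i] heights_nonneg[OF h, of i] by auto

lemma upd_mem:
  assumes h: "h \<in> heights n" and i: "i \<in> {1..<2 * n}"
  shows "upd i e h \<in> heights n"
  using heights_nonneg[OF h, of "i - 1"] h by (auto simp: upd_def intro!: heights_upd_at[OF h i])

lemma flip_mem:
  assumes h: "h \<in> heights n" and i: "i \<in> {1..<2 * n}"
  shows "flip i h \<in> heights n"
  using heights_nonneg[OF h, of "i - 1"] h peak_cases[OF h i]
  by (auto simp: flip_def intro!: heights_upd_at[OF h i])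

lemma flip_flip:
  assumes "i \<in> {1..<2 * n}"
  shows "flip i (flip i h) = h"
  using assms by (auto simp: flip_def)

text \<open>At a corner one coin value keeps the path and the other flips it, or both keep it if the
  flip is blocked. Averaging over the coin is therefore the lazy flip.\<close>

lemma upd_flip_sum:
  assumes h: "h \<in> heights n" and i: "i \<in> {1..<2 * n}"
  shows "f (upd i True h) + f (upd i False h) = f h + (f (flip i h) :: real)"
proof (cases "h (i - 1) = h (Suc i)")
  case True
  have t: "h(i := h i) = h" by simp
  show ?thesis
  proof (cases "h i = h (i - 1) + 1")
    case c: True
    then have hh: "h(i := h (i - 1) + 1) = h" using t by simp
    have e: "2 * h (i - 1) - h i = h (i - 1) - 1" using c by simp
    show ?thesis unfolding upd_def flip_def e using True hh by auto
  next
    case False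
    then have c: "h i = h (i - 1) - 1" "h (i - 1) \<ge> 1" using peak_cases[OF h i True] by auto
    then have hh: "h(i := h (i - 1) - 1) = h" using t by simp
    have e: "2 * h (i - 1) - h i = h (i - 1) + 1" using c by simp
    show ?thesis unfolding upd_def flip_def e using True hh c by auto
  qed
qed (simp add: upd_def flip_def)

text \<open>The function that vanishes at both ends and has constant second difference
  \<open>- 2\<close>; this strict concavity is the source of the contraction.\<close>

definition weight :: "nat \<Rightarrow> real" where
  "weight i = real i * (real (2 * n) - real i)"

text \<open>Stated from valley to peak, because raising a valley always yields a path again whereas
  lowering a peak may hit the floor.\<close>

definition flip_lipschitz :: "real \<Rightarrow> ((nat \<Rightarrow> int) \<Rightarrow> real) \<Rightarrow> bool" where
  "flip_lipschitz L f \<longleftrightarrow> (\<forall>i\<in>{1..<2 * n}. \<forall>h\<in>heights n. h (i - 1) = h (Suc i) \<and> h i = h (i - 1) - 1 \<longrightarrow>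
      \<bar>f h - f (h(i := h i + 2))\<bar> \<le> L * weight i)"

lemma flip_lipschitzD:
  assumes "flip_lipschitz L f" "i \<in> {1..<2 * n}" "h \<in> heights n" "h (i - 1) = h (Suc i)" "h i = h (i - 1) - 1"
  shows "\<bar>f h - f (h(i := h i + 2))\<bar> \<le> L * weight i"
  using assms unfolding flip_lipschitz_def by blast

lemma weight_bounds:
  assumes "i \<in> {1..<2 * n}"
  shows "1 \<le> weight i" "weight i \<le> real n ^ 2"
proof -
  have "1 * 1 \<le> real i * (real (2 * n) - real i)"
    using assms by (intro mult_mono) auto
  then show "1 \<le> weight i" by (simp add: weight_def)
  have "0 \<le> (real n - real i)\<^sup>2" by simp
  then show "weight i \<le> real n ^ 2" by (simp add: weight_def power2_eq_square algebra_simps)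
qed

section \<open>Coupled updates of two paths that differ in one corner\<close>

lemma upd_far:
  assumes "i \<in> {1..<2 * n}" "j \<in> {1..<2 * n}" "j \<noteq> i" "Suc j \<noteq> i" "j \<noteq> Suc i"
  shows "upd j e (h(i := h i + 2)) = (upd j e h)(i := upd j e h i + 2)"
proof -
  have "j - 1 \<noteq> i" using assms by auto
  then show ?thesis using assms by (auto simp: upd_def fun_upd_twist)
qed

text \<open>An update away from \<open>i\<close> and its neighbours preserves the corner at
  \<open>i\<close>, so the two paths still differ by one flip there.\<close>

lemma upd_far_contr:
  assumes f: "flip_lipschitz L f" and h: "h \<in> heights n" and i: "i \<in> {1..<2 * n}" "j \<in> {1..<2 * n}" "j \<noteq> i" "Suc j \<noteq> i" "j \<noteq> Suc i"
    and v: "h (i - 1) = h (Suc i)" "h i = h (i - 1) - 1"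
  shows "\<bar>f (upd j e h) - f (upd j e (h(i := h i + 2)))\<bar> \<le> L * weight i"
proof -
  have "j \<noteq> i - 1" using i by auto
  then have "upd j e h (i - 1) = h (i - 1)" "upd j e h (Suc i) = h (Suc i)" "upd j e h i = h i"
    using i by (auto simp: upd_def)
  then show ?thesis
    unfolding upd_far[OF i] using v by (intro flip_lipschitzD[OF f i(1) upd_mem[OF h i(2)]]) auto
qed

lemma half_sum_diff:
  fixes x y z p q :: real
  shows "\<bar>x - y\<bar> \<le> p \<Longrightarrow> \<bar>y - z\<bar> \<le> q \<Longrightarrow> \<bar>(x + x) / 2 - (z + y) / 2\<bar> \<le> p + q / 2"
    and "\<bar>x - y\<bar> \<le> p \<Longrightarrow> \<bar>z - x\<bar> \<le> q \<Longrightarrow> \<bar>(x + z) / 2 - (y + y) / 2\<bar> \<le> p + q / 2"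
  by (auto simp: abs_le_iff field_simps)

text \<open>A neighbouring update either keeps the pair or, with one of the two coin values, moves one of the two functions
  by a single further flip at \<open>j\<close>.\<close>

lemma upd_near_contr:
  assumes f: "flip_lipschitz L f" and h: "h \<in> heights n" and L: "L \<ge> 0"
    and i: "i \<in> {1..<2 * n}" and j: "j \<in> {1..<2 * n}" "j = Suc i \<or> Suc j = i"
    and v: "h (i - 1) = h (Suc i)" "h i = h (i - 1) - 1"
  defines "h' \<equiv> h(i := h i + 2)"
  shows "\<bar>(f (upd j True h) + f (upd j False h)) / 2 - (f (upd j True h') + f (upd j False h')) / 2\<bar> \<le> L * weight i + L * weight j / 2"
proof -
  define m where "m = h (i - 1)"
  \<comment> \<open>The neighbour of \<open>j\<close> on the side away from \<open>i\<close>; it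
    treats the positions left and right of \<open>i\<close> together.\<close>
  define k where "k = (if j = Suc i then Suc j else j - 1)"
  have hj: "h j = m" using j v i by (auto simp: m_def)
  have hi: "h i = m - 1" using v by (simp add: m_def)
  have m1: "m \<ge> 1" using hi heights_nonneg[OF h, of i] by simp
  have ki: "k \<noteq> i" "j \<noteq> i" "k \<noteq> j" using i j by (auto simp: k_def)
  have nb: "(g (j - 1) = g (Suc j) \<longleftrightarrow> g i = g k) \<and> (g i = g k \<longrightarrow> g (j - 1) = g i \<and> g (Suc j) = g i)" for g :: "nat \<Rightarrow> int"
    using j i by (auto simp: k_def)
  have updk: "upd j e g = (if g i = g k then g(j := if e \<or> g i = 0 then g i + 1 else g i - 1) else g)" for e g
    using nb[of g] by (auto simp: upd_def)
  have hk: "h k = m + 1 \<or> h k = m - 1"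
  proof (cases "j = Suc i")
    case True
    then show ?thesis using heights_step[OF h, of j] j hj by (auto simp: k_def)
  next
    case False
    then show ?thesis using heights_pred[OF h j(1)] hj by (auto simp: k_def)
  qed
  have h': "h' \<in> heights n" unfolding h'_def
    using hi m1 v by (intro heights_upd_at[OF h i]) (auto simp: m_def)
  have h'v: "h' i = m + 1" "h' k = h k" "h' j = m" using ki hi hj by (auto simp: h'_def)
  have base: "\<bar>f h - f h'\<bar> \<le> L * weight i" unfolding h'_def by (rule flip_lipschitzD[OF f i h v])
  have wj: "0 \<le> L * weight j" using L weight_bounds(1)[OF j(1)] by simp
  from hk show ?thesis
  proof
    assume k: "h k = m + 1"
    have "upd j e h = h" for e using updk[of e h] hi k by simp
    moreover have "upd j True h' = h'(j := h' j + 2)" using updk[of True h'] h'v k by (simp add: algebra_simps)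
    moreover have "upd j False h' = h'"
    proof -
      have "h'(j := h' j) = h'" by simp
      then show ?thesis using updk[of False h'] h'v k m1 by simp
    qed
    moreover have "\<bar>f h' - f (h'(j := h' j + 2))\<bar> \<le> L * weight j"
      using nb[of h'] h'v k by (intro flip_lipschitzD[OF f j(1) h']) auto
    ultimately show ?thesis using half_sum_diff(1)[OF base] by simp
  next
    assume k: "h k = m - 1"
    have u': "upd j e h' = h'" for e using updk[of e h'] h'v k by simp
    have "h(j := h j) = h" by simp
    then have uT: "upd j True h = h" using updk[of True h] hi hj k by simp
    show ?thesis
    \<comment> \<open>For \<open>m = 1\<close> both neighbours of \<open>j\<close> lie at height 0
      in \<open>h\<close>, the floor forces the peak for either coin value, and \<open>h\<close>
      does not move.\<close>
    proof (cases "m = 1")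
      case True
      have "h(j := h j) = h" by simp
      then have "upd j False h = h" using updk[of False h] hi hj k True by simp
      moreover have "\<bar>f h - f h'\<bar> \<le> L * weight i + L * weight j / 2" using base wj by linarith
      ultimately show ?thesis using uT u' by simp
    next
      case False
      have uF: "upd j False h = h(j := m - 2)" using updk[of False h] hi hj k False m1 by simp
      define g where "g = h(j := m - 2)"
      have g: "g \<in> heights n" using upd_mem[OF h j(1), of False] uF by (simp add: g_def)
      have gv: "g i = m - 1" "g k = m - 1" "g j = m - 2" using ki hi k by (auto simp: g_def)
      have "\<bar>f g - f (g(j := g j + 2))\<bar> \<le> L * weight j"
        using nb[of g] gv by (intro flip_lipschitzD[OF f j(1) g]) auto
      moreover have "g(j := g j + 2) = h" using hj by (auto simp: g_def)
      ultimately have "\<bar>f g - f h\<bar> \<le> L * weight j" by simp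
      then show ?thesis using half_sum_diff(2)[OF base] uT uF u' by (simp add: g_def)
    qed
  qed
qed

text \<open>Path coupling with a common coin. The update at \<open>i\<close> makes the two paths
  equal and saves \<open>L * weight i\<close>, while each neighbouring update costs at most half the
  weight of its position. By the second difference of the weight the balance is a gain of exactly
  \<open>L\<close>.\<close>

lemma flip_lipschitz_contr:
  assumes n: "n \<ge> 1" and L: "L \<ge> 0" and f: "flip_lipschitz L f"
  defines "M \<equiv> real (card {1..<2 * n})"
  shows "flip_lipschitz ((1 - 1 / (2 * M * real n ^ 2)) * L) (\<lambda>h. (\<Sum>i\<in>{1..<2 * n}. (f h + f (flip i h)) / 2) / M)"
  unfolding flip_lipschitz_def
proof (intro ballI impI)
  fix i h assume i: "i \<in> {1..<2 * n}" and h: "h \<in> heights n" and "h (i - 1) = h (Suc i) \<and> h i = h (i - 1) - 1"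
  then have v: "h (i - 1) = h (Suc i)" "h i = h (i - 1) - 1" by auto
  let ?I = "{1..<2 * n}" and ?h = "h(i := h i + 2)"
  have h': "?h \<in> heights n"
    using v heights_nonneg[OF h, of i] by (intro heights_upd_at[OF h i]) auto
  have M: "M = 2 * real n - 1" "M > 0" using n by (auto simp: M_def of_nat_diff)
  have wi: "0 \<le> L * weight i" using L weight_bounds(1)[OF i] by simp
  define q where "q j h = (f (upd j True h) + f (upd j False h)) / 2" for j h
  have Q: "(f g + f (flip j g)) / 2 = q j g" if "g \<in> heights n" "j \<in> ?I" for g j
    using upd_flip_sum[OF that, of f] by (simp add: q_def)
  have upd_i: "upd i e ?h = upd i e h" for e using i v by (auto simp: upd_def)
  have q_bound: "\<bar>q j h - q j ?h\<bar> \<le> (if j = i then 0 else L * weight i) +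
      ((if j = Suc i then L * weight j / 2 else 0) + (if j = i - 1 then L * weight j / 2 else 0))" if j: "j \<in> ?I" for j
  proof -
    consider "j = i" | "j \<noteq> i" "j = Suc i \<or> Suc j = i" | "j \<noteq> i" "Suc j \<noteq> i" "j \<noteq> Suc i" by blast
    then show ?thesis
    proof cases
      case 1
      then show ?thesis using upd_i i by (auto simp: q_def)
    next
      case 2
      have "\<bar>q j h - q j ?h\<bar> \<le> L * weight i + L * weight j / 2"
        unfolding q_def by (rule upd_near_contr[OF f h L i j 2(2) v])
      then show ?thesis using 2 i by auto
    next
      case 3
      have "\<bar>f (upd j e h) - f (upd j e ?h)\<bar> \<le> L * weight i" for e
        by (rule upd_far_contr[OF f h i j 3 v])
      from this[of True] this[of False] have "\<bar>q j h - q j ?h\<bar> \<le> L * weight i"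
        by (auto simp: q_def abs_le_iff field_simps)
      then show ?thesis using 3 by auto
    qed
  qed
  have "\<bar>\<Sum>j\<in>?I. q j h - q j ?h\<bar> \<le> (\<Sum>j\<in>?I. \<bar>q j h - q j ?h\<bar>)" by (rule sum_abs)
  also have "\<dots> \<le> (\<Sum>j\<in>?I. (if j = i then 0 else L * weight i) +
      ((if j = Suc i then L * weight j / 2 else 0) + (if j = i - 1 then L * weight j / 2 else 0)))"
    by (intro sum_mono q_bound)
  also have "\<dots> = (\<Sum>j\<in>?I. if j = i then 0 else L * weight i) +
     ((\<Sum>j\<in>?I. if j = Suc i then L * weight j / 2 else 0) + (\<Sum>j\<in>?I. if j = i - 1 then L * weight j / 2 else 0))"
    by (simp only: sum.distrib)
  also have "(\<Sum>j\<in>?I. if j = i then 0 else L * weight i) = (\<Sum>j\<in>?I - {i}. L * weight i)"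
    by (intro sum.mono_neutral_cong_right) auto
  also have "\<dots> = (M - 1) * (L * weight i)"
    using i by (simp add: M_def card_Diff_singleton of_nat_diff)
  \<comment> \<open>At the right end \<open>Suc i = 2 n\<close> is not a position in
    \<open>?I\<close>, but there the weight is zero; position 0 is treated likewise below.\<close>
  also have "(\<Sum>j\<in>?I. if j = Suc i then L * weight j / 2 else 0) = L * weight (Suc i) / 2"
  proof (cases "Suc i \<in> ?I")
    case False
    then have "Suc i = 2 * n" using i by auto
    then have "weight (Suc i) = 0" by (simp add: weight_def)
    then show ?thesis using False by (auto intro!: sum.neutral)
  qed simp
  also have "(\<Sum>j\<in>?I. if j = i - 1 then L * weight j / 2 else 0) = L * weight (i - 1) / 2"
  proof (cases "i - 1 \<in> ?I")
    case False
    then have "i - 1 = 0" using i by auto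
    then have "weight (i - 1) = 0" by (simp add: weight_def)
    then show ?thesis using False by (auto intro!: sum.neutral)
  qed simp
  also have "(M - 1) * (L * weight i) + (L * weight (Suc i) / 2 + L * weight (i - 1) / 2) = M * (L * weight i) - L"
  proof -
    have "real (i - 1) = real i - 1" using i by (auto simp: of_nat_diff)
    then have "weight (Suc i) + weight (i - 1) = 2 * weight i - 2"
      by (simp add: weight_def algebra_simps)
    then have "L * (weight (Suc i) + weight (i - 1)) = L * (2 * weight i - 2)" by (rule arg_cong)
    then have "L * weight (Suc i) + L * weight (i - 1) = 2 * (L * weight i) - 2 * L"
      by (simp only: distrib_left right_diff_distrib mult.commute mult.left_commute)
    then have "L * weight (Suc i) / 2 + L * weight (i - 1) / 2 = L * weight i - L" by linarith
    then show ?thesis by (simp add: algebra_simps)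
  qed
  \<comment> \<open>The weight is at most \<open>n^2\<close>. The additional factor 2 keeps the
    contraction rate positive when \<open>n = 1\<close>.\<close>
  also have "\<dots> \<le> M * (L * weight i) - L * (weight i / (2 * real n ^ 2))"
  proof -
    have "0 \<le> real n ^ 2" by simp
    then have "weight i \<le> 2 * real n ^ 2" using weight_bounds(2)[OF i] by linarith
    then have "weight i / (2 * real n ^ 2) \<le> 1" using n by (simp add: divide_le_eq)
    then show ?thesis using L mult_left_mono[of "weight i / (2 * real n ^ 2)" 1 L] by simp
  qed
  also have "\<dots> = M * ((1 - 1 / (2 * M * real n ^ 2)) * L * weight i)"
    using M(2) n by (simp add: field_simps)
  finally have fin: "\<bar>\<Sum>j\<in>?I. q j h - q j ?h\<bar> \<le> M * ((1 - 1 / (2 * M * real n ^ 2)) * L * weight i)" .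
  define D where "D = (\<Sum>j\<in>?I. q j h - q j ?h)"
  have "\<bar>D\<bar> \<le> M * ((1 - 1 / (2 * M * real n ^ 2)) * L * weight i)" using fin by (simp only: D_def)
  then have "\<bar>D / M\<bar> \<le> (1 - 1 / (2 * M * real n ^ 2)) * L * weight i"
    using M(2) by (simp add: abs_divide pos_divide_le_eq mult.commute)
  moreover have "(\<Sum>j\<in>?I. (f h + f (flip j h)) / 2) = (\<Sum>j\<in>?I. q j h)"
    by (intro sum.cong refl Q[OF h])
  moreover have "(\<Sum>j\<in>?I. (f ?h + f (flip j ?h)) / 2) = (\<Sum>j\<in>?I. q j ?h)"
    by (intro sum.cong refl Q[OF h'])
  moreover have "D / M = (\<Sum>j\<in>?I. q j h) / M - (\<Sum>j\<in>?I. q j ?h) / M"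
    by (simp only: D_def sum_subtractf diff_divide_distrib)
  ultimately show "\<bar>(\<Sum>j\<in>?I. (f h + f (flip j h)) / 2) / M - (\<Sum>j\<in>?I. (f ?h + f (flip j ?h)) / 2) / M\<bar>
      \<le> (1 - 1 / (2 * M * real n ^ 2)) * L * weight i"
    by metis
qed

text \<open>If the maximum is at least 2, a position attaining it is a peak that can be lowered.
  Otherwise the path only takes the values 0 and 1 and has to be the zigzag.\<close>

lemma heights_descend:
  assumes h: "h \<in> heights n" and ne: "h \<noteq> zig n"
  obtains i where "i \<in> {1..<2 * n}" "h i \<ge> 2" "h (i - 1) = h i - 1" "h (Suc i) = h i - 1"
proof (rule ccontr)
  assume no: "\<not> thesis"
  have fin: "finite (h ` {..2 * n})" "h ` {..2 * n} \<noteq> {}" by auto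
  define m where "m = Max (h ` {..2 * n})"
  have le: "h j \<le> m" if "j \<le> 2 * n" for j using that fin by (simp add: m_def)
  have "m \<in> h ` {..2 * n}" unfolding m_def by (rule Max_in[OF fin])
  then obtain i where i: "i \<le> 2 * n" "h i = m" by auto
  have m1: "m \<le> 1"
  proof (rule ccontr)
    assume "\<not> m \<le> 1"
    then have m2: "m \<ge> 2" by simp
    then have ii: "i \<in> {1..<2 * n}" using i h by (auto simp: heights_def) (metis One_nat_def Suc_leI gr0I not_numeral_le_zero, metis le_neq_implies_less not_numeral_le_zero)
    have i1: "i - 1 \<le> 2 * n" and i2: "Suc i \<le> 2 * n" using ii by auto
    note nb = le[OF i1] le[OF i2]
    have "h (i - 1) = h i - 1" using heights_pred[OF h ii] nb i by linarith
    moreover have "h (Suc i) = h i - 1" using heights_step[OF h, of i] nb i ii by auto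
    ultimately show False using no that ii m2 i by blast
  qed
  have "h j = zig n j" if "j \<le> 2 * n" for j
    using that
  proof (induction j)
    case 0
    then show ?case using h by (simp add: heights_def zig_def)
  next
    case (Suc j)
    have "h (Suc j) = h j + 1 \<or> h (Suc j) = h j - 1" using Suc.prems by (intro heights_step[OF h]) simp
    moreover have "0 \<le> h (Suc j)" "h (Suc j) \<le> 1"
      using heights_nonneg[OF h] le[OF Suc.prems] m1 by auto
    moreover have "h (2 * n) = 0" using h by (simp add: heights_def)
    moreover have "h j = zig n j" using Suc by simp
    ultimately show ?case using Suc.prems by (cases "Suc j = 2 * n") (auto simp: zig_def split: if_splits)
  qed
  moreover have "h j = zig n j" if "j > 2 * n" for j using h that by (simp add: heights_def zig_def)
  ultimately have "h = zig n" by (metis ext not_le)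
  then show False using ne by simp
qed

lemma heights_down:
  assumes h: "h \<in> heights n" and i: "i \<in> {1..<2 * n}" "h i \<ge> 2" "h (i - 1) = h i - 1" "h (Suc i) = h i - 1"
  shows "h(i := h i - 2) \<in> heights n"
    and "(\<Sum>j<2 * n. nat ((h(i := h i - 2)) j)) < (\<Sum>j<2 * n. nat (h j))"
    and "flip i (h(i := h i - 2)) = h"
proof -
  show "h(i := h i - 2) \<in> heights n" using i by (intro heights_upd_at[OF h i(1)]) auto
  show "(\<Sum>j<2 * n. nat ((h(i := h i - 2)) j)) < (\<Sum>j<2 * n. nat (h j))"
    using i by (intro sum_strict_mono_ex1) (auto intro!: bexI[of _ i])
  have "i \<noteq> i - 1" "i - 1 \<noteq> i" using i(1) by auto
  then show "flip i (h(i := h i - 2)) = h" using i by (auto simp: flip_def fun_eq_iff)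
qed

text \<open>The path is lowered peak by peak to the zigzag. The sum of the heights decreases each
  time, and a step costs at most \<open>L n^2\<close>.\<close>

lemma flip_lipschitz_osc0:
  assumes f: "flip_lipschitz L f" and L: "L \<ge> 0" and h: "h \<in> heights n"
  shows "\<bar>f h - f (zig n)\<bar> \<le> L * real n ^ 2 * real (\<Sum>j<2 * n. nat (h j))"
  using h
proof (induction "\<Sum>j<2 * n. nat (h j)" arbitrary: h rule: less_induct)
  case less
  show ?case
  proof (cases "h = zig n")
    case True
    then show ?thesis using L by (simp add: sum_nonneg)
  next
    case False
    then obtain i where i: "i \<in> {1..<2 * n}" "h i \<ge> 2" "h (i - 1) = h i - 1" "h (Suc i) = h i - 1"
      using heights_descend[OF less.prems] by blast
    let ?g = "h(i := h i - 2)"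
    note g = heights_down[OF less.prems i]
    have ii: "i - 1 \<noteq> i" using i(1) by auto
    have "\<bar>f ?g - f (?g(i := ?g i + 2))\<bar> \<le> L * weight i"
      using i ii by (intro flip_lipschitzD[OF f i(1) g(1)]) auto
    also have "\<dots> \<le> L * real n ^ 2" using weight_bounds(2)[OF i(1)] L by (intro mult_left_mono)
    finally have 1: "\<bar>f ?g - f h\<bar> \<le> L * real n ^ 2" by simp
    have 2: "\<bar>f ?g - f (zig n)\<bar> \<le> L * real n ^ 2 * real (\<Sum>j<2 * n. nat (?g j))"
      by (rule less.hyps[OF g(2,1)])
    have "real (\<Sum>j<2 * n. nat (?g j)) + 1 \<le> real (\<Sum>j<2 * n. nat (h j))"
      using g(2) by linarith
    then have "L * real n ^ 2 * (real (\<Sum>j<2 * n. nat (?g j)) + 1) \<le> L * real n ^ 2 * real (\<Sum>j<2 * n. nat (h j))"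
      using L by (intro mult_left_mono) auto
    then have "L * real n ^ 2 * real (\<Sum>j<2 * n. nat (?g j)) + L * real n ^ 2 \<le> L * real n ^ 2 * real (\<Sum>j<2 * n. nat (h j))"
      by (simp only: distrib_left mult_1_right)
    then show ?thesis using 1 2 by linarith
  qed
qed

definition flip_step :: "(nat \<Rightarrow> int) \<Rightarrow> (nat \<Rightarrow> int) \<Rightarrow> bool" where
  "flip_step h g \<longleftrightarrow> (\<exists>i\<in>{1..<2 * n}. g = flip i h)"

lemma Poincare_hts:
  assumes n: "n \<ge> 1"
  shows "Poincare flip_step (heights n) (2 * real n ^ 3)"
  unfolding Poincare_def
proof
  fix F
  let ?I = "{1..<2 * n}"
  define M where "M = real (card ?I)"
  define C where "C = 2 * real n ^ 2 * (\<Sum>h\<in>heights n. real (\<Sum>j<2 * n. nat (h j)))"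
  have M: "M = 2 * real n - 1" "M \<ge> 1" using n by (auto simp: M_def of_nat_diff)
  have n1: "1 \<le> real n ^ 2" using n by (intro one_le_power) simp
  have Mn: "2 * M * real n ^ 2 \<ge> 2"
    using mult_mono[of 2 "2 * M" 1 "real n ^ 2"] M n1 by simp
  interpret flip_chain "heights n" ?I flip flip_lipschitz "1 - 1 / (2 * M * real n ^ 2)" C
  proof
    show "finite (heights n)" by (rule finite_hts)
    show "heights n \<noteq> {}" using zig_hts[of n] by blast
    show "finite ?I" "?I \<noteq> {}" using n by auto
    show "flip i h \<in> heights n \<and> flip i (flip i h) = h" if "i \<in> ?I" "h \<in> heights n" for i h
      using flip_mem[OF that(2,1)] flip_flip[OF that(1)] by simp
    show "\<exists>L\<ge>0. flip_lipschitz L f" for f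
    proof (intro exI conjI)
      \<comment> \<open>All weights are at least 1, so the sum of all differences is an admissible
        constant.\<close>
      let ?L = "\<Sum>x\<in>heights n. \<Sum>y\<in>heights n. \<bar>f x - f y\<bar>"
      show "0 \<le> ?L" by (intro sum_nonneg) auto
      show "flip_lipschitz ?L f"
        unfolding flip_lipschitz_def
      proof (intro ballI impI)
        fix i h assume i: "i \<in> ?I" and h: "h \<in> heights n" and v: "h (i - 1) = h (Suc i) \<and> h i = h (i - 1) - 1"
        have h': "h(i := h i + 2) \<in> heights n"
          using v heights_nonneg[OF h, of i] by (intro heights_upd_at[OF h i]) auto
        have "\<bar>f h - f (h(i := h i + 2))\<bar> \<le> (\<Sum>y\<in>heights n. \<bar>f h - f y\<bar>)"
          using finite_hts by (intro member_le_sum[OF h', of "\<lambda>y. \<bar>f h - f y\<bar>"]) auto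
        also have "\<dots> \<le> ?L"
          using finite_hts by (intro member_le_sum[OF h, of "\<lambda>x. \<Sum>y\<in>heights n. \<bar>f x - f y\<bar>"]) (auto intro: sum_nonneg)
        also have "\<dots> \<le> ?L * weight i"
          using weight_bounds(1)[OF i] mult_left_mono[of 1 "weight i" ?L] \<open>0 \<le> ?L\<close> by simp
        finally show "\<bar>f h - f (h(i := h i + 2))\<bar> \<le> ?L * weight i" .
      qed
    qed
    show "\<bar>f x - f y\<bar> \<le> C * L" if L: "0 \<le> L" and f: "flip_lipschitz L f" and xy: "x \<in> heights n" "y \<in> heights n" for L f x y
    proof -
      have "\<bar>f z - f (zig n)\<bar> \<le> L * (C / 2)" if z: "z \<in> heights n" for z
      proof -
        have "real (\<Sum>j<2 * n. nat (z j)) \<le> (\<Sum>h\<in>heights n. real (\<Sum>j<2 * n. nat (h j)))"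
          using finite_hts by (intro member_le_sum[OF z, of "\<lambda>h. real (\<Sum>j<2 * n. nat (h j))"]) (auto intro!: sum_nonneg)
        then have "L * real n ^ 2 * real (\<Sum>j<2 * n. nat (z j)) \<le> L * real n ^ 2 * (\<Sum>h\<in>heights n. real (\<Sum>j<2 * n. nat (h j)))"
          using L by (intro mult_left_mono) auto
        then show ?thesis using flip_lipschitz_osc0[OF f L z] by (simp add: C_def mult.assoc)
      qed
      from this[OF xy(1)] this[OF xy(2)] have "\<bar>f x - f (zig n)\<bar> + \<bar>f y - f (zig n)\<bar> \<le> L * (C / 2) + L * (C / 2)"
        by (rule add_mono)
      moreover have "\<bar>f x - f y\<bar> \<le> \<bar>f x - f (zig n)\<bar> + \<bar>f y - f (zig n)\<bar>"
        using abs_triangle_ineq4[of "f x - f (zig n)" "f y - f (zig n)"] by simp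
      moreover have "L * (C / 2) + L * (C / 2) = C * L" by simp
      ultimately show ?thesis by linarith
    qed
    show "flip_lipschitz ((1 - 1 / (2 * M * real n ^ 2)) * L) (\<lambda>h. (\<Sum>i\<in>?I. (f h + f (flip i h)) / 2) / real (card ?I))"
      if "0 \<le> L" "flip_lipschitz L f" for L f
      using flip_lipschitz_contr[OF n that] by (simp add: M_def)
    show "0 < 1 - 1 / (2 * M * real n ^ 2)" "1 - 1 / (2 * M * real n ^ 2) < 1"
      using Mn by (auto simp: field_simps)
  qed
  let ?D = "edge_energy flip_step (heights n) F"
  have E: "(\<Sum>h\<in>heights n. (F h - F (flip i h))\<^sup>2) \<le> ?D" if i: "i \<in> ?I" for i
    using flip_mem[OF _ i] i by (intro sum_edges_le_dirich finite_hts) (auto simp: flip_step_def)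
  have "pair_energy (heights n) (heights n) F \<le> real (card (heights n)) / (1 - (1 - 1 / (2 * M * real n ^ 2))) *
      ((\<Sum>i\<in>?I. \<Sum>h\<in>heights n. (F h - F (flip i h))\<^sup>2) / (2 * real (card ?I)))"
    by (rule poincare)
  also have "\<dots> \<le> real (card (heights n)) / (1 - (1 - 1 / (2 * M * real n ^ 2))) * ((\<Sum>i\<in>?I. ?D) / (2 * real (card ?I)))"
    using M(2) by (intro mult_left_mono divide_right_mono sum_mono E) auto
  \<comment> \<open>Here \<open>1 / (1 - \<theta>)\<close> is \<open>2 M n^2\<close>, the sum over
    positions is \<open>M\<close> times the energy, and the division by \<open>2 M\<close> leaves
    \<open>M n^2\<close>.\<close>
  also have "\<dots> = real (card (heights n)) * (M * real n ^ 2) * ?D"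
    using M(2) n unfolding M_def by simp
  also have "\<dots> \<le> real (card (heights n)) * (2 * real n * real n ^ 2) * ?D"
    using M by (intro mult_right_mono mult_left_mono edge_energy_nonneg) auto
  also have "\<dots> = 2 * real n ^ 3 * real (card (heights n)) * ?D"
    by (simp add: power2_eq_square power3_eq_cube)
  finally show "pair_energy (heights n) (heights n) F \<le> 2 * real n ^ 3 * real (card (heights n)) * ?D" .
qed

end

section \<open>Planar gluings\<close>

definition letter :: "(nat \<Rightarrow> nat) \<Rightarrow> nat \<Rightarrow> int" where
  "letter s k = (if k < s k then 1 else if s k < k then - 1 else 0)"

definition height :: "(nat \<Rightarrow> nat) \<Rightarrow> nat \<Rightarrow> int" where
  "height s i = (\<Sum>k<i. letter s k)"

text \<open>Only the right end of an arc is tested. A letter inside the arc with a partner left of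
  \<open>i\<close> would make that partner open an arc that contains \<open>i\<close> but not
  \<open>s i\<close>, which the same condition excludes.\<close>

definition planar :: "nat \<Rightarrow> (nat \<Rightarrow> nat) set" where
  "planar n = {s \<in> matching {..<2 * n}. \<forall>i j. i < j \<and> j < s i \<longrightarrow> s j < s i}"

lemma height_Suc: "height s (Suc i) = height s i + letter s i"
  by (simp add: height_def)

lemma height_diff: "a \<le> b \<Longrightarrow> height s b - height s a = (\<Sum>k\<in>{a..<b}. letter s k)"
  unfolding height_def by (simp add: sum_diff_nat_ivl lessThan_atLeast0)

context
  fixes n :: nat
begin

lemma planar_matching: "s \<in> planar n \<Longrightarrow> s \<in> matching {..<2 * n}"
  by (simp add: planar_def)

lemma planarD: "s \<in> planar n \<Longrightarrow> i < j \<Longrightarrow> j < s i \<Longrightarrow> s j < s i"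
  by (simp add: planar_def)

lemma match_props:
  assumes "s \<in> matching {..<2 * n}"
  shows "s (s k) = k" "k < 2 * n \<Longrightarrow> s k < 2 * n" "k < 2 * n \<Longrightarrow> s k \<noteq> k" "k \<ge> 2 * n \<Longrightarrow> s k = k"
  using assms matching_invol[OF assms] by (auto simp: matching_def)

lemma match_inj: "s \<in> matching {..<2 * n} \<Longrightarrow> s x = s y \<longleftrightarrow> x = y"
  by (metis match_props(1))

lemma planar_inside:
  assumes s: "s \<in> planar n" and ij: "i < s i" and k: "i < k" "k < s i"
  shows "i < s k" "s k < s i"
proof -
  note m = match_props[OF planar_matching[OF s]]
  show "s k < s i" using planarD[OF s k] .
  show "i < s k"
  proof (rule ccontr)
    assume "\<not> i < s k"
    moreover have "s k \<noteq> i" using m(1)[of k] k by auto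
    ultimately have "s k < i" by simp
    moreover have "i < s (s k)" using k m(1)[of k] by simp
    ultimately have "s i < s (s k)" by (rule planarD[OF s])
    then show False using k m(1)[of k] by simp
  qed
qed

text \<open>The partner of a closing letter lies in the interval and opens there, so closing letters
  inject into opening ones.\<close>

lemma letter_sum_nonneg:
  assumes m: "s \<in> matching {..<2 * n}" and closed: "\<And>k. a \<le> k \<Longrightarrow> k < c \<Longrightarrow> a \<le> s k"
  shows "0 \<le> (\<Sum>k\<in>{a..<c}. letter s k)"
proof -
  let ?O = "{k \<in> {a..<c}. k < s k}" and ?C = "{k \<in> {a..<c}. s k < k}"
  have "card ?C \<le> card ?O"
  proof (rule card_inj_on_le[where f = s])
    show "inj_on s ?C" using match_inj[OF m] by (auto simp: inj_on_def)
    show "s ` ?C \<subseteq> ?O" using closed match_props(1)[OF m] by fastforce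
  qed auto
  moreover have "(\<Sum>k\<in>{a..<c}. letter s k) = (\<Sum>k\<in>{a..<c}. (if k < s k then 1 else 0) - (if s k < k then 1 else 0))"
    by (intro sum.cong refl) (auto simp: letter_def)
  moreover have "\<dots> = int (card ?O) - int (card ?C)"
    by (simp add: sum_subtractf sum.If_cases Int_def conj_commute)
  ultimately show ?thesis by simp
qed

lemma letter_sum_zero:
  assumes m: "s \<in> matching {..<2 * n}" and closed: "\<And>k. a \<le> k \<Longrightarrow> k < c \<Longrightarrow> a \<le> s k \<and> s k < c"
  shows "(\<Sum>k\<in>{a..<c}. letter s k) = 0"
proof -
  have "(\<Sum>k\<in>{a..<c}. letter s k) = (\<Sum>k\<in>{a..<c}. letter s (s k))"
    by (rule sum.reindex_bij_witness[of _ s s]) (use closed match_props(1)[OF m] in auto)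
  also have "\<dots> = (\<Sum>k\<in>{a..<c}. - letter s k)"
    using match_props(1)[OF m] by (intro sum.cong refl) (auto simp: letter_def)
  finally show ?thesis by (simp add: sum_negf)
qed

lemma height_hts:
  assumes s: "s \<in> matching {..<2 * n}"
  shows "height s \<in> heights n"
proof -
  note m = match_props[OF s]
  have end0: "height s (2 * n) = 0"
    using letter_sum_zero[OF s, of 0 "2 * n"] m(2) by (simp add: height_def lessThan_atLeast0)
  have "height s i = 0" if "2 * n \<le> i" for i
    using that
  proof (induction i rule: dec_induct)
    case (step i)
    then show ?case using m(4)[of i] by (simp add: height_Suc letter_def)
  qed (rule end0)
  moreover have "0 \<le> height s i" for i
    using letter_sum_nonneg[OF s, of 0 i] by (simp add: height_def lessThan_atLeast0)
  moreover have "\<bar>height s (Suc i) - height s i\<bar> = 1" if "i < 2 * n" for i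
    using m(3)[OF that] by (simp add: height_Suc letter_def)
  moreover have "height s 0 = 0" by (simp add: height_def)
  ultimately show ?thesis by (simp add: heights_def)
qed

lemma height_opener:
  assumes s: "s \<in> planar n" and ij: "i < s i"
  shows "height s (Suc (s i)) = height s i" and "i < k \<Longrightarrow> k \<le> s i \<Longrightarrow> height s i < height s k"
proof -
  note m = planar_matching[OF s]
  have 1: "height s (Suc i) = height s i + 1" using ij by (simp add: height_Suc letter_def)
  show 2: "height s i < height s k" if "i < k" "k \<le> s i" for k
  proof -
    have "0 \<le> (\<Sum>l\<in>{Suc i..<k}. letter s l)"
      using planar_inside(1)[OF s ij] that by (intro letter_sum_nonneg[OF m]) (simp add: Suc_le_eq)
    then have "height s (Suc i) \<le> height s k" using height_diff[of "Suc i" k s] that by simp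
    then show ?thesis using 1 by simp
  qed
  have "(\<Sum>l\<in>{Suc i..<s i}. letter s l) = 0"
    using planar_inside[OF s ij] by (intro letter_sum_zero[OF m]) (simp add: Suc_le_eq)
  then have "height s (s i) = height s (Suc i)" using height_diff[of "Suc i" "s i" s] ij by simp
  moreover have "letter s (s i) = - 1" using ij match_props(1)[OF m] by (simp add: letter_def)
  ultimately show "height s (Suc (s i)) = height s i" using 1 by (simp add: height_Suc)
qed

text \<open>Over an arc the path stays strictly above its starting level, so the arc ends at the
  first return to this level. Hence the path determines the matching.\<close>

lemma opener_Least:
  assumes s: "s \<in> planar n" and ij: "i < s i"
  shows "s i = (LEAST j. i < j \<and> height s (Suc j) = height s i)"
proof (rule Least_equality[symmetric])
  show "i < s i \<and> height s (Suc (s i)) = height s i" using ij height_opener(1)[OF s ij] by simp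
  fix j assume j: "i < j \<and> height s (Suc j) = height s i"
  show "s i \<le> j"
  proof (rule ccontr)
    assume "\<not> s i \<le> j"
    then show False using height_opener(2)[OF s ij, of "Suc j"] j by simp
  qed
qed

lemma height_inj:
  assumes s: "s \<in> planar n" and t: "t \<in> planar n" and eq: "height s = height t"
  shows "s = t"
proof
  fix k
  note ms = match_props[OF planar_matching[OF s]] and mt = match_props[OF planar_matching[OF t]]
  have l: "letter s i = letter t i" for i
    using height_Suc[of s i] height_Suc[of t i] eq by simp
  have op: "i < t i \<and> t i = s i" if "i < s i" for i
  proof -
    have "i < t i" using l[of i] that by (simp add: letter_def split: if_splits)
    then show ?thesis using opener_Least[OF s that] opener_Least[OF t] eq by simp
  qed
  show "s k = t k"
  proof (cases "k < 2 * n")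
    case False
    then show ?thesis using ms(4) mt(4) by simp
  next
    case True
    then consider "k < s k" | "s k < k" using ms(3) by (meson linorder_neqE_nat)
    then show ?thesis
    proof cases
      case 2
      then have "t (s k) = k" using op[of "s k"] ms(1) by simp
      then show ?thesis using mt(1) by metis
    qed (use op in simp)
  qed
qed

section \<open>Corner flips as chord swaps\<close>

lemma conj_swp_apply:
  assumes s: "s \<in> matching {..<2 * n}" and "x \<noteq> y" "s x \<noteq> y" "s x \<noteq> x" "s y \<noteq> y"
  defines "t \<equiv> swp x y \<circ> s \<circ> swp x y"
  shows "t x = s y" "t y = s x" "t (s x) = y" "t (s y) = x"
    "\<And>z. z \<notin> {x, y, s x, s y} \<Longrightarrow> t z = s z"
proof -
  note m = match_props(1)[OF s] and inj = match_inj[OF s]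
  have "s y \<noteq> x" using m assms by metis
  then show "t x = s y" "t y = s x" "t (s x) = y" "t (s y) = x"
    using assms m by (simp_all add: t_def)
  fix z assume z: "z \<notin> {x, y, s x, s y}"
  have "s z \<noteq> x" "s z \<noteq> y" using z m[of z] by auto
  with z show "t z = s z" by (simp add: t_def)
qed

lemma conj_swp_matching:
  assumes "s \<in> matching {..<2 * n}" "x < 2 * n" "y < 2 * n"
  shows "swp x y \<circ> s \<circ> swp x y \<in> matching {..<2 * n}"
proof -
  have "swp x y ` {..<2 * n} = {..<2 * n}" using assms(2,3) by (simp add: transpose_image_eq)
  then show ?thesis using matching_conj[OF assms(1) bij_transpose, of x y] by (simp only: inv_transpose_eq)
qed

text \<open>At a valley the chords \<open>{A, i - 1}\<close> and \<open>{i, B}\<close> stand side by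
  side. The swap replaces them by a leaf \<open>{i - 1, i}\<close> below \<open>{A, B}\<close>,
  which changes the direction of the path only in the two steps around \<open>i\<close>.\<close>

lemma planar_raise:
  assumes s: "s \<in> planar n" and i: "i \<in> {1..<2 * n}" and a: "s (i - 1) < i - 1" and b: "i < s i"
  defines "t \<equiv> swp (s (i - 1)) i \<circ> s \<circ> swp (s (i - 1)) i"
  shows "t \<in> planar n" "sw s t" "height t = (height s)(i := height s i + 2)"
proof -
  note mm = planar_matching[OF s]
  note m = match_props[OF mm]
  define A B where "A = s (i - 1)" and "B = s i"
  have A: "A < i - 1" "s A = i - 1" "s (i - 1) = A" and B: "i < B" "s B = i" "s i = B"
    using a b m(1) by (auto simp: A_def B_def)
  have lt: "A < 2 * n" "i < 2 * n" "B < 2 * n" using i A(1) m(2)[of i] by (auto simp: B_def)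
  have t: "t = swp A i \<circ> s \<circ> swp A i" by (simp add: t_def A_def)
  have ne: "A \<noteq> i" "s A \<noteq> i" "s A \<noteq> A" "s i \<noteq> i" using A B i by auto
  have tv: "t A = B" "t B = A" "t i = i - 1" "t (i - 1) = i" "\<And>z. z \<notin> {A, B, i - 1, i} \<Longrightarrow> t z = s z"
    unfolding t using conj_swp_apply[OF mm ne] A B by auto
  show tm: "sw s t" unfolding t using lt ne by (intro sw_conj[OF mm]) auto
  have mt: "t \<in> matching {..<2 * n}" unfolding t using conj_swp_matching[OF mm] lt by simp
  have "t j < t k" if kj: "k < j" "j < t k" for k j
  proof -
    have sp: "u < w \<Longrightarrow> w < s u \<Longrightarrow> s w < s u" for u w using planarD[OF s] .
    have sk_ne: "s k \<noteq> i" if "k \<noteq> B" using that m(1)[of k] B by auto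
    consider "k = i - 1 \<or> k = i \<or> k = B" | "k = A" | "k \<notin> {A, B, i - 1, i}" by blast
    then show ?thesis
    proof cases
      case 1
      then show ?thesis using kj tv A B i by (elim disjE) simp_all
    next
      case 2
      then have j: "A < j" "j < B" using kj tv by simp_all
      consider "j = i - 1" | "j = i" | "j < i - 1" | "j > i" by linarith
      then have "t j < B"
      proof cases
        case 3
        then have "t j = s j" "s j < i - 1" using tv(5)[of j] j sp[of A j] A B by simp_all
        then show ?thesis using B by simp
      next
        case 4
        then have "t j = s j" using tv(5)[of j] j A by simp
        then show ?thesis using sp[of i j] 4 j B by simp
      qed (use tv B in simp_all)
      then show ?thesis using 2 tv by simp
    next
      case 3
      then have k: "t k = s k" "k < j" "j < s k" using tv kj by simp_all
      consider "j = A" | "j = B" | "j = i - 1" | "j = i" | "j \<notin> {A, B, i - 1, i}" by blast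
      then have "t j < s k"
      proof cases
        case 1
        then have "i - 1 < s k" using sp[of k A] k A by simp
        then have "i < s k" using sk_ne 3 by simp
        moreover have "k < i" using 1 k A by simp
        ultimately have "s i < s k" by (intro sp)
        then show ?thesis using 1 tv B by simp
      next
        case 2
        then show ?thesis using tv k A B by simp
      next
        case j: 3
        then have "i < s k" using k sk_ne 3 by simp
        then show ?thesis using j tv by simp
      next
        case 4
        then show ?thesis using tv k by simp
      next
        case 5
        then show ?thesis using tv(5)[of j] sp[OF k(2,3)] by simp
      qed
      then show ?thesis using k by simp
    qed
  qed
  then show "t \<in> planar n" using mt by (simp add: planar_def)
  have lett: "letter t k = letter s k + (if k = i - 1 then 2 else 0) - (if k = i then 2 else 0)" for k
  proof -
    have ii: "i - 1 < i" "i - 1 \<noteq> i" using i by auto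
    consider "k = A" | "k = B" | "k = i - 1" | "k = i" | "k \<notin> {A, B, i - 1, i}" by blast
    then show ?thesis
    proof cases
      case 1
      have "A \<noteq> i - 1" "A \<noteq> i" "A < B" using A B by simp_all
      then show ?thesis using 1 tv(1) A by (simp add: letter_def)
    next
      case 2
      have "B \<noteq> i - 1" "B \<noteq> i" "A < B" using A B by simp_all
      then show ?thesis using 2 tv(2) B by (simp add: letter_def)
    next
      case 3
      then show ?thesis using tv(4) A ii by (simp add: letter_def)
    next
      case 4
      then show ?thesis using tv(3) B ii by (simp add: letter_def)
    next
      case 5
      then show ?thesis using tv(5)[of k] by (simp add: letter_def)
    qed
  qed
  have "height t k = height s k + (if k = i then 2 else 0)" for k
  proof (induction k)
    case (Suc k)
    then show ?case using lett[of k] i by (auto simp: height_Suc)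
  qed (use i in \<open>simp add: height_def\<close>)
  then show "height t = (height s)(i := height s i + 2)" by (simp add: fun_eq_iff)
qed

text \<open>The innermost chord \<open>{a, s a}\<close> around the leaf \<open>{i - 1, i}\<close> is cut open.\<close>

lemma planar_lower:
  assumes s: "s \<in> planar n" and i: "i \<in> {1..<2 * n}" and leaf: "s (i - 1) = i"
    and a: "a < i - 1" "i < s a" and inner: "\<And>c. a < c \<Longrightarrow> c < i - 1 \<Longrightarrow> s c < i"
  defines "t \<equiv> swp a i \<circ> s \<circ> swp a i"
  shows "t \<in> planar n" "sw s t" "height t = (height s)(i := height s i - 2)"
proof -
  note mm = planar_matching[OF s]
  note m = match_props[OF mm]
  define B where "B = s a"
  have B: "i < B" "s B = a" "s a = B" and A: "a < i - 1" and lf: "s i = i - 1" "s (i - 1) = i"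
    using a leaf m(1) by (auto simp: B_def) metis
  have lt: "a < 2 * n" "i < 2 * n" "B < 2 * n" using i A m(2)[of a] by (auto simp: B_def)
  have ne: "a \<noteq> i" "s a \<noteq> i" "s a \<noteq> a" "s i \<noteq> i" using A B lf i by auto
  have tv: "t a = i - 1" "t (i - 1) = a" "t i = B" "t B = i" "\<And>z. z \<notin> {a, B, i - 1, i} \<Longrightarrow> t z = s z"
    unfolding t_def using conj_swp_apply[OF mm ne] A B lf by auto
  show tm: "sw s t" unfolding t_def using lt ne by (intro sw_conj[OF mm]) auto
  have mt: "t \<in> matching {..<2 * n}" unfolding t_def using conj_swp_matching[OF mm] lt by simp
  have "t j < t k" if kj: "k < j" "j < t k" for k j
  proof -
    have sp: "u < w \<Longrightarrow> w < s u \<Longrightarrow> s w < s u" for u w using planarD[OF s] .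
    consider "k = i - 1 \<or> k = B" | "k = a" | "k = i" | "k \<notin> {a, B, i - 1, i}" by blast
    then show ?thesis
    proof cases
      case 1
      then show ?thesis using kj tv A B by (elim disjE) simp_all
    next
      case 2
      then have j: "a < j" "j < i - 1" using kj tv by simp_all
      then have "j \<notin> {a, B, i - 1, i}" using B(1) by auto
      then have "t j = s j" by (rule tv(5))
      moreover have "s j < i" using inner j by simp
      moreover have "s j \<noteq> i - 1" using m(1)[of j] lf j by auto
      ultimately show ?thesis using 2 tv by simp
    next
      case 3
      then have j: "i < j" "j < B" using kj tv by simp_all
      then have "j \<notin> {a, B, i - 1, i}" using A by auto
      then have "t j = s j" by (rule tv(5))
      moreover have "s j < B" using sp[of a j] j A B by simp
      ultimately show ?thesis using 3 tv by simp
    next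
      case 4
      then have k: "t k = s k" "k < j" "j < s k" using tv kj by simp_all
      consider "j = a" | "j = B" | "j = i - 1" | "j = i" | "j \<notin> {a, B, i - 1, i}" by blast
      then have "t j < s k"
      proof cases
        case 1
        then show ?thesis using sp[of k a] k tv B by simp
      next
        case 2
        then show ?thesis using tv k B by simp
      next
        case 3
        then show ?thesis using tv k A by simp
      next
        case j: 4
        have "k < a"
        proof (rule ccontr)
          assume "\<not> k < a"
          then have "a < k" "k < i - 1" using k j 4 by auto
          then show False using inner[of k] k j by simp
        qed
        then show ?thesis using sp[of k a] j k tv A B by simp
      next
        case 5
        then show ?thesis using tv(5)[of j] sp[OF k(2,3)] by simp
      qed
      then show ?thesis using k by simp
    qed
  qed
  then show "t \<in> planar n" using mt by (simp add: planar_def)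
  have lett: "letter t k = letter s k - (if k = i - 1 then 2 else 0) + (if k = i then 2 else 0)" for k
  proof -
    have ii: "i - 1 < i" "i - 1 \<noteq> i" using i by auto
    consider "k = a" | "k = B" | "k = i - 1" | "k = i" | "k \<notin> {a, B, i - 1, i}" by blast
    then show ?thesis
    proof cases
      case 1
      have "a \<noteq> i - 1" "a \<noteq> i" "a < B" using A B by simp_all
      then show ?thesis using 1 tv(1) A B by (simp add: letter_def)
    next
      case 2
      have "B \<noteq> i - 1" "B \<noteq> i" "a < B" using A B by simp_all
      then show ?thesis using 2 tv(4) B by (simp add: letter_def)
    next
      case 3
      then show ?thesis using tv(2) A lf ii by (simp add: letter_def)
    next
      case 4
      then show ?thesis using tv(3) B lf ii by (simp add: letter_def)
    next
      case 5
      then show ?thesis using tv(5)[of k] by (simp add: letter_def)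
    qed
  qed
  have "height t k = height s k - (if k = i then 2 else 0)" for k
  proof (induction k)
    case (Suc k)
    then show ?case using lett[of k] i by (auto simp: height_Suc)
  qed (use i in \<open>simp add: height_def\<close>)
  then show "height t = (height s)(i := height s i - 2)" by (simp add: fun_eq_iff)
qed

text \<open>A valley is raised by \<open>planar_raise\<close>. At a peak the letters
  \<open>i - 1\<close> and \<open>i\<close> form a leaf, and the positive height of its neighbours
  provides an enclosing chord for \<open>planar_lower\<close>.\<close>

lemma planar_flip:
  assumes s: "s \<in> planar n" and i: "i \<in> {1..<2 * n}"
  shows "\<exists>t\<in>planar n. height t = flip i (height s) \<and> (t = s \<or> sw s t)"
proof (cases "height s (i - 1) = height s (Suc i) \<and> height s (i - 1) \<noteq> 0")
  case False
  then have "flip i (height s) = height s" by (auto simp: flip_def)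
  then show ?thesis using s by metis
next
  case True
  note mm = planar_matching[OF s]
  note m = match_props[OF mm]
  have Suc: "Suc (i - 1) = i" using i by simp
  have hi: "height s i = height s (i - 1) + letter s (i - 1)" "height s (Suc i) = height s i + letter s i"
    using height_Suc[of s "i - 1"] Suc by (simp_all add: height_Suc)
  have ne: "s (i - 1) \<noteq> i - 1" "s i \<noteq> i" using m(3) i by auto
  show ?thesis
  proof (cases "i < s i")
    case up: True
    then have l: "letter s i = 1" by (simp add: letter_def)
    then have l': "letter s (i - 1) = - 1" using hi True by simp
    then have a: "s (i - 1) < i - 1" by (simp add: letter_def split: if_splits)
    note r = planar_raise[OF s i a up]
    have "2 * height s (i - 1) - height s i = height s i + 2" using hi l' by simp
    then have "flip i (height s) = (height s)(i := height s i + 2)" using True by (simp add: flip_def)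
    then show ?thesis using r by metis
  next
    case down: False
    then have dn: "s i < i" using ne by simp
    then have l: "letter s i = - 1" by (simp add: letter_def)
    then have l': "letter s (i - 1) = 1" using hi True by simp
    then have up: "i - 1 < s (i - 1)" by (simp add: letter_def split: if_splits)
    have leaf: "s (i - 1) = i"
    proof (rule ccontr)
      assume no: "s (i - 1) \<noteq> i"
      then have "i < s (i - 1)" using up Suc by simp
      moreover have "i - 1 < i" using i by simp
      ultimately have "i - 1 < s i" using planar_inside(1)[OF s up] by blast
      then show False using dn by simp
    qed
    \<comment> \<open>The openers of the chords around the leaf; the largest one is innermost. If
      there were none, the letters before the leaf would be matched among themselves and the height
      at \<open>i - 1\<close> would be 0.\<close>
    define Q where "Q = {c. c < i - 1 \<and> i < s c}"
    have "Q \<noteq> {}"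
    proof
      assume "Q = {}"
      have in0: "s k < i - 1" if "k < i - 1" for k
      proof -
        have "\<not> i < s k" using \<open>Q = {}\<close> that by (auto simp: Q_def)
        moreover have "s k \<noteq> i" using leaf m(1) that by (metis less_irrefl)
        moreover have "s k \<noteq> i - 1" using leaf m(1) that Suc by (metis lessI less_asym)
        ultimately show ?thesis using Suc by linarith
      qed
      then have "(\<Sum>k\<in>{0..<i - 1}. letter s k) = 0" by (intro letter_sum_zero[OF mm]) auto
      then show False using True by (simp add: height_def lessThan_atLeast0)
    qed
    moreover have fQ: "finite Q" by (simp add: Q_def)
    ultimately have "Max Q \<in> Q" by (rule Max_in[rotated])
    then have a: "Max Q < i - 1" "i < s (Max Q)" by (auto simp: Q_def)
    have inner: "s c < i" if c: "Max Q < c" "c < i - 1" for c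
    proof -
      have "c \<notin> Q" using c(1) Max_ge[OF fQ, of c] by auto
      moreover have "s c \<noteq> i" using leaf m(1) c by (metis less_irrefl)
      ultimately show ?thesis using c by (auto simp: Q_def)
    qed
    note r = planar_lower[OF s i leaf a inner]
    have "2 * height s (i - 1) - height s i = height s i - 2" using hi l' by simp
    then have "flip i (height s) = (height s)(i := height s i - 2)" using True by (simp add: flip_def)
    then show ?thesis using r by metis
  qed
qed

definition zigm :: "nat \<Rightarrow> nat" where
  "zigm k = (if k < 2 * n then (if even k then Suc k else k - 1) else k)"

lemma zigm_planar: "zigm \<in> planar n" and height_zigm: "height zigm = zig n"
proof -
  have lt: "Suc k < 2 * n" if "k < 2 * n" "even k" for k using that by presburger
  have "zigm \<in> matching {..<2 * n}"
    unfolding matching_def using lt by (auto simp: zigm_def elim: oddE)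
  then show p: "zigm \<in> planar n" by (auto simp: planar_def zigm_def split: if_splits)
  have "height zigm k = zig n k" for k
  proof (induction k)
    case (Suc k)
    then show ?case using lt[of k] by (auto simp: height_Suc letter_def zigm_def zig_def dest: odd_pos)
  qed (simp add: height_def zig_def)
  then show "height zigm = zig n" by (rule ext)
qed

text \<open>The path is lowered to the zigzag, whose preimage is \<open>zigm\<close>, and the
  preimage is lifted back along the reversed flips.\<close>

lemma height_surj:
  assumes "h \<in> heights n"
  shows "h \<in> height ` planar n"
  using assms
proof (induction "\<Sum>j<2 * n. nat (h j)" arbitrary: h rule: less_induct)
  case less
  show ?case
  proof (cases "h = zig n")
    case True
    with imageI[OF zigm_planar, of height] show ?thesis by (simp only: height_zigm)
  next
    case False
    then obtain i where i: "i \<in> {1..<2 * n}" "h i \<ge> 2" "h (i - 1) = h i - 1" "h (Suc i) = h i - 1"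
      using heights_descend[OF less.prems] by blast
    note g = heights_down[OF less.prems i]
    obtain s where s: "s \<in> planar n" "h(i := h i - 2) = height s" using less.hyps[OF g(2,1)] by blast
    obtain t where "t \<in> planar n" "height t = flip i (height s)" using planar_flip[OF s(1) i(1)] by blast
    then show ?thesis using g(3) s(2) by (metis imageI)
  qed
qed

lemma height_bij: "bij_betw height (planar n) (heights n)"
  unfolding bij_betw_def inj_on_def
  using height_inj height_surj height_hts[OF planar_matching] by blast

lemma Poincare_planar:
  assumes n: "n \<ge> 1"
  shows "Poincare sw (planar n) (2 * real n ^ 3)"
  unfolding Poincare_def
proof
  fix F
  have fin: "finite (planar n)"
    by (rule finite_subset[OF _ finite_matching[of "{..<2 * n}"]]) (auto simp: planar_def)
  let ?f = "inv_into (planar n) height"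
  have bij: "bij_betw ?f (heights n) (planar n)" by (rule bij_betw_inv_into[OF height_bij])
  have f1: "?f h \<in> planar n" "height (?f h) = h" if "h \<in> heights n" for h
    using that height_bij by (auto simp: bij_betw_def inv_into_into f_inv_into_f)
  have f2: "?f (height s) = s" if "s \<in> planar n" for s
    using that height_bij by (simp add: bij_betw_def)
  \<comment> \<open>A blocked flip fixes the path and need not come from a swap. Removing these
    loops does not change the energy.\<close>
  let ?W = "\<lambda>h g. flip_step n h g \<and> h \<noteq> g"
  have "Poincare ?W (heights n) (2 * real n ^ 3)"
  proof -
    have "edge_energy ?W (heights n) G = edge_energy (flip_step n) (heights n) G" for G
      unfolding edge_energy_def using finite_hts[of n] by (intro sum.mono_neutral_left) auto
    then show ?thesis using Poincare_hts[OF n] by (simp add: Poincare_def)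
  qed
  then show "pair_energy (planar n) (planar n) F \<le> 2 * real n ^ 3 * real (card (planar n)) * edge_energy sw (planar n) F"
  proof (rule Poincare_image[OF bij fin order.refl])
    fix h g assume h: "h \<in> heights n" and g: "g \<in> heights n" and hg: "flip_step n h g \<and> h \<noteq> g"
    then obtain i where i: "i \<in> {1..<2 * n}" "g = flip i h" by (auto simp: flip_step_def)
    obtain t where t: "t \<in> planar n" "height t = flip i (height (?f h))" "t = ?f h \<or> sw (?f h) t"
      using planar_flip[OF f1(1)[OF h] i(1)] by blast
    have "height t = g" using t(2) f1(2)[OF h] i(2) by simp
    then have "?f g = t" using f2[OF t(1)] by simp
    moreover have "t \<noteq> ?f h" using \<open>height t = g\<close> f1(2)[OF h] hg by auto
    ultimately show "sw (?f h) (?f g)" using t(3) by simp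
  qed simp
qed

text \<open>The two bounds on the number of vertices make the value \<open>Suc n\<close> equivalent
  to the absence of crossings, and in the increasing word a crossing is a violation of the nesting
  condition.\<close>

lemma gluings_planar: "gluings [0..<2 * n] (Suc n) = planar n"
proof -
  have iff: "has_crossing [0..<2 * n] s \<longleftrightarrow> \<not> (\<forall>i j. i < j \<and> j < s i \<longrightarrow> s j < s i)"
    if m: "s \<in> matching {..<2 * n}" for s
  proof
    assume "has_crossing [0..<2 * n] s"
    then obtain A p1 B p2 C D E where e: "[0..<2 * n] = A @ p1 # B @ p2 # C @ s p1 # D @ s p2 # E"
      by (rule crossing_rotation)
    have "sorted_wrt (<) [0..<2 * n]" by (rule sorted_wrt_upt)
    then have "p1 < p2" "p2 < s p1" "s p1 < s p2" unfolding e by (auto simp: sorted_wrt_append)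
    then show "\<not> (\<forall>i j. i < j \<and> j < s i \<longrightarrow> s j < s i)" by (metis less_asym)
  next
    assume "\<not> (\<forall>i j. i < j \<and> j < s i \<longrightarrow> s j < s i)"
    then obtain i j where ij: "i < j" "j < s i" "\<not> s j < s i" by blast
    then have "s i < s j" using match_inj[OF m, of i j] by (metis linorder_neqE_nat less_irrefl)
    moreover have "s j < 2 * n"
    proof (rule ccontr)
      assume "\<not> s j < 2 * n"
      then have "s j = j" using match_props(1,4)[OF m] by (metis not_less)
      then show False using \<open>s i < s j\<close> ij by simp
    qed
    ultimately have "\<exists>A B C D E. [0..<2 * n] = A @ [0..<2 * n] ! i # B @ [0..<2 * n] ! j # C @ [0..<2 * n] ! s i # D @ [0..<2 * n] ! s j # E"
      using ij by (intro split_index4) auto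
    then have "subseq [i, j, s i, s j] [0..<2 * n]"
      unfolding subseq4_iff using ij \<open>s i < s j\<close> \<open>s j < 2 * n\<close> by simp
    then show "has_crossing [0..<2 * n] s" unfolding has_crossing_def by blast
  qed
  have num_vertices: "num_vertices [0..<2 * n] s = Suc n \<longleftrightarrow> \<not> has_crossing [0..<2 * n] s" if m: "s \<in> matching {..<2 * n}" for s
  proof -
    have m': "s \<in> matching (set [0..<2 * n])" using m by (simp add: lessThan_atLeast0)
    show ?thesis
      using no_crossing_nv[of "[0..<2 * n]" s n] crossing_nv_bound[of "[0..<2 * n]" s n] m' by auto
  qed
  show ?thesis
    unfolding gluings_def planar_def using iff num_vertices by (auto simp: lessThan_atLeast0)
qed

end

section \<open>Transport of the planar inequality to arbitrary words\<close>

lemma Poincare_mono: "Poincare W S K \<Longrightarrow> K \<le> K' \<Longrightarrow> Poincare W S K'"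
  unfolding Poincare_def
proof (intro allI)
  fix F assume *: "\<forall>F. pair_energy S S F \<le> K * real (card S) * edge_energy W S F" and "K \<le> K'"
  then have "K * (real (card S) * edge_energy W S F) \<le> K' * (real (card S) * edge_energy W S F)"
    by (intro mult_right_mono mult_nonneg_nonneg edge_energy_nonneg) auto
  then show "pair_energy S S F \<le> K' * real (card S) * edge_energy W S F"
    using *[rule_format, of F] by (simp add: mult.assoc)
qed

lemma sw_bij_conj:
  assumes b: "bij b" and st: "sw s t"
  shows "sw (b \<circ> s \<circ> inv b) (b \<circ> t \<circ> inv b)"
proof -
  obtain x y where xy: "x \<noteq> y" "s x \<noteq> x" "s y \<noteq> y" "s x \<noteq> y" "t = swp x y \<circ> s \<circ> swp x y"
    using st unfolding sw_def by blast
  have i: "inv b (b z) = z" for z using b by (simp add: bij_is_inj)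
  have c: "b (swp x y z) = swp (b x) (b y) (b z)" for z
    using b by (auto simp: transpose_def bij_is_inj inj_eq)
  have c': "swp x y (inv b z) = inv b (swp (b x) (b y) z)" for z
    using c[of "inv b z"] b i by (metis bij_inv_eq_iff)
  have "b \<circ> t \<circ> inv b = swp (b x) (b y) \<circ> (b \<circ> s \<circ> inv b) \<circ> swp (b x) (b y)"
    unfolding xy(5) fun_eq_iff o_apply c c' by simp
  moreover have "b x \<noteq> b y" "(b \<circ> s \<circ> inv b) (b x) \<noteq> b x" "(b \<circ> s \<circ> inv b) (b y) \<noteq> b y" "(b \<circ> s \<circ> inv b) (b x) \<noteq> b y"
    using xy i b by (auto simp: bij_is_inj inj_eq)
  ultimately show ?thesis unfolding sw_def by blast
qed

lemma Poincare_genus_zero: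
  fixes ys :: "nat list"
  assumes d: "distinct ys" and n: "length ys = 2 * n" "n \<ge> 1"
  shows "Poincare sw (gluings ys (Suc n)) (real (length ys) ^ 3)"
proof -
  have "Poincare sw (gluings [0..<2 * n] (Suc n)) (2 * real n ^ 3)"
    using Poincare_planar[OF n(2)] by (simp only: gluings_planar)
  moreover obtain b where b: "bij b" "map b [0..<2 * n] = ys"
    using ex_bij_map[of "[0..<2 * n]" ys] d n by auto
  moreover have "bij_betw (\<lambda>r. b \<circ> r \<circ> inv b) (gluings [0..<2 * n] (Suc n)) (gluings ys (Suc n))"
    using gluings_conj[OF b(1), of "[0..<2 * n]" "Suc n"] b(2) by simp
  ultimately have "Poincare sw (gluings ys (Suc n)) (2 * real n ^ 3)"
    unfolding Poincare_def[of sw "gluings ys (Suc n)"]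
    using Poincare_image[OF _ finite_dg order.refl, of _ _ ys "Suc n" sw _ sw] sw_bij_conj[OF b(1)]
    by (metis (no_types, lifting) mult_nonneg_nonneg of_nat_0_le_iff zero_le_numeral zero_le_power)
  moreover have "2 * real n ^ 3 \<le> real (length ys) ^ 3"
    using n by (simp add: power_mult_distrib)
  ultimately show ?thesis by (rule Poincare_mono)
qed

section \<open>Induction on the genus\<close>

text \<open>Below the maximal number of vertices every gluing has a crossing, hence lies in some
  class.\<close>

lemma gluings_cover:
  assumes d: "distinct xs" and n: "length xs = 2 * n" and v: "v \<noteq> Suc n"
  shows "gluings xs v = (\<Union>p\<in>crossing_quads xs. with_crossing xs v p)"
proof (intro subset_antisym subsetI)
  fix s assume s: "s \<in> gluings xs v"
  then have "has_crossing xs s" using no_crossing_nv[OF d _ n, of s] v by (auto simp: gluings_def)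
  then obtain A p1 B p2 C D E where xs: "xs = A @ p1 # B @ p2 # C @ s p1 # D @ s p2 # E"
    by (rule crossing_rotation)
  then have "rotate 0 xs = A @ p1 # B @ p2 # C @ s p1 # D @ s p2 # E" by simp
  from rotate_append_rotate[OF this] have "conf xs p1 B p2 C (s p1) D (s p2) (E @ A)"
    by (simp add: conf_def)
  then have "(p1, p2, s p1, s p2) \<in> crossing_quads xs" by (rule crossing_quadsI)
  moreover have "s \<in> with_crossing xs v (p1, p2, s p1, s p2)" using s by (simp add: with_crossing_def)
  ultimately show "s \<in> (\<Union>p\<in>crossing_quads xs. with_crossing xs v p)" by blast
next
  fix s assume "s \<in> (\<Union>p\<in>crossing_quads xs. with_crossing xs v p)"
  then show "s \<in> gluings xs v" by (auto simp: with_crossing_def split: prod.splits)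
qed

lemma crossing_quads_subset:
  assumes "distinct xs"
  shows "crossing_quads xs \<subseteq> set xs \<times> set xs \<times> set xs \<times> set xs"
proof
  fix p assume "p \<in> crossing_quads xs"
  then obtain p1 p2 p3 p4 B C D E where "p = (p1, p2, p3, p4)" "conf xs p1 B p2 C p3 D p4 E"
    unfolding crossing_quads_def by blast
  then show "p \<in> set xs \<times> set xs \<times> set xs \<times> set xs"
    using conf_facts(4)[of xs p1 B p2 C p3 D p4 E] assms by auto
qed

lemma finite_quads: "distinct xs \<Longrightarrow> finite (crossing_quads xs)"
  using crossing_quads_subset by (rule finite_subset) auto

lemma card_quads:
  assumes "distinct xs"
  shows "card (crossing_quads xs) \<le> length xs ^ 4"
proof -
  have "card (crossing_quads xs) \<le> card (set xs \<times> set xs \<times> set xs \<times> set xs)"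
    using crossing_quads_subset[OF assms] by (rule card_mono[rotated]) auto
  also have "\<dots> = length xs ^ 4"
    using assms by (simp add: card_cartesian_product distinct_card eval_nat_numeral)
  finally show ?thesis .
qed

text \<open>A swap in the core moves none of the four letters of the crossing pair, so its
  transposition commutes with both crossing chords.\<close>

lemma sw_core:
  assumes c: "conf xs p1 B p2 C p3 D p4 E" and d: "distinct xs"
    and r: "r \<in> gluings (D @ C @ B @ E) v" and sw: "sw r r'"
  shows "sw (swp p1 p3 \<circ> swp p2 p4 \<circ> r) (swp p1 p3 \<circ> swp p2 p4 \<circ> r')"
proof -
  let ?S = "set (D @ C @ B @ E)"
  note f = conf_facts(1)[OF c d]
  from sw obtain x y where xy: "x \<noteq> y" "r x \<noteq> x" "r y \<noteq> y" "r x \<noteq> y" and r': "r' = swp x y \<circ> r \<circ> swp x y"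
    unfolding sw_def by blast
  have m: "r \<in> matching ?S" using r by (simp add: gluings_def)
  have S: "x \<in> ?S" "y \<in> ?S" "r x \<in> ?S" "r y \<in> ?S" using m xy unfolding matching_def by blast+
  have p: "z \<in> ?S \<Longrightarrow> z \<noteq> p1 \<and> z \<noteq> p2 \<and> z \<noteq> p3 \<and> z \<noteq> p4" for z using f by auto
  have fix_: "(swp p1 p3 \<circ> swp p2 p4 \<circ> r) z = r z" if "r z \<in> ?S" for z
    using p[OF that] by simp
  have t: "swp x y p1 = p1" "swp x y p2 = p2" "swp x y p3 = p3" "swp x y p4 = p4"
    using p[OF S(1)] p[OF S(2)] by auto
  have "swp p1 p3 \<circ> swp p2 p4 \<circ> r' = swp x y \<circ> (swp p1 p3 \<circ> swp p2 p4 \<circ> r) \<circ> swp x y"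
    unfolding r' comp_assoc comp_swp_assoc[OF bij_transpose, of x y p1 p3]
      comp_swp_assoc[OF bij_transpose, of x y p2 p4] t by (rule refl)
  then show ?thesis
    unfolding sw_def using xy S(3,4) fix_ by metis
qed

text \<open>Each class inherits the constant \<open>K\<close> of its core word, links compare
  neighbouring classes, and the connected cover extends the comparison to all pairs. The bound
  \<open>v + 1 \<le> n\<close> excludes genus 0, so that the classes do cover.\<close>

lemma Poincare_step:
  fixes xs :: "nat list"
  assumes d: "distinct xs" and n: "length xs = 2 * n" and v: "v \<ge> 2" "v + 1 \<le> n"
    and K: "K \<ge> 1" and IH: "\<And>ys :: nat list. distinct ys \<Longrightarrow> length ys + 4 = length xs \<Longrightarrow> Poincare sw (gluings ys v) K"
  shows "Poincare sw (gluings xs v) (36 * real (length xs) ^ 26 * K)"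
  unfolding Poincare_def
proof
  fix F
  let ?m = "length xs" and ?D = "edge_energy sw (gluings xs v) F"
  have m: "?m \<ge> 6" using v n by simp
  define N where "N = card (gluings (drop 4 xs) v)"
  have N: "card (gluings ys v) = N" if "distinct ys" "length ys + 4 = ?m" for ys :: "nat list"
    unfolding N_def using that d m by (intro card_dg_eq) auto
  have cO: "card (with_crossing xs v p) = N" if "p \<in> crossing_quads xs" for p
    using that card_Om[OF d m v(1) N] unfolding crossing_quads_def by blast
  have cover: "gluings xs v = (\<Union>p\<in>crossing_quads xs. with_crossing xs v p)" using gluings_cover[OF d n] v by simp
  have sub: "with_crossing xs v p \<subseteq> gluings xs v" if "p \<in> crossing_quads xs" for p using that cover by blast
  have self: "pair_energy (with_crossing xs v p) (with_crossing xs v p) F \<le> K * real N * ?D" if pq: "p \<in> crossing_quads xs" for p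
  proof -
    obtain p1 p2 p3 p4 B C D E where p: "p = (p1, p2, p3, p4)" and c: "conf xs p1 B p2 C p3 D p4 E"
      using pq unfolding crossing_quads_def by blast
    have "distinct (D @ C @ B @ E)" "length (D @ C @ B @ E) + 4 = ?m"
      using conf_facts(1,3)[OF c d] by auto
    then have po: "Poincare sw (gluings (D @ C @ B @ E) v) K" by (rule IH)
    have "pair_energy (with_crossing xs v p) (with_crossing xs v p) F \<le> K * real (card (with_crossing xs v p)) * ?D"
      unfolding p
    proof (rule Poincare_image[OF with_crossing_core[OF c d, of v] finite_dg _ po])
      show "with_crossing xs v (p1, p2, p3, p4) \<subseteq> gluings xs v" using sub pq p by simp
    qed (use sw_core[OF c d] K in auto)
    then show ?thesis using cO[OF pq] by simp
  qed
  have link: "pair_energy (with_crossing xs v p) (with_crossing xs v q) F \<le> (9 * K * real ?m ^ 2 * ?D) * real N" if pq: "(p, q) \<in> link xs v N" for p q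
  proof -
    obtain A j where A: "p \<in> crossing_quads xs" "q \<in> crossing_quads xs" "A \<subseteq> with_crossing xs v p" "inj_on j A" "j ` A \<subseteq> with_crossing xs v q"
      "\<forall>z\<in>A. j z = z \<or> sw z (j z)" "N \<le> ?m ^ 2 * card A"
      using pq unfolding link_def by blast
    have L: "real N \<le> real ?m ^ 2 * real (card A)"
      using A(7) by (metis of_nat_le_iff of_nat_mult of_nat_power)
    have "pair_energy (with_crossing xs v p) (with_crossing xs v q) F \<le> 9 * K * real ?m ^ 2 * real N * ?D"
      using A(6) by (intro pair_energy_link[OF finite_dg sub[OF A(1)] sub[OF A(2)] cO[OF A(1)] cO[OF A(2)] A(3-5) _ L K
        self[OF A(1)] self[OF A(2)]]) auto
    then show ?thesis by (simp add: mult_ac)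
  qed
  have "pair_energy (gluings xs v) (gluings xs v) F \<le> 4 * real (?m ^ 4) ^ 6 * (9 * K * real ?m ^ 2 * ?D) * real (card (gluings xs v))"
  proof (rule Poincare_union[OF finite_dg finite_quads[OF d] cover cO _ link])
    show "link xs v N \<subseteq> crossing_quads xs \<times> crossing_quads xs" by (auto simp: link_def)
    show "pair_energy (with_crossing xs v p) (with_crossing xs v p) F \<le> 9 * K * real ?m ^ 2 * ?D * real N" if "p \<in> crossing_quads xs" for p
    proof -
      have "1 * (K * real N * ?D) \<le> (9 * real ?m ^ 2) * (K * real N * ?D)"
      proof (rule mult_right_mono)
        have "1 \<le> real ?m ^ 2" using m by (intro one_le_power) simp
        then show "1 \<le> 9 * real ?m ^ 2" by simp
      qed (use K edge_energy_nonneg[of sw "gluings xs v" F] in simp)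
      then show ?thesis using self[OF that] by (simp add: mult_ac)
    qed
    show "(p, q) \<in> (link xs v N)\<^sup>*" if "p \<in> crossing_quads xs" "q \<in> crossing_quads xs" for p q
      using that n by (intro crossing_quads_connected[OF d m v(1) N]) auto
    show "card (crossing_quads xs) \<le> ?m ^ 4" using card_quads[OF d] .
    show "1 \<le> ?m ^ 4" using m by (intro one_le_power) simp
    show "0 \<le> 9 * K * real ?m ^ 2 * ?D" using K edge_energy_nonneg[of sw "gluings xs v" F] by simp
  qed
  \<comment> \<open>The number of quadruples is at most \<open>m^4\<close> with
    \<open>m = length xs\<close>, which gives \<open>m^24\<close>; the remaining
    \<open>9 m^2\<close> is the cost of one link.\<close>
  also have "\<dots> = 36 * (real ?m ^ 24 * real ?m ^ 2) * K * real (card (gluings xs v)) * ?D"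
    by (simp add: power_mult[symmetric] mult_ac)
  also have "real ?m ^ 24 * real ?m ^ 2 = real ?m ^ 26" by (simp add: power_add[symmetric])
  finally show "pair_energy (gluings xs v) (gluings xs v) F \<le> 36 * real ?m ^ 26 * K * real (card (gluings xs v)) * ?D" .
qed

lemma Poincare_all:
  fixes xs :: "nat list"
  assumes "distinct xs" "length xs = 2 * n" "v + 2 * g = n + 1" "v \<ge> 2"
  shows "Poincare sw (gluings xs v) (real (length xs) ^ (28 * g + 3))"
  using assms
proof (induction g arbitrary: xs n)
  case 0
  then show ?case using Poincare_genus_zero[of xs n] by simp
next
  case (Suc g)
  have m: "length xs \<ge> 6" using Suc.prems by simp
  have v: "v + 1 \<le> n" using Suc.prems by simp
  let ?K = "real (length xs) ^ (28 * g + 3)"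
  have "Poincare sw (gluings ys v) ?K" if ys: "distinct ys" "length ys + 4 = length xs" for ys :: "nat list"
  proof -
    have "Poincare sw (gluings ys v) (real (length ys) ^ (28 * g + 3))"
      using ys Suc.prems by (intro Suc.IH[of ys "n - 2"]) auto
    moreover have "real (length ys) ^ (28 * g + 3) \<le> ?K"
      using ys by (intro power_mono) auto
    ultimately show ?thesis by (rule Poincare_mono)
  qed
  moreover have "?K \<ge> 1" using m by (intro one_le_power) simp
  ultimately have "Poincare sw (gluings xs v) (36 * real (length xs) ^ 26 * ?K)"
    by (intro Poincare_step[OF Suc.prems(1,2,4) v]) auto
  moreover have "36 * real (length xs) ^ 26 * ?K \<le> real (length xs) ^ (28 * Suc g + 3)"
  proof -
    \<comment> \<open>At least six letters are present, so the constant 36 is absorbed by two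
      further powers of the length; this is the step from 26 to 28.\<close>
    have "6 ^ 2 \<le> real (length xs) ^ 2" using m by (intro power_mono) auto
    then have "36 * (real (length xs) ^ 26 * ?K) \<le> real (length xs) ^ 2 * (real (length xs) ^ 26 * ?K)"
      by (intro mult_right_mono) auto
    also have "\<dots> = real (length xs) ^ (28 * Suc g + 3)"
      by (simp add: power_add[symmetric])
    finally show ?thesis by (simp add: mult.assoc)
  qed
  ultimately show ?case by (rule Poincare_mono)
qed

section \<open>Existence of gluings\<close>

lemma gluings_nonempty:
  fixes xs :: "nat list"
  assumes "distinct xs" "length xs = 2 * n" "v + 2 * g = n + 1" "v \<ge> 1"
  shows "gluings xs v \<noteq> {}"
  using assms
proof (induction n arbitrary: xs v g rule: less_induct)
  case (less n)
  show ?case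
  proof (cases "g = 0")
    case True
    show ?thesis
    proof (cases "n = 0")
      case True
      then have "id \<in> gluings xs v" using less.prems \<open>g = 0\<close> by (simp add: gluings_def matching_def num_vertices_def)
      then show ?thesis by blast
    next
      case False
      then obtain x y B where xs: "xs = x # y # B" using less.prems(2)
        by (cases xs rule: remdups_adj.cases) auto
      have "gluings B n \<noteq> {}" using less.prems xs False True by (intro less.IH[of "n - 1" B n 0]) auto
      then obtain r where "r \<in> gluings B n" by blast
      from gluings_leaf_mem(1)[OF _ this, of x y] show ?thesis
        using less.prems xs True by auto
    qed
  next
    case False
    then have n: "n \<ge> 2" using less.prems by simp
    then have "length xs \<ge> 4" using less.prems by simp
    then obtain a b c e E where xs: "xs = a # b # c # e # E"
      by (cases xs; cases "tl xs"; cases "tl (tl xs)"; cases "tl (tl (tl xs))") auto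
    have "gluings E v \<noteq> {}" using less.prems xs False n by (intro less.IH[of "n - 2" E v "g - 1"]) auto
    \<comment> \<open>The first four letters become a crossing pair with empty arcs
      \<open>B\<close>, \<open>C\<close>, \<open>D\<close>, so the core word is \<open>E\<close>
      itself.\<close>
    then obtain r where "r \<in> gluings ([] @ [] @ [] @ E) v" by auto
    from gluings_crossing_mem(1)[OF _ this, of a b c e] show ?thesis
      using less.prems xs by auto
  qed
qed

text \<open>The first letter is matched with the third in one gluing and with the fourth in the
  other. Two states are what gives the second eigenvalue a meaning.\<close>

lemma gluings_card_ge_2:
  fixes xs :: "nat list"
  assumes d: "distinct xs" and n: "length xs = 2 * n" and v: "v + 2 * g = n + 1" "v \<ge> 2" "g \<ge> 1"
  shows "card (gluings xs v) \<ge> 2"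
proof -
  have "length xs \<ge> 6" using n v by simp
  then obtain a b c e f E where xs: "xs = a # b # c # e # f # E"
    by (cases xs; cases "tl xs"; cases "tl (tl xs)"; cases "tl (tl (tl xs))"; cases "tl (tl (tl (tl xs)))") auto
  have core: "gluings ys v \<noteq> {}" if "distinct ys" "length ys = 2 * (n - 2)" for ys :: "nat list"
    using v n by (intro gluings_nonempty[OF that, of v "g - 1"]) simp_all
  have ne: "gluings (f # E) v \<noteq> {}" "gluings (c # E) v \<noteq> {}"
    using d n xs core[of "f # E"] core[of "c # E"] by simp_all
  obtain r where r: "r \<in> gluings ([] @ [] @ [] @ (f # E)) v" using ne by auto
  obtain r' where r': "r' \<in> gluings ([] @ [c] @ [] @ E) v" using ne by auto
  have "distinct (a # [] @ b # [] @ c # [] @ e # (f # E))" using d xs by simp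
  from gluings_crossing_mem[OF this r] obtain s where s: "s \<in> gluings xs v" "s a = c" using xs by auto
  have "distinct (a # [] @ b # [c] @ e # [] @ f # E)" using d xs by simp
  from gluings_crossing_mem[OF this r'] obtain s' where s': "s' \<in> gluings xs v" "s' a = e" using xs by auto
  have "s \<noteq> s'" using s s' d xs by auto
  then have "card {s, s'} = 2" by simp
  moreover have "card {s, s'} \<le> card (gluings xs v)" using s s' by (intro card_mono finite_dg) auto
  ultimately show ?thesis by simp
qed

section \<open>The second eigenvalue\<close>

text \<open>At a centred eigenvector both sides of the gap inequality are explicit multiples of the
  squared norm, and the norm cancels.\<close>

lemma eigen_mean_zero_bound:
  fixes a :: "nat \<Rightarrow> nat \<Rightarrow> real" and f :: "nat \<Rightarrow> real"
  assumes sym: "\<And>i j. i < N \<Longrightarrow> j < N \<Longrightarrow> a i j = a j i"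
    and row: "\<And>i. i < N \<Longrightarrow> (\<Sum>j<N. a i j) = 1"
    and gap: "\<kappa> * (\<Sum>i<N. \<Sum>j<N. (f i - f j)\<^sup>2) \<le> real N * (\<Sum>i<N. \<Sum>j<N. a i j * (f i - f j)\<^sup>2)"
    and eig: "\<And>i. i < N \<Longrightarrow> (\<Sum>j<N. a i j * f j) = \<mu> * f i"
    and z: "(\<Sum>i<N. f i) = 0" and nz: "i0 < N" "f i0 \<noteq> 0"
  shows "\<kappa> \<le> 1 - \<mu>"
proof -
  let ?n = "\<Sum>i<N. (f i)\<^sup>2"
  have npos: "?n > 0" using nz by (intro sum_pos2[where i = i0]) auto
  have "(\<Sum>i<N. \<Sum>j<N. (f i - f j)\<^sup>2) = (\<Sum>i<N. \<Sum>j<N. (f i)\<^sup>2 + (f j)\<^sup>2 - 2 * f i * f j)"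
    by (intro sum.cong refl) (simp add: power2_eq_square algebra_simps)
  also have "\<dots> = 2 * real N * ?n - 2 * ((\<Sum>i<N. f i) * (\<Sum>j<N. f j))"
    by (simp add: sum.distrib sum_subtractf sum_distrib_left sum_distrib_right mult_ac)
  finally have 1: "(\<Sum>i<N. \<Sum>j<N. (f i - f j)\<^sup>2) = 2 * real N * ?n" using z by simp
  have s1: "(\<Sum>i<N. \<Sum>j<N. a i j * (f i)\<^sup>2) = ?n"
    using row by (simp add: sum_distrib_right[symmetric])
  have "(\<Sum>i<N. \<Sum>j<N. a i j * (f j)\<^sup>2) = (\<Sum>j<N. \<Sum>i<N. a i j * (f j)\<^sup>2)" by (rule sum.swap)
  also have "\<dots> = (\<Sum>j<N. \<Sum>i<N. a j i * (f j)\<^sup>2)" using sym by (intro sum.cong refl) auto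
  finally have s2: "(\<Sum>i<N. \<Sum>j<N. a i j * (f j)\<^sup>2) = ?n" using s1 by simp
  have s3: "(\<Sum>i<N. \<Sum>j<N. a i j * (f i * f j)) = \<mu> * ?n"
  proof -
    have "(\<Sum>j<N. a i j * (f i * f j)) = \<mu> * (f i)\<^sup>2" if "i < N" for i
    proof -
      have "(\<Sum>j<N. a i j * (f i * f j)) = f i * (\<Sum>j<N. a i j * f j)"
        by (simp add: sum_distrib_left mult_ac)
      then show ?thesis using eig[OF that] by (simp add: power2_eq_square)
    qed
    then show ?thesis by (simp add: sum_distrib_left)
  qed
  have "(\<Sum>i<N. \<Sum>j<N. a i j * (f i - f j)\<^sup>2)
     = (\<Sum>i<N. \<Sum>j<N. a i j * (f i)\<^sup>2 + a i j * (f j)\<^sup>2 - 2 * (a i j * (f i * f j)))"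
    by (intro sum.cong refl) (simp add: power2_eq_square algebra_simps)
  also have "\<dots> = ?n + ?n - 2 * (\<mu> * ?n)"
    using s1 s2 s3 by (simp add: sum.distrib sum_subtractf sum_distrib_left[symmetric])
  finally have 2: "(\<Sum>i<N. \<Sum>j<N. a i j * (f i - f j)\<^sup>2) = 2 * (1 - \<mu>) * ?n" by (simp add: algebra_simps)
  have "real N > 0" using nz by simp
  have "\<kappa> * (2 * real N * ?n) \<le> real N * (2 * (1 - \<mu>) * ?n)"
    using gap unfolding 1 2 .
  then have "(2 * real N * ?n) * \<kappa> \<le> (2 * real N * ?n) * (1 - \<mu>)"
    by (simp only: mult_ac)
  then show ?thesis using npos \<open>real N > 0\<close> by (simp add: mult_le_cancel_left_pos)
qed

context
  fixes a :: "nat \<Rightarrow> nat \<Rightarrow> real" and N :: nat and \<kappa> :: real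
  assumes sym: "\<And>i j. i < N \<Longrightarrow> j < N \<Longrightarrow> a i j = a j i"
    and row: "\<And>i. i < N \<Longrightarrow> (\<Sum>j<N. a i j) = 1"
    and gap: "\<And>f. \<kappa> * (\<Sum>i<N. \<Sum>j<N. (f i - f j)\<^sup>2) \<le> real N * (\<Sum>i<N. \<Sum>j<N. a i j * (f i - f j)\<^sup>2)"
    and kappa: "\<kappa> > 0" and N2: "N \<ge> 2"
begin

definition Am :: "real mat" where "Am = mat N N (\<lambda>(i, j). a i j)"

text \<open>The matrix \<open>Am\<close> acting on the quotient of the space by the constant vectors, with coordinates \<open>1, \<dots>, N - 1\<close>.\<close>

definition Rm :: "real mat" where
  "Rm = mat (N - 1) (N - 1) (\<lambda>(i, j). a (Suc i) (Suc j) - a 0 (Suc j))"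

lemma Am_carrier: "Am \<in> carrier_mat N N" and Rm_carrier: "Rm \<in> carrier_mat (N - 1) (N - 1)"
  by (simp_all add: Am_def Rm_def)

lemma mult_vec_index: "i < N \<Longrightarrow> w \<in> carrier_vec N \<Longrightarrow> (Am *\<^sub>v w) $ i = (\<Sum>j<N. a i j * w $ j)"
  by (simp add: Am_def scalar_prod_def lessThan_atLeast0)

lemma sum_invariant:
  fixes f :: "nat \<Rightarrow> real"
  shows "(\<Sum>i<N. \<Sum>j<N. a i j * f j) = (\<Sum>j<N. f j)"
proof -
  have "(\<Sum>i<N. \<Sum>j<N. a i j * f j) = (\<Sum>j<N. \<Sum>i<N. a i j * f j)" by (rule sum.swap)
  also have "\<dots> = (\<Sum>j<N. (\<Sum>i<N. a j i) * f j)"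
    unfolding sum_distrib_right using sym by (intro sum.cong refl) auto
  finally show ?thesis using row by simp
qed

lemma eigen_gap:
  fixes f :: "nat \<Rightarrow> real"
  assumes eig: "\<And>i. i < N \<Longrightarrow> (\<Sum>j<N. a i j * f j) = \<mu> * f i" and nz: "i0 < N" "f i0 \<noteq> 0" and mu: "\<mu> \<noteq> 1"
  shows "\<mu> \<le> 1 - \<kappa>"
proof -
  have "\<mu> * (\<Sum>i<N. f i) = (\<Sum>i<N. f i)"
    using sum_invariant[of f] eig by (simp add: sum_distrib_left)
  then have "(\<Sum>i<N. f i) = 0" using mu by simp
  from eigen_mean_zero_bound[OF sym row gap eig this nz] show ?thesis by simp
qed

text \<open>A nonconstant fixed vector stays a fixed vector after centring, and then the gap
  inequality would give \<open>\<kappa> \<le> 0\<close>.\<close>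

lemma fixed_const:
  fixes f :: "nat \<Rightarrow> real"
  assumes eig: "\<And>i. i < N \<Longrightarrow> (\<Sum>j<N. a i j * f j) = f i" and i: "i < N"
  shows "f i = f 0"
proof (rule ccontr)
  assume ne: "f i \<noteq> f 0"
  define c where "c = (\<Sum>j<N. f j) / real N"
  define g where "g j = f j - c" for j
  have N0: "real N > 0" using N2 by simp
  have z: "(\<Sum>j<N. g j) = 0" using N0 by (simp add: g_def sum_subtractf c_def)
  have eg: "(\<Sum>j<N. a k j * g j) = 1 * g k" if "k < N" for k
    using eig[OF that] row[OF that] by (simp add: g_def right_diff_distrib sum_subtractf sum_distrib_right[symmetric])
  have "g i \<noteq> 0 \<or> g 0 \<noteq> 0" using ne by (auto simp: g_def)
  then obtain k where k: "k < N" "g k \<noteq> 0" using i by (cases "g i = 0") auto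
  have "\<kappa> \<le> 1 - 1"
    by (rule eigen_mean_zero_bound[OF sym row gap eg z k])
  then show False using kappa by simp
qed

text \<open>\<open>P\<close> replaces the first basis vector by the constant vector, which
  \<open>Am\<close> fixes, so the conjugated matrix is block triangular with blocks 1 and
  \<open>Rm\<close>. Splitting the characteristic polynomial keeps track of algebraic multiplicity,
  on which the list of eigenvalues is based.\<close>

lemma char_poly_Am: "char_poly Am = [:-1, 1:] * char_poly Rm"
proof -
  define P where "P = mat N N (\<lambda>(i, j). if i = j \<or> j = 0 then 1 else 0 :: real)"
  define Q where "Q = mat N N (\<lambda>(i, j). if i = j then 1 else if j = 0 then - 1 else 0 :: real)"
  define R where "R = mat 1 (N - 1) (\<lambda>(i, j). a 0 (Suc j))"
  define B where "B = four_block_mat (1\<^sub>m 1) R (0\<^sub>m (N - 1) 1) Rm"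
  have PQ: "P \<in> carrier_mat N N" "Q \<in> carrier_mat N N" by (simp_all add: P_def Q_def)
  have B: "B \<in> carrier_mat N N"
    using N2 by (auto simp: B_def R_def Rm_def)
  have mulP: "(M * P) $$ (i, j) = (if j = 0 then (\<Sum>k<N. M $$ (i, k)) else M $$ (i, j))"
    if M: "M \<in> carrier_mat N N" and ij: "i < N" "j < N" for M i j
  proof -
    have "(M * P) $$ (i, j) = (\<Sum>k<N. M $$ (i, k) * (if k = j \<or> j = 0 then 1 else 0))"
      using M ij by (simp add: P_def scalar_prod_def lessThan_atLeast0)
    also have "\<dots> = (if j = 0 then (\<Sum>k<N. M $$ (i, k)) else M $$ (i, j))"
    proof (cases "j = 0")
      case False
      have "(\<Sum>k<N. M $$ (i, k) * (if k = j \<or> j = 0 then 1 else 0)) = (\<Sum>k<N. if k = j then M $$ (i, k) else 0)"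
        using False by (intro sum.cong refl) auto
      then show ?thesis using False ij by simp
    qed simp
    finally show ?thesis .
  qed
  have mulQ: "(Q * M) $$ (i, j) = M $$ (i, j) - (if i = 0 then 0 else M $$ (0, j))"
    if M: "M \<in> carrier_mat N N" and ij: "i < N" "j < N" for M i j
  proof -
    have N0: "0 < N" using N2 by simp
    have "(Q * M) $$ (i, j) = (\<Sum>k<N. (if i = k then 1 else if k = 0 then - 1 else 0) * M $$ (k, j))"
      using M ij by (simp add: Q_def scalar_prod_def lessThan_atLeast0)
    also have "\<dots> = (\<Sum>k<N. (if k = i then M $$ (k, j) else 0) - (if k = 0 then (if i = 0 then 0 else M $$ (0, j)) else 0))"
      by (intro sum.cong refl) auto
    also have "\<dots> = M $$ (i, j) - (if i = 0 then 0 else M $$ (0, j))"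
      using ij N0 by (simp add: sum_subtractf)
    finally show ?thesis .
  qed
  have QP: "Q * P = 1\<^sub>m N"
  proof (rule eq_matI)
    fix i j assume "i < dim_row (1\<^sub>m N :: real mat)" "j < dim_col (1\<^sub>m N :: real mat)"
    then have ij: "i < N" "j < N" by auto
    have "P $$ (i, j) = (if i = j \<or> j = 0 then 1 else 0)" "P $$ (0, j) = (if j = 0 then 1 else 0)"
      using ij N2 by (auto simp: P_def)
    then show "(Q * P) $$ (i, j) = 1\<^sub>m N $$ (i, j)"
      unfolding mulQ[OF PQ(1) ij] using ij by auto
  qed (use PQ in auto)
  have PQ1: "P * Q = 1\<^sub>m N" using mat_mult_left_right_inverse[OF PQ(2,1) QP] .
  have AP: "Am * P \<in> carrier_mat N N" using Am_carrier PQ by auto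
  have QAP: "Q * (Am * P) = B"
  proof (rule eq_matI)
    fix i j assume "i < dim_row B" "j < dim_col B"
    then have ij: "i < N" "j < N" using B by auto
    have e: "(Am * P) $$ (k, j) = (if j = 0 then 1 else a k j)" if "k < N" for k
      unfolding mulP[OF Am_carrier that ij(2)] using row[OF that] that ij by (simp add: Am_def)
    show "(Q * (Am * P)) $$ (i, j) = B $$ (i, j)"
      unfolding mulQ[OF AP ij] using e[OF ij(1)] e[of 0] N2 ij
      by (cases i; cases j) (auto simp: B_def R_def Rm_def)
  qed (use PQ B in auto)
  have "P * B * Q = P * (Q * (Am * P)) * Q" by (simp add: QAP)
  also have "\<dots> = (P * Q) * (Am * P) * Q"
    using assoc_mult_mat[OF PQ AP] by simp
  also have "\<dots> = Am * P * Q" by (simp only: PQ1 left_mult_one_mat[OF AP])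
  also have "\<dots> = Am * (P * Q)" using assoc_mult_mat[OF Am_carrier PQ] .
  also have "\<dots> = Am" using Am_carrier by (simp add: PQ1)
  finally have "Am = P * B * Q" by simp
  then have "similar_mat Am B"
    unfolding similar_mat_def similar_mat_wit_def Let_def
    using Am_carrier B PQ PQ1 QP by (intro exI[of _ P] exI[of _ Q]) auto
  then have "char_poly Am = char_poly B" by (rule char_poly_similar)
  also have "\<dots> = char_poly (1\<^sub>m 1) * char_poly Rm"
    unfolding B_def by (rule char_poly_four_block_zeros_col) (auto simp: R_def Rm_def)
  also have "char_poly (1\<^sub>m 1 :: real mat) = [:-1, 1:]"
    by (subst char_poly_upper_triangular[of _ 1]) (auto simp: diag_mat_def)
  finally show ?thesis .
qed

text \<open>The eigenvalue 1 of \<open>Am\<close> is algebraically simple: a fixed vector of the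
  quotient lifts to \<open>f\<close> with \<open>A f = f + c\<close>. Since \<open>A\<close>
  preserves sums, \<open>c = 0\<close>, so \<open>f\<close> is constant, and it vanishes because its
  coordinate 0 does.\<close>

lemma Rm_root_ne_1: "poly (char_poly Rm) 1 \<noteq> 0"
proof
  assume "poly (char_poly Rm) 1 = 0"
  then obtain w where w: "eigenvector Rm w 1"
    using eigenvalue_root_char_poly[OF Rm_carrier, of 1] by (auto simp: eigenvalue_def)
  then have wc: "w \<in> carrier_vec (N - 1)" "w \<noteq> 0\<^sub>v (N - 1)" "Rm *\<^sub>v w = w"
    using Rm_carrier by (auto simp: eigenvector_def)
  define f where "f i = (if i = 0 then 0 else w $ (i - 1))" for i
  define c where "c = (\<Sum>j<N. a 0 j * f j)"
  have split: "(\<Sum>j<N. a i j * f j) = (\<Sum>j<N - 1. a i (Suc j) * w $ j)" for i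
  proof -
    have "(\<Sum>j<N. a i j * f j) = (\<Sum>j<Suc (N - 1). a i j * f j)" using N2 by simp
    also have "\<dots> = a i 0 * f 0 + (\<Sum>j<N - 1. a i (Suc j) * f (Suc j))" by (rule sum.lessThan_Suc_shift)
    finally show ?thesis by (simp add: f_def)
  qed
  have fc: "(\<Sum>j<N. a i j * f j) = f i + c" if i: "i < N" for i
  proof (cases i)
    case 0
    then show ?thesis by (simp add: c_def f_def)
  next
    case (Suc k)
    then have k: "k < N - 1" using i by simp
    have "(Rm *\<^sub>v w) $ k = (\<Sum>j<N - 1. (a (Suc k) (Suc j) - a 0 (Suc j)) * w $ j)"
      using k wc(1) by (simp add: Rm_def scalar_prod_def lessThan_atLeast0)
    also have "\<dots> = (\<Sum>j<N. a i j * f j) - c"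
      unfolding c_def split Suc by (simp add: left_diff_distrib sum_subtractf)
    finally show ?thesis using wc(3) Suc by (simp add: f_def)
  qed
  have "(\<Sum>i<N. f i + c) = (\<Sum>i<N. f i)" using sum_invariant[of f] fc by simp
  then have c0: "c = 0" using N2 by (simp add: sum.distrib)
  have "f i = f 0" if "i < N" for i
    using fc c0 by (intro fixed_const[OF _ that]) simp
  then have "w $ k = 0" if "k < N - 1" for k using that by (metis Suc_less_eq Suc_pred' f_def diff_Suc_1 gr0I less_diff_conv add.commute plus_1_eq_Suc nat.distinct(1))
  then have "w = 0\<^sub>v (N - 1)" using wc(1) by (intro eq_vecI) auto
  then show False using wc(2) by simp
qed

lemma root_gap:
  assumes "poly (char_poly Rm) \<mu> = 0"
  shows "\<mu> \<le> 1 - \<kappa>"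
proof -
  have mu: "\<mu> \<noteq> 1" using assms Rm_root_ne_1 by auto
  have "poly (char_poly Am) \<mu> = 0" using assms by (simp add: char_poly_Am)
  then obtain w where "eigenvector Am w \<mu>"
    using eigenvalue_root_char_poly[OF Am_carrier] by (auto simp: eigenvalue_def)
  then have w: "w \<in> carrier_vec N" "w \<noteq> 0\<^sub>v N" "Am *\<^sub>v w = \<mu> \<cdot>\<^sub>v w"
    using Am_carrier by (auto simp: eigenvector_def)
  have "\<exists>i<N. w $ i \<noteq> 0"
  proof (rule ccontr)
    assume "\<not> ?thesis"
    then have "w = 0\<^sub>v N" using w(1) by (intro eq_vecI) auto
    then show False using w(2) by simp
  qed
  then obtain i0 where i0: "i0 < N" "w $ i0 \<noteq> 0" by blast
  have "(\<Sum>j<N. a i j * w $ j) = \<mu> * w $ i" if "i < N" for i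
    using mult_vec_index[OF that w(1)] w(1,3) that by simp
  from eigen_gap[OF this i0 mu] show ?thesis .
qed

text \<open>By symmetry the Hermitian form at an eigenvector equals its conjugate, and it is
  \<open>z\<close> times a positive number.\<close>

lemma complex_root_real:
  assumes "poly (map_poly complex_of_real (char_poly Am)) z = 0"
  shows "z \<in> \<real>"
proof -
  let ?A = "map_mat complex_of_real Am"
  have A: "?A \<in> carrier_mat N N" using Am_carrier by simp
  have "poly (char_poly ?A) z = 0"
    using assms of_real_hom.char_poly_hom[OF Am_carrier] by metis
  then obtain w where "eigenvector ?A w z"
    using eigenvalue_root_char_poly[OF A] by (auto simp: eigenvalue_def)
  then have w: "w \<in> carrier_vec N" "w \<noteq> 0\<^sub>v N" "?A *\<^sub>v w = z \<cdot>\<^sub>v w"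
    using Am_carrier by (auto simp: eigenvector_def)
  have eig: "(\<Sum>j<N. complex_of_real (a i j) * w $ j) = z * w $ i" if i: "i < N" for i
  proof -
    have "(?A *\<^sub>v w) $ i = (\<Sum>j<N. complex_of_real (a i j) * w $ j)"
      using i w(1) by (simp add: Am_def scalar_prod_def lessThan_atLeast0)
    then show ?thesis using w i by simp
  qed
  let ?s = "\<Sum>i<N. \<Sum>j<N. complex_of_real (a i j) * w $ j * cnj (w $ i)"
  let ?n = "\<Sum>i<N. (cmod (w $ i))\<^sup>2"
  have "?s = (\<Sum>i<N. z * w $ i * cnj (w $ i))"
    using eig by (intro sum.cong refl) (simp add: sum_distrib_right[symmetric])
  also have "\<dots> = z * complex_of_real ?n"
    by (simp add: sum_distrib_left mult.assoc complex_norm_square del: of_real_power)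
  finally have s: "?s = z * complex_of_real ?n" .
  have "cnj ?s = (\<Sum>i<N. \<Sum>j<N. complex_of_real (a i j) * cnj (w $ j) * w $ i)" by simp
  also have "\<dots> = (\<Sum>j<N. \<Sum>i<N. complex_of_real (a i j) * cnj (w $ j) * w $ i)" by (rule sum.swap)
  also have "\<dots> = ?s" using sym by (intro sum.cong refl) (auto simp: mult_ac)
  finally have "cnj ?s = ?s" .
  then have "cnj z * complex_of_real ?n = z * complex_of_real ?n" unfolding s by simp
  moreover have "?n > 0"
  proof -
    have "\<exists>i<N. w $ i \<noteq> 0"
    proof (rule ccontr)
      assume "\<not> ?thesis"
      then have "w = 0\<^sub>v N" using w(1) by (intro eq_vecI) auto
      then show False using w(2) by simp
    qed
    then obtain i where "i < N" "w $ i \<noteq> 0" by blast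
    then show ?thesis by (intro sum_pos2[where i = i]) auto
  qed
  ultimately have "cnj z = z" by (metis less_irrefl mult_cancel_right of_real_eq_0_iff)
  then show ?thesis by (simp add: Reals_cnj_iff)
qed

lemma map_poly_complex_of_real_mult:
  "map_poly complex_of_real (p * q) = map_poly complex_of_real p * map_poly complex_of_real q"
  by (rule poly_eqI) (simp add: coeff_map_poly coeff_mult)

text \<open>Needed so that the list of real eigenvalues has an entry at index 1. A complex root
  exists, it is also a root for the symmetric matrix \<open>Am\<close>, and so it is real.\<close>

lemma Rm_has_root: "\<exists>r. poly (char_poly Rm) r = 0"
proof -
  have "degree (char_poly Rm) = N - 1" using degree_monic_char_poly[OF Rm_carrier] by simp
  then have "degree (map_poly complex_of_real (char_poly Rm)) \<noteq> 0"
    using N2 by (simp add: degree_map_poly)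
  then have "\<not> constant (poly (map_poly complex_of_real (char_poly Rm)))"
    by (simp add: constant_degree)
  then obtain z where z: "poly (map_poly complex_of_real (char_poly Rm)) z = 0"
    using fundamental_theorem_of_algebra by blast
  have "poly (map_poly complex_of_real (char_poly Am)) z = 0"
    unfolding char_poly_Am map_poly_complex_of_real_mult using z by simp
  then have "z \<in> \<real>" by (rule complex_root_real)
  then obtain r where "z = complex_of_real r" by (elim Reals_cases)
  then have "complex_of_real (poly (char_poly Rm) r) = 0" using z by simp
  then show ?thesis by auto
qed

text \<open>The only root above \<open>1 - \<kappa>\<close> is the single 1 of the constant vector.
  If the second entry exceeded the bound, so would the first, and there would be two such
  roots.\<close>

lemma second_eigenvalue_Am: "second_largest_eigenvalue Am \<le> 1 - \<kappa>"
proof -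
  have R0: "char_poly Rm \<noteq> 0" using Rm_root_ne_1 by auto
  let ?M = "proots (char_poly Rm)"
  have "proots (char_poly Am) = proots [:-1, 1 :: real:] + ?M"
    unfolding char_poly_Am using R0 by (intro proots_mult) auto
  also have "proots [:-1, 1 :: real:] = {#1#}"
    using proots_linear_factor[of 1] by simp
  finally have m: "proots (char_poly Am) = add_mset 1 ?M" by simp
  obtain r where "poly (char_poly Rm) r = 0" using Rm_has_root by blast
  then have "r \<in># ?M" using R0 by simp
  then have "size ?M \<ge> 1" by (metis Suc_leI One_nat_def nonempty_has_size empty_not_add_mset multi_member_split)
  define L where "L = eigenvalues_desc Am"
  have mL: "mset L = add_mset 1 ?M" by (simp add: L_def eigenvalues_desc_def m)
  have "length L = size (add_mset 1 ?M)" using mL by (metis size_mset)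
  then have "length L \<ge> 2" using \<open>size ?M \<ge> 1\<close> by simp
  then obtain x y L' where L: "L = x # y # L'" by (cases L rule: remdups_adj.cases) auto
  have "sorted (rev L)" by (simp add: L_def eigenvalues_desc_def)
  then have xy: "y \<le> x" unfolding L by (simp add: sorted_append)
  have "y \<le> 1 - \<kappa>"
  proof (rule ccontr)
    assume "\<not> y \<le> 1 - \<kappa>"
    then have "y > 1 - \<kappa>" "x > 1 - \<kappa>" using xy by auto
    then have big: "size (filter_mset (\<lambda>t. t > 1 - \<kappa>) (mset L)) \<ge> 2" by (simp add: L)
    have "filter_mset (\<lambda>t. t > 1 - \<kappa>) ?M = filter_mset (\<lambda>_. False) ?M"
      using root_gap R0 by (intro filter_mset_cong refl) force
    also have "\<dots> = {#}" by (rule filter_mset_False)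
    finally have e: "filter_mset (\<lambda>t. t > 1 - \<kappa>) ?M = {#}" .
    have "filter_mset (\<lambda>t. t > 1 - \<kappa>) (mset L) = {#1#}"
      unfolding mL using kappa by (simp only: filter_mset_add_mset e) simp
    with big show False by simp
  qed
  then show ?thesis using L by (simp add: second_largest_eigenvalue_def L_def[symmetric])
qed

lemma second_eigenvalue_bound:
  "second_largest_eigenvalue (mat N N (\<lambda>(i, j). a i j)) \<le> 1 - \<kappa>"
  using second_eigenvalue_Am by (simp only: Am_def)

end

section \<open>Chord diagrams\<close>

definition chord_set :: "nat \<Rightarrow> (nat \<Rightarrow> nat) \<Rightarrow> nat set set" where
  "chord_set n s = (\<lambda>x. {x, s x}) ` {1..2 * n}"

lemma chord_setI: "x \<in> {1..2 * n} \<Longrightarrow> {x, s x} \<in> chord_set n s"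
  unfolding chord_set_def by (rule imageI)

lemma chord_setE:
  assumes "c \<in> chord_set n s"
  obtains x where "x \<in> {1..2 * n}" "c = {x, s x}"
  using assms unfolding chord_set_def by blast

lemma chord_set_iff:
  assumes s: "s \<in> matching {1..2 * n}"
  shows "{a, b} \<in> chord_set n s \<longleftrightarrow> a \<in> {1..2 * n} \<and> b = s a"
proof
  assume "{a, b} \<in> chord_set n s"
  then obtain x where x: "x \<in> {1..2 * n}" "{a, b} = {x, s x}" unfolding chord_set_def by blast
  then have "(a = x \<and> b = s x) \<or> (a = s x \<and> b = x)" by (auto simp: doubleton_eq_iff)
  then show "a \<in> {1..2 * n} \<and> b = s a"
  proof
    assume "a = s x \<and> b = x"
    moreover have "s x \<in> {1..2 * n}" using s x(1) unfolding matching_def by blast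
    ultimately show ?thesis using matching_invol[OF s, of x] by simp
  qed (use x in simp)
qed (auto simp: chord_set_def)

lemma chord_set_memD:
  assumes s: "s \<in> matching {1..2 * n}" and c: "c \<in> chord_set n s" and a: "a \<in> c"
  shows "a \<in> {1..2 * n}" "c = {a, s a}"
proof -
  obtain x where x: "x \<in> {1..2 * n}" "c = {x, s x}" using c unfolding chord_set_def by blast
  have ax: "a = x \<or> a = s x" using a x(2) by blast
  have "s x \<in> {1..2 * n}" "s (s x) = x" using s x(1) matching_invol[OF s] unfolding matching_def by blast+
  then show "a \<in> {1..2 * n}" "c = {a, s a}" using ax x by auto
qed

lemma chord_set_diagram:
  assumes s: "s \<in> matching {1..2 * n}"
  shows "chord_diagram n (chord_set n s)"
proof -
  have m: "x \<in> {1..2 * n} \<Longrightarrow> s x \<in> {1..2 * n} \<and> s x \<noteq> x" for x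
    using s unfolding matching_def by blast
  have sub: "chord_set n s \<subseteq> chords n"
  proof
    fix c assume "c \<in> chord_set n s"
    then obtain x where x: "x \<in> {1..2 * n}" "c = {x, s x}" unfolding chord_set_def by blast
    then show "c \<in> chords n" unfolding chords_def polygon_sides_def using m[OF x(1)] by blast
  qed
  have "2 * card (chord_set n s) = card (\<Union>(chord_set n s))"
  proof (rule card_partition)
    show "finite (chord_set n s)" by (simp add: chord_set_def)
    show "finite (\<Union>(chord_set n s))" by (simp add: chord_set_def)
    show "card c = 2" if c: "c \<in> chord_set n s" for c
    proof -
      obtain x where x: "x \<in> {1..2 * n}" "c = {x, s x}" using c by (rule chord_setE)
      then show ?thesis using m[OF x(1)] by (simp add: card_insert_if)
    qed
    show "c \<inter> c' = {}" if "c \<in> chord_set n s" "c' \<in> chord_set n s" "c \<noteq> c'" for c c'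
    proof (rule ccontr)
      assume "c \<inter> c' \<noteq> {}"
      then obtain a where "a \<in> c" "a \<in> c'" by blast
      then show False using chord_set_memD(2)[OF s that(1)] chord_set_memD(2)[OF s that(2)] that(3) by metis
    qed
  qed
  also have "\<Union>(chord_set n s) = {1..2 * n}"
    using m unfolding chord_set_def by blast
  finally have card: "card (chord_set n s) = n" by simp
  have "\<exists>!c. c \<in> chord_set n s \<and> a \<in> c" if a: "a \<in> {1..2 * n}" for a
  proof (rule ex1I[of _ "{a, s a}"])
    show "{a, s a} \<in> chord_set n s \<and> a \<in> {a, s a}" using a by (simp add: chord_set_def)
    show "c = {a, s a}" if "c \<in> chord_set n s \<and> a \<in> c" for c
      using chord_set_memD(2)[OF s, of c a] that by blast
  qed
  then show ?thesis unfolding chord_diagram_def polygon_sides_def using sub card by blast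
qed

lemma chord_diagram_is_chord_set:
  assumes X: "chord_diagram n X"
  obtains s where "s \<in> matching {1..2 * n}" "X = chord_set n s"
proof -
  have ex: "\<exists>!c. c \<in> X \<and> a \<in> c" if "a \<in> {1..2 * n}" for a
    using X that unfolding chord_diagram_def polygon_sides_def by blast
  have form: "\<exists>a b. c = {a, b} \<and> a \<in> {1..2 * n} \<and> b \<in> {1..2 * n} \<and> a \<noteq> b" if "c \<in> X" for c
    using X that unfolding chord_diagram_def chords_def polygon_sides_def by blast
  have "\<exists>b. {a, b} \<in> X \<and> b \<in> {1..2 * n} \<and> b \<noteq> a" if a: "a \<in> {1..2 * n}" for a
  proof -
    obtain c where c: "c \<in> X" "a \<in> c" using ex[OF a] by blast
    obtain x y where xy: "c = {x, y}" "x \<in> {1..2 * n}" "y \<in> {1..2 * n}" "x \<noteq> y" using form[OF c(1)] by blast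
    have "a = x \<or> a = y" using c(2) xy(1) by blast
    then show ?thesis
    proof
      assume "a = x"
      then show ?thesis using c(1) xy by blast
    next
      assume "a = y"
      then have "c = {a, x}" using xy(1) by blast
      then show ?thesis using c(1) xy \<open>a = y\<close> by blast
    qed
  qed
  then obtain b where b: "\<And>a. a \<in> {1..2 * n} \<Longrightarrow> {a, b a} \<in> X \<and> b a \<in> {1..2 * n} \<and> b a \<noteq> a"
    by metis
  define s where "s a = (if a \<in> {1..2 * n} then b a else a)" for a
  have bb: "b (b a) = a" if a: "a \<in> {1..2 * n}" for a
  proof -
    have "{b a, b (b a)} \<in> X" "{a, b a} \<in> X" "b a \<in> {1..2 * n}" using b[OF a] b[of "b a"] by blast+
    then have "{b a, b (b a)} = {a, b a}" using ex[of "b a"] by blast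
    then show ?thesis by (auto simp: doubleton_eq_iff)
  qed
  have m: "s \<in> matching {1..2 * n}"
    unfolding matching_def using b bb by (auto simp: s_def)
  moreover have "X = chord_set n s"
  proof (intro subset_antisym subsetI)
    fix c assume c: "c \<in> X"
    then obtain x y where xy: "c = {x, y}" "x \<in> {1..2 * n}" using form by blast
    have "{x, b x} \<in> X" using b[OF xy(2)] by blast
    then have "c = {x, b x}" using ex[OF xy(2)] c xy(1) by blast
    then show "c \<in> chord_set n s" unfolding chord_set_def using xy(2) by (auto simp: s_def)
  next
    fix c assume "c \<in> chord_set n s"
    then obtain x where "x \<in> {1..2 * n}" "c = {x, s x}" unfolding chord_set_def by blast
    then show "c \<in> X" using b[of x] by (simp add: s_def)
  qed
  ultimately show thesis by (rule that)
qed

lemma inj_chord_set: "inj_on (chord_set n) (matching {1..2 * n})"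
proof (rule inj_onI, rule ext)
  fix s t x assume s: "s \<in> matching {1..2 * n}" and t: "t \<in> matching {1..2 * n}" and eq: "chord_set n s = chord_set n t"
  show "s x = t x"
  proof (cases "x \<in> {1..2 * n}")
    case True
    then have "{x, s x} \<in> chord_set n t" unfolding eq[symmetric] by (simp add: chord_set_def)
    then show ?thesis using chord_set_iff[OF t] by blast
  next
    case False
    then show ?thesis using s t unfolding matching_def by auto
  qed
qed

section \<open>The polygon as a word and its vertex classes\<close>

definition polygon :: "nat \<Rightarrow> nat list" where
  "polygon n = [1..<2 * n + 1]"

lemma polygon_simps: "set (polygon n) = {1..2 * n}" "distinct (polygon n)" "length (polygon n) = 2 * n"
  by (auto simp: polygon_def)

lemma polygon_nth: "k < 2 * n \<Longrightarrow> polygon n ! k = Suc k"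
  unfolding polygon_def by (subst nth_upt) auto

lemma cycle_polygon:
  assumes "y \<in> {1..2 * n}"
  shows "cycle_of_list (polygon n) y = next_vertex n y"
proof -
  have y: "y - 1 < 2 * n" using assms by auto
  have len: "length (polygon n) = 2 * n" by (simp add: polygon_simps)
  have "map (cycle_of_list (polygon n)) (polygon n) = rotate1 (polygon n)"
    using cyclic_rotation[of "polygon n" 1] by (simp add: polygon_simps)
  then have "map (cycle_of_list (polygon n)) (polygon n) ! (y - 1) = rotate1 (polygon n) ! (y - 1)" by simp
  then have "cycle_of_list (polygon n) (polygon n ! (y - 1)) = polygon n ! (Suc (y - 1) mod (2 * n))"
    using y by (simp add: len nth_rotate1)
  moreover have "polygon n ! (y - 1) = y" using polygon_nth[OF y] assms by simp
  moreover have "polygon n ! (Suc (y - 1) mod (2 * n)) = next_vertex n y"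
  proof (cases "y = 2 * n")
    case True
    then show ?thesis using assms by (simp add: polygon_nth next_vertex_def)
  next
    case False
    then show ?thesis using assms by (simp add: polygon_nth next_vertex_def)
  qed
  ultimately show ?thesis by simp
qed

text \<open>The glued pairs are the graph of \<open>next_vertex n \<circ> s\<close>, which is a
  permutation of the vertices, so the classes of the generated equivalence are its orbits.\<close>

lemma num_vertex_classes_eq:
  assumes s: "s \<in> matching {1..2 * n}" and n: "n \<ge> 1"
  shows "num_vertex_classes n (chord_set n s) = num_vertices (polygon n) s"
proof -
  define p where "p = cycle_of_list (polygon n) \<circ> s"
  have perm: "p permutes {1..2 * n}"
    unfolding p_def using matching_permutes[OF s] cycle_permutes[of "polygon n"]
    by (metis permutes_compose polygon_simps(1))
  have px: "p x = next_vertex n (s x)" if "x \<in> {1..2 * n}" for x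
  proof -
    have "s x \<in> {1..2 * n}" using s that unfolding matching_def by blast
    then show ?thesis by (simp add: p_def cycle_polygon)
  qed
  have G: "glued_vertices n (chord_set n s) = {(x, p x) |x. x \<in> {1..2 * n}}"
    unfolding glued_vertices_def using chord_set_iff[OF s] px by fastforce
  let ?R = "vertex_equiv n (chord_set n s)"
  let ?G = "glued_vertices n (chord_set n s)"
  have cls: "?R `` {x} = orbit p x" if x: "x \<in> {1..2 * n}" for x
  proof (intro subset_antisym subsetI)
    fix y assume "y \<in> ?R `` {x}"
    then have "(x, y) \<in> (?G \<union> ?G\<inverse>)\<^sup>*" by (simp add: vertex_equiv_def)
    then show "y \<in> orbit p x"
    proof (induction rule: rtrancl_induct)
      case base
      show ?case using permutes_self_in_orbit[OF _ perm] by simp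
    next
      case (step y z)
      then consider "z = p y" | "y = p z" unfolding G by blast
      then show ?case
      proof cases
        case 1
        then show ?thesis using step.IH by (simp add: orbit.step)
      next
        \<comment> \<open>A step against the gluing relation goes backwards along a permutation of a
          finite set and stays in the orbit.\<close>
        case 2
        have "y \<in> orbit p z" unfolding 2 by (rule orbit.base)
        then have "orbit p y = orbit p z" using perm by (intro orbit_eq_of_mem[of "{1..2 * n}"]) auto
        moreover have "orbit p y = orbit p x" using step.IH perm by (intro orbit_eq_of_mem[of "{1..2 * n}"]) auto
        ultimately show ?thesis using permutes_self_in_orbit[OF _ perm, of z] by simp
      qed
    qed
  next
    fix y assume "y \<in> orbit p x"
    then have "y \<in> {1..2 * n} \<and> (x, y) \<in> (?G \<union> ?G\<inverse>)\<^sup>*"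
    proof induction
      case base
      have "(x, p x) \<in> ?G" unfolding G using x by blast
      then show ?case using permutes_in_image[OF perm] x by blast
    next
      case (step y)
      then have "(y, p y) \<in> ?G" unfolding G by blast
      then show ?case using permutes_in_image[OF perm] step by (metis UnI1 rtrancl.rtrancl_into_rtrancl)
    qed
    then show "y \<in> ?R `` {x}" by (simp add: vertex_equiv_def)
  qed
  have "polygon_vertices n // ?R = (\<lambda>x. ?R `` {x}) ` {1..2 * n}"
    unfolding quotient_def polygon_vertices_def by blast
  also have "\<dots> = orbit p ` {1..2 * n}" by (intro image_cong refl cls)
  finally have "num_vertex_classes n (chord_set n s) = num_orbits {1..2 * n} p"
    by (simp only: num_vertex_classes_def num_orbits_def)
  moreover have "polygon n \<noteq> []" using n polygon_simps(3)[of n] by (metis list.size(3) mult_is_0 not_one_le_zero zero_neq_numeral)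
  ultimately show ?thesis by (simp only: num_vertices_def if_False polygon_simps p_def)
qed

lemma diagrams_eq:
  assumes "v + 2 * g = n + 1" "n \<ge> 1"
  shows "bij_betw (chord_set n) (gluings (polygon n) v) (diagrams n g)"
  unfolding bij_betw_def
proof
  show "inj_on (chord_set n) (gluings (polygon n) v)"
    by (rule inj_on_subset[OF inj_chord_set]) (auto simp: gluings_def polygon_simps)
  have gen: "genus n (chord_set n s) = real g \<longleftrightarrow> num_vertices (polygon n) s = v" if "s \<in> matching {1..2 * n}" for s
  proof -
    have "real v = real n + 1 - 2 * real g" using assms(1) by linarith
    then show ?thesis
      unfolding genus_def num_vertex_classes_eq[OF that assms(2)] by auto
  qed
  show "chord_set n ` gluings (polygon n) v = diagrams n g"
  proof (intro subset_antisym subsetI)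
    fix X assume "X \<in> chord_set n ` gluings (polygon n) v"
    then obtain s where "s \<in> matching {1..2 * n}" "num_vertices (polygon n) s = v" "X = chord_set n s"
      by (auto simp: gluings_def polygon_simps)
    then show "X \<in> diagrams n g" using gen chord_set_diagram by (simp add: diagrams_def)
  next
    fix X assume X: "X \<in> diagrams n g"
    then have "chord_diagram n X" by (simp add: diagrams_def)
    then obtain s where s: "s \<in> matching {1..2 * n}" "X = chord_set n s" by (rule chord_diagram_is_chord_set)
    then have "s \<in> gluings (polygon n) v" using gen X by (simp add: diagrams_def gluings_def polygon_simps)
    then show "X \<in> chord_set n ` gluings (polygon n) v" using s(2) by blast
  qed
qed

section \<open>Swaps of matchings and swaps of chord sets\<close>

lemma sw_chord_swap:
  assumes s: "s \<in> matching {1..2 * n}" and st: "sw s t"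
  shows "chord_swap (chord_set n s) (chord_set n t)"
proof -
  obtain x y where xy: "x \<noteq> y" "s x \<noteq> x" "s y \<noteq> y" "s x \<noteq> y" and t: "t = swp x y \<circ> s \<circ> swp x y"
    using st unfolding sw_def by blast
  let ?V = "{1..2 * n}"
  have inv: "s (s z) = z" for z using matching_invol[OF s] .
  have V: "x \<in> ?V" "y \<in> ?V" "s x \<in> ?V" "s y \<in> ?V" using s xy unfolding matching_def by blast+
  have syx: "s y \<noteq> x" using inv xy by metis
  have sxy: "s x \<noteq> s y" using inv xy by metis
  have tv: "t x = s y" "t y = s x" "t (s x) = y" "t (s y) = x"
    using xy syx inv by (simp_all add: t)
  have to: "t z = s z" if "z \<notin> {x, y, s x, s y}" for z
  proof -
    have "s z \<noteq> x" "s z \<noteq> y" using that inv[of z] by auto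
    then show ?thesis using that by (simp add: t)
  qed
  have "chord_set n t = (chord_set n s - {{x, s x}, {y, s y}}) \<union> {{x, s y}, {s x, y}}"
  proof (intro subset_antisym subsetI)
    fix c assume "c \<in> chord_set n t"
    then obtain z where z: "z \<in> ?V" "c = {z, t z}" by (rule chord_setE)
    show "c \<in> (chord_set n s - {{x, s x}, {y, s y}}) \<union> {{x, s y}, {s x, y}}"
    proof (cases "z \<in> {x, y, s x, s y}")
      case True
      then have "c = {x, s y} \<or> c = {s x, y}"
        using z(2) tv by (elim insertE emptyE) (simp_all add: doubleton_eq_iff)
      then show ?thesis by blast
    next
      case False
      have "c = {z, s z}" using z(2) to[OF False] by simp
      then have "c \<in> chord_set n s" using z(1) chord_setI by metis
      moreover have "z \<in> c" using z(2) by simp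
      then have "c \<noteq> {x, s x}" "c \<noteq> {y, s y}" using False by auto
      ultimately show ?thesis by simp
    qed
  next
    fix c assume c: "c \<in> (chord_set n s - {{x, s x}, {y, s y}}) \<union> {{x, s y}, {s x, y}}"
    show "c \<in> chord_set n t"
    proof (cases "c \<in> {{x, s y}, {s x, y}}")
      case True
      then have "c = {x, t x} \<or> c = {y, t y}"
        using tv by (elim insertE emptyE) (simp_all add: doubleton_eq_iff)
      then show ?thesis using chord_setI[OF V(1)] chord_setI[OF V(2)] by metis
    next
      case False
      then have cs: "c \<in> chord_set n s" "c \<noteq> {x, s x}" "c \<noteq> {y, s y}" using c by simp_all
      obtain z where z: "z \<in> ?V" "c = {z, s z}" using cs(1) by (rule chord_setE)
      have "z \<notin> {x, y, s x, s y}"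
      proof
        assume "z \<in> {x, y, s x, s y}"
        then show False
          using cs(2,3) z(2) inv[of x] inv[of y] by (elim insertE emptyE) (simp_all add: doubleton_eq_iff)
      qed
      then have "t z = s z" by (rule to)
      then show ?thesis using chord_setI[OF z(1), of t] z(2) by simp
    qed
  qed
  moreover have "{x, s x} \<in> chord_set n s" "{y, s y} \<in> chord_set n s"
    by (rule chord_setI[OF V(1)], rule chord_setI[OF V(2)])
  moreover have "{x, s x} \<noteq> {y, s y}" using xy by (auto simp: doubleton_eq_iff)
  ultimately show ?thesis unfolding chord_swap_def by blast
qed

text \<open>To undo a swap, the two new chords must not have been present before; this holds because
  partners in a diagram are unique. The symmetry of the kernel rests on it.\<close>

lemma chord_swap_sym:
  assumes X: "chord_diagram n X" and swap: "chord_swap X Y"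
  shows "chord_swap Y X"
proof -
  obtain a b c d where abcd: "{a, b} \<in> X" "{c, d} \<in> X" "{a, b} \<noteq> {c, d}"
    and Y: "Y = (X - {{a, b}, {c, d}}) \<union> {{a, c}, {b, d}} \<or> Y = (X - {{a, b}, {c, d}}) \<union> {{a, d}, {b, c}}"
    using swap unfolding chord_swap_def by (elim exE conjE) (rule that)
  obtain s where s: "s \<in> matching {1..2 * n}" "X = chord_set n s" using chord_diagram_is_chord_set[OF X] .
  have iff: "{u, w} \<in> X \<longleftrightarrow> u \<in> {1..2 * n} \<and> w = s u" for u w using chord_set_iff[OF s(1)] s(2) by simp
  have inv: "s (s z) = z" for z using matching_invol[OF s(1)] .
  have b: "b = s a" "d = s c" "a \<in> {1..2 * n}" "c \<in> {1..2 * n}" using abcd iff by blast+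
  have ne: "a \<noteq> c" "a \<noteq> d" "b \<noteq> c" "b \<noteq> d" "a \<noteq> b" "c \<noteq> d"
  proof -
    have fp: "s z \<noteq> z" if "z \<in> {1..2 * n}" for z using s(1) that unfolding matching_def by blast
    show ac: "a \<noteq> c" using abcd(3) b by auto
    show "a \<noteq> d"
    proof
      assume "a = d"
      then have "b = c" using b inv by metis
      with \<open>a = d\<close> show False using abcd(3) by auto
    qed
    show "b \<noteq> c"
    proof
      assume "b = c"
      then have "d = a" using b inv by metis
      with \<open>b = c\<close> show False using abcd(3) by auto
    qed
    show "b \<noteq> d" using b inv ac by metis
    show "a \<noteq> b" "c \<noteq> d" using b fp[of a] fp[of c] by auto
  qed
  have notin: "{a, c} \<notin> X" "{b, d} \<notin> X" "{a, d} \<notin> X" "{b, c} \<notin> X"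
    using iff b ne inv by auto
  \<comment> \<open>Both recombinations at once: \<open>e\<close> and \<open>f\<close> are
    \<open>c\<close> and \<open>d\<close> in either order.\<close>
  have key: "chord_swap ((X - {{a, b}, {c, d}}) \<union> {{a, e}, {b, f}}) X"
    if ef: "{c, d} = {e, f}" "{a, e} \<notin> X" "{b, f} \<notin> X" "{a, e} \<noteq> {b, f}" for e f
  proof -
    let ?Y = "(X - {{a, b}, {c, d}}) \<union> {{a, e}, {b, f}}"
    have "X = (?Y - {{a, e}, {b, f}}) \<union> {{a, b}, {e, f}}"
      using abcd ef by auto
    then show ?thesis unfolding chord_swap_def using ef(4) by blast
  qed
  have "{a, c} \<noteq> {b, d}" "{a, d} \<noteq> {b, c}" using ne by (auto simp: doubleton_eq_iff)
  then have "chord_swap ((X - {{a, b}, {c, d}}) \<union> {{a, c}, {b, d}}) X"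
    "chord_swap ((X - {{a, b}, {c, d}}) \<union> {{a, d}, {b, c}}) X"
    using key[of c d] key[of d c] notin by (auto simp: insert_commute)
  then show ?thesis using Y by blast
qed

section \<open>Spectral gap of the chain\<close>

lemma Poincare_diagrams:
  assumes v: "v + 2 * g = n + 1" "v \<ge> 2"
  shows "Poincare chord_swap (diagrams n g) (real (2 * n) ^ (28 * g + 3))"
  unfolding Poincare_def
proof
  fix F
  have n: "n \<ge> 1" using v by simp
  have bij: "bij_betw (chord_set n) (gluings (polygon n) v) (diagrams n g)" by (rule diagrams_eq[OF v(1) n])
  have fin: "finite (diagrams n g)" using bij finite_dg by (metis bij_betw_finite)
  have po: "Poincare sw (gluings (polygon n) v) (real (2 * n) ^ (28 * g + 3))"
    using Poincare_all[of "polygon n" n v g] v by (simp add: polygon_simps)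
  show "pair_energy (diagrams n g) (diagrams n g) F \<le> real (2 * n) ^ (28 * g + 3) * real (card (diagrams n g)) * edge_energy chord_swap (diagrams n g) F"
  proof (rule Poincare_image[OF bij fin order.refl po])
    fix s t assume "s \<in> gluings (polygon n) v" "sw s t"
    then show "chord_swap (chord_set n s) (chord_set n t)"
      by (intro sw_chord_swap) (auto simp: gluings_def polygon_simps)
  qed simp
qed

text \<open>The enumeration is some list of \<open>S\<close> without repetition, so sums over
  indices are sums over states and the bound for matrices indexed by numbers applies.\<close>

lemma transition_matrix_gap:
  fixes p :: "'s \<Rightarrow> 's \<Rightarrow> real"
  assumes fin: "finite S" and two: "card S \<ge> 2" and kappa: "\<kappa> > 0"
    and sym: "\<And>X Y. X \<in> S \<Longrightarrow> Y \<in> S \<Longrightarrow> p X Y = p Y X"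
    and row: "\<And>X. X \<in> S \<Longrightarrow> (\<Sum>Y\<in>S. p X Y) = 1"
    and gap: "\<And>F. \<kappa> * pair_energy S S F \<le> real (card S) * (\<Sum>X\<in>S. \<Sum>Y\<in>S. p X Y * (F X - F Y)\<^sup>2)"
  shows "second_largest_eigenvalue (transition_matrix S p) \<le> 1 - \<kappa>"
proof -
  let ?N = "card S"
  define e where "e = enumeration S"
  have "\<exists>xs. set xs = S \<and> distinct xs" using finite_distinct_list[OF fin] by blast
  then have "set e = S \<and> distinct e" unfolding e_def enumeration_def by (rule someI_ex)
  then have e: "set e = S" "distinct e" by auto
  have len: "length e = ?N" using distinct_card[OF e(2)] e(1) by simp
  have bij: "bij_betw (\<lambda>i. e ! i) {..<?N} S"
    by (rule bij_betw_nth[OF e(2)]) (simp_all only: len e(1))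
  have mem: "e ! i \<in> S" if "i < ?N" for i using that e len by auto
  have reidx: "(\<Sum>i<?N. h (e ! i)) = (\<Sum>X\<in>S. h X)" for h :: "'s \<Rightarrow> real"
    by (rule sum.reindex_bij_betw[OF bij])
  have reidx2: "(\<Sum>i<?N. \<Sum>j<?N. h (e ! i) (e ! j)) = (\<Sum>X\<in>S. \<Sum>Y\<in>S. h X Y)" for h :: "'s \<Rightarrow> 's \<Rightarrow> real"
  proof -
    have inner: "(\<Sum>j<?N. h (e ! i) (e ! j)) = (\<Sum>Y\<in>S. h (e ! i) Y)" for i by (rule reidx)
    show ?thesis unfolding inner by (rule reidx)
  qed
  have lift_fun: "\<exists>F. \<forall>i<?N. F (e ! i) = f i" for f :: "nat \<Rightarrow> real"
  proof -
    have inj: "inj_on (\<lambda>i. e ! i) {..<?N}" using bij by (rule bij_betw_imp_inj_on)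
    have "f (inv_into {..<?N} (\<lambda>i. e ! i) (e ! i)) = f i" if "i < ?N" for i
      using inv_into_f_f[OF inj, of i] that by simp
    then show ?thesis by (intro exI[of _ "\<lambda>X. f (inv_into {..<?N} (\<lambda>i. e ! i) X)"]) simp
  qed
  have "second_largest_eigenvalue (mat ?N ?N (\<lambda>(i, j). p (e ! i) (e ! j))) \<le> 1 - \<kappa>"
  proof (rule second_eigenvalue_bound[OF _ _ _ kappa two])
    show "p (e ! i) (e ! j) = p (e ! j) (e ! i)" if "i < ?N" "j < ?N" for i j
      using that by (intro sym mem)
    show "(\<Sum>j<?N. p (e ! i) (e ! j)) = 1" if "i < ?N" for i
      using row[OF mem[OF that]] reidx[of "p (e ! i)"] by simp
    fix f :: "nat \<Rightarrow> real"
    obtain F where F: "\<forall>i<?N. F (e ! i) = f i" using lift_fun[of f] by blast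
    have "(\<Sum>i<?N. \<Sum>j<?N. (f i - f j)\<^sup>2) = (\<Sum>i<?N. \<Sum>j<?N. (F (e ! i) - F (e ! j))\<^sup>2)"
      using F by (intro sum.cong refl) simp
    also have "\<dots> = pair_energy S S F" unfolding pair_energy_def by (rule reidx2)
    finally have 1: "(\<Sum>i<?N. \<Sum>j<?N. (f i - f j)\<^sup>2) = pair_energy S S F" .
    have "(\<Sum>i<?N. \<Sum>j<?N. p (e ! i) (e ! j) * (f i - f j)\<^sup>2) = (\<Sum>i<?N. \<Sum>j<?N. p (e ! i) (e ! j) * (F (e ! i) - F (e ! j))\<^sup>2)"
      using F by (intro sum.cong refl) simp
    also have "\<dots> = (\<Sum>X\<in>S. \<Sum>Y\<in>S. p X Y * (F X - F Y)\<^sup>2)"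
      by (rule reidx2)
    finally show "\<kappa> * (\<Sum>i<?N. \<Sum>j<?N. (f i - f j)\<^sup>2) \<le> real ?N * (\<Sum>i<?N. \<Sum>j<?N. p (e ! i) (e ! j) * (f i - f j)\<^sup>2)"
      using gap[of F] 1 by simp
  qed
  then show ?thesis
    by (simp only: transition_matrix_def e_def)
qed

lemma spectral_gap_bound:
  assumes g: "g > 0" and n: "n > 2 * g"
  shows "spectral_gap n g \<ge> 1 / (2 * real n ^ 2 * real (2 * n) ^ (28 * g + 3))"
proof -
  define v where "v = n + 1 - 2 * g"
  have v: "v + 2 * g = n + 1" "v \<ge> 2" using n by (auto simp: v_def)
  have n3: "n \<ge> 3" using g n by simp
  let ?S = "diagrams n g" and ?K = "real (2 * n) ^ (28 * g + 3)" and ?b = "4 * real (n choose 2)"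
  have bij: "bij_betw (chord_set n) (gluings (polygon n) v) ?S" using v n3 by (intro diagrams_eq) auto
  have fin: "finite ?S" using bij finite_dg by (metis bij_betw_finite)
  have two: "card ?S \<ge> 2"
    using gluings_card_ge_2[of "polygon n" n v g] v g bij_betw_same_card[OF bij] by (simp add: polygon_simps)
  have K: "?K > 0" using n3 by simp
  have b: "?b > 0" using n3 by (simp add: binomial_eq_0_iff)
  have bn: "?b \<le> 2 * real n ^ 2"
  proof -
    have "real (n choose 2) * 2 \<le> real n ^ 2"
      using n3 by (simp add: choose_two of_nat_diff real_of_nat_div power2_eq_square)
    then show ?thesis by simp
  qed
  have symS: "chord_swap X Y \<longleftrightarrow> chord_swap Y X" if "X \<in> ?S" "Y \<in> ?S" for X Y
    using that chord_swap_sym[of n] unfolding diagrams_def by blast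
  \<comment> \<open>The probability \<open>1 / ?b\<close> of a single swap, divided by the Poincare
    constant \<open>?K\<close>.\<close>
  define \<kappa> where "\<kappa> = 1 / (?b * ?K)"
  have kap: "\<kappa> > 0" using K b by (simp add: \<kappa>_def)
  have "second_largest_eigenvalue (transition_matrix ?S (swap_kernel n g)) \<le> 1 - \<kappa>"
  proof (rule transition_matrix_gap[OF fin two kap])
    show "swap_kernel n g X Y = swap_kernel n g Y X" if "X \<in> ?S" "Y \<in> ?S" for X Y
      using symS[OF that] by (auto simp: swap_kernel_def swap_prob_def)
    show "(\<Sum>Y\<in>?S. swap_kernel n g X Y) = 1" if X: "X \<in> ?S" for X
    proof -
      have "(\<Sum>Y\<in>?S. swap_kernel n g X Y) = swap_kernel n g X X + (\<Sum>Y\<in>?S - {X}. swap_kernel n g X Y)"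
        using fin X by (rule sum.remove)
      also have "(\<Sum>Y\<in>?S - {X}. swap_kernel n g X Y) = (\<Sum>Y\<in>?S - {X}. swap_prob n X Y)"
        by (intro sum.cong refl) (auto simp: swap_kernel_def)
      finally show ?thesis by (simp add: swap_kernel_def)
    qed
    fix F :: "nat set set \<Rightarrow> real"
    let ?D = "edge_energy chord_swap ?S F"
    \<comment> \<open>Diagonal entries multiply the difference zero, and off the diagonal every
      ordered swap has weight \<open>1 / ?b\<close>.\<close>
    have "(\<Sum>X\<in>?S. \<Sum>Y\<in>?S. swap_kernel n g X Y * (F X - F Y)\<^sup>2)
        = (\<Sum>X\<in>?S. \<Sum>Y\<in>?S. (if chord_swap X Y then (F X - F Y)\<^sup>2 else 0) / ?b)"
      by (intro sum.cong refl) (auto simp: swap_kernel_def swap_prob_def)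
    also have "\<dots> = (\<Sum>p\<in>?S \<times> ?S. if chord_swap (fst p) (snd p) then (F (fst p) - F (snd p))\<^sup>2 else 0) / ?b"
      by (simp add: sum_divide_distrib sum.cartesian_product case_prod_unfold)
    also have "\<dots> = ?D / ?b"
      unfolding edge_energy_def using fin by (simp add: sum.inter_filter)
    finally have e: "(\<Sum>X\<in>?S. \<Sum>Y\<in>?S. swap_kernel n g X Y * (F X - F Y)\<^sup>2) = ?D / ?b" .
    have "pair_energy ?S ?S F \<le> ?K * real (card ?S) * ?D"
      using Poincare_diagrams[OF v] by (simp add: Poincare_def)
    then have "\<kappa> * pair_energy ?S ?S F \<le> \<kappa> * (?K * real (card ?S) * ?D)"
      using kap by (intro mult_left_mono) auto
    also have "\<dots> = real (card ?S) * (?D / ?b)"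
      using K b by (simp add: \<kappa>_def)
    finally show "\<kappa> * pair_energy ?S ?S F \<le> real (card ?S) * (\<Sum>X\<in>?S. \<Sum>Y\<in>?S. swap_kernel n g X Y * (F X - F Y)\<^sup>2)"
      unfolding e .
  qed
  then have "\<kappa> \<le> spectral_gap n g" by (simp add: spectral_gap_def)
  moreover have "1 / (2 * real n ^ 2 * ?K) \<le> \<kappa>"
    unfolding \<kappa>_def using bn K b by (intro divide_left_mono mult_right_mono mult_pos_pos) auto
  ultimately show ?thesis by linarith
qed

theorem theorem1p2:
  fixes g :: nat
  assumes "g > 0"
  shows "\<exists>C::real. C > 0 \<and>
           (\<forall>n::nat. n > 2 * g \<longrightarrow>
              spectral_gap n g \<ge> C * real n powr (- 1488 * real g + 616))"
proof (intro exI conjI allI impI)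
  \<comment> \<open>Collects the powers of two in the bound
    \<open>1 / (2 n^2 (2 n)^(28 g + 3))\<close>.\<close>
  let ?C = "1 / (2 * 2 ^ (28 * g + 3)) :: real"
  show "?C > 0" by simp
  fix n :: nat assume n: "n > 2 * g"
  then have n1: "real n \<ge> 1" by simp
  \<comment> \<open>The exponents compare because \<open>28 g + 5 \<le> 1488 g - 616\<close> amounts
    to \<open>621 \<le> 1460 g\<close>, which holds from \<open>g = 1\<close> on.\<close>
  have "?C * real n powr (- 1488 * real g + 616) \<le> ?C * real n powr (- real (28 * g + 5))"
    using n1 assms by (intro mult_left_mono powr_mono) auto
  also have "real n powr (- real (28 * g + 5)) = 1 / real n ^ (28 * g + 5)"
  proof -
    have "real n powr real (28 * g + 5) = real n ^ (28 * g + 5)"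
      using n1 by (intro powr_realpow) simp
    then show ?thesis by (simp only: powr_minus inverse_eq_divide)
  qed
  also have "?C * (1 / real n ^ (28 * g + 5)) = 1 / (2 * real n ^ 2 * real (2 * n) ^ (28 * g + 3))"
    by (simp add: power_mult_distrib power_add power2_eq_square eval_nat_numeral mult_ac)
  also have "\<dots> \<le> spectral_gap n g" by (rule spectral_gap_bound[OF assms n])
  finally show "?C * real n powr (- 1488 * real g + 616) \<le> spectral_gap n g" .
qed

end
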